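(* Let $(C,o)$ be a reduced complex analytic curve singularity, with multiplicity $\mathrm{mult}(C,o)$, lattice cohomology $\mathbb{H}^0=\mathbb{H}^0(C,o)$ and reduced lattice cohomology $\mathbb{H}^0_{\mathrm{red}}=\mathbb{H}^0_{\mathrm{red}}(C,o)$. Then: (a) $\mathbb{H}^0_{\mathrm{red}}=0$ if and only if $(C,o)$ is smooth, i.e. $\mathrm{mult}(C,o)=1$. (b) $\mathbb{H}^0_{\mathrm{red}}\neq0$ but $\mathbb{H}^0_{2n}=0$ for all $n<0$ (the latter being equivalent to $\min\{n\mid S_n\ne\emptyset\}\ge0$) if and only if $\mathrm{mult}(C,o)=2$. In this case $(C,o)$ is a plane curve singularity with a local equation of type $x^2+y^k=0$, $k\ge2$. (c) $\mathbb{H}^0_{2n}\ne0$ for some $n<0$ (equivalently $\min\{n\mid S_n\neq\emptyset\}<0$) if and only if $\mathrm{mult}(C,o)>2$.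
   Context: Let $(C,o)=\bigcup_{i=1}^r(C_i,o)$ be the decomposition into irreducible branches, $\mathcal{O}=\mathcal{O}_{C,o}$ the local ring, $n_i:(\mathbb{C},0)\to(C_i,o)$ the normalization of the $i$-th branch with parameter $t_i$, and $\mathfrak{v}_i(g)=\mathrm{ord}_{t_i}(n_i^*g)\in\mathbb{Z}_{\ge0}\cup\{\infty\}$ for $g\in\mathcal{O}$. For $\ell\in\mathbb{Z}_{\ge 0}^r$ put $\mathcal{F}(\ell)=\{g\in\mathcal{O}\mid \mathfrak{v}_i(g)\ge\ell_i\ \forall i\}$, $\mathfrak{h}(\ell)=\dim_{\mathbb{C}}\mathcal{O}/\mathcal{F}(\ell)$ and $w_0(\ell)=2\mathfrak{h}(\ell)-|\ell|$ with $|\ell|=\sum_i\ell_i$. $\mathbb{R}^r_{\ge0}$ is decomposed into closed unit cubes with vertices $\ell+\sum_{i\in K}e_i$, $K\subset I$ (for $\ell\in\mathbb{Z}_{\ge0}^r$, $I\subset\{1,\dots,r\}$; dimension $\#I\ge0$). The weight of a cube is the maximum of $w_0$ over its vertices. $S_n$ is the union of all closed cubes of weight $\le n$; it is a finite cubical complex, empty for $n\ll0$. $\mathbb{H}^0_{2n}(C,o)=H^0(S_n,\mathbb{Z})$, $\mathbb{H}^0=\bigoplus_n\mathbb{H}^0_{2n}$, and $\mathbb{H}^0_{\mathrm{red}}=\bigoplus_n\widetilde H^0(S_n,\mathbb{Z})$ (reduced cohomology; for $S_n=\emptyset$ one has $\widetilde H^0=0$). $\mathrm{mult}(C,o)$ is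 the multiplicity of the local ring $\mathcal{O}$ (the degree of a generic linear projection $(C,o)\to(\mathbb{C},0)$). *)

theory Defs
  imports
    "HOL-Complex_Analysis.Complex_Analysis"
    "HOL-Homology.Homology"
    "HOL-Algebra.QuotRing"
    "HOL-Algebra.Ideal_Product"
    "HOL-Algebra.Embedded_Algebras"
begin

subsection \<open>Holomorphic germs in several variables\<close>

text \<open>Holomorphic means complex (Frechet) differentiable on an open set. Germs are represented by
  total functions; only the values near the base point matter.\<close>

definition holomorphic_vec_on :: "(complex^'n \<Rightarrow> complex) \<Rightarrow> (complex^'n) set \<Rightarrow> bool" where
  "holomorphic_vec_on f U \<longleftrightarrow>
     (\<forall>x\<in>U. \<exists>D. (f has_derivative D) (at x) \<and> (\<forall>c v. D (c *s v) = c * D v))"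

definition holomorphic_germ :: "complex^'n \<Rightarrow> (complex^'n \<Rightarrow> complex) \<Rightarrow> bool" where
  "holomorphic_germ p f \<longleftrightarrow> (\<exists>U. open U \<and> p \<in> U \<and> holomorphic_vec_on f U)"

definition holomorphic_map_germ :: "complex^'n \<Rightarrow> (complex^'n \<Rightarrow> complex^'m) \<Rightarrow> bool" where
  "holomorphic_map_germ p F \<longleftrightarrow> (\<forall>j. holomorphic_germ p (\<lambda>x. F x $ j))"

subsection \<open>Germs of analytic sets\<close>

definition analytic_germ :: "complex^'n \<Rightarrow> (complex^'n) set \<Rightarrow> bool" where
  "analytic_germ p A \<longleftrightarrow>
     (\<exists>U fs. open U \<and> p \<in> U \<and> finite fs \<and> (\<forall>f\<in>fs. holomorphic_vec_on f U) \<and>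
             A \<inter> U = {x\<in>U. \<forall>f\<in>fs. f x = 0})"

definition germ_subset :: "'a::topological_space \<Rightarrow> 'a set \<Rightarrow> 'a set \<Rightarrow> bool" where
  "germ_subset p A B \<longleftrightarrow> (\<forall>\<^sub>F x in nhds p. x \<in> A \<longrightarrow> x \<in> B)"

definition germ_eq :: "'a::topological_space \<Rightarrow> 'a set \<Rightarrow> 'a set \<Rightarrow> bool" where
  "germ_eq p A B \<longleftrightarrow> germ_subset p A B \<and> germ_subset p B A"

definition irreducible_germ :: "complex^'n \<Rightarrow> (complex^'n) set \<Rightarrow> bool" where
  "irreducible_germ p A \<longleftrightarrow>
     analytic_germ p A \<and> p \<in> A \<and>
     (\<forall>A1 A2. analytic_germ p A1 \<longrightarrow> analytic_germ p A2 \<longrightarrow> germ_eq p A (A1 \<union> A2) \<longrightarrow>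
        germ_eq p A A1 \<or> germ_eq p A A2)"

text \<open>Isomorphism of germs of reduced complex spaces, given by mutually inverse restrictions of
  ambient holomorphic map germs; the ambient dimensions may differ.\<close>

definition germ_isomorphic ::
  "complex^'n \<Rightarrow> (complex^'n) set \<Rightarrow> complex^'m \<Rightarrow> (complex^'m) set \<Rightarrow> bool" where
  "germ_isomorphic p A q B \<longleftrightarrow>
     (\<exists>F G. holomorphic_map_germ p F \<and> holomorphic_map_germ q G \<and> F p = q \<and> G q = p \<and>
        (\<forall>\<^sub>F x in nhds p. x \<in> A \<longrightarrow> F x \<in> B \<and> G (F x) = x) \<and>
        (\<forall>\<^sub>F y in nhds q. y \<in> B \<longrightarrow> G y \<in> A \<and> F (G y) = y))"

subsection \<open>Curve singularities with their branches and normalizations\<close>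

text \<open>The normalization of an irreducible curve germ: a holomorphic homeomorphism from a disc onto
  a neighbourhood of \<open>p\<close> in the branch (hence a finite map with smooth source) which is immersive,
  i.e. biholomorphic onto its image, away from the origin.\<close>

definition normalization_germ ::
  "complex^'n \<Rightarrow> (complex^'n) set \<Rightarrow> (complex \<Rightarrow> complex^'n) \<Rightarrow> bool" where
  "normalization_germ p A \<nu> \<longleftrightarrow>
     \<nu> 0 = p \<and>
     (\<exists>\<epsilon>>0. \<exists>U. open U \<and> p \<in> U \<and>
        (\<forall>j. (\<lambda>t. \<nu> t $ j) holomorphic_on ball 0 \<epsilon>) \<and>
        (\<exists>g. homeomorphism (ball 0 \<epsilon>) (A \<inter> U) \<nu> g) \<and>
        (\<forall>t\<in>ball 0 \<epsilon> - {0}. \<exists>j. deriv (\<lambda>s. \<nu> s $ j) t \<noteq> 0))"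

text \<open>A reduced curve germ \<open>(C, p)\<close>, embedded in some \<open>(\<complex>\<^sup>N, p)\<close>, with its irreducible components
  \<open>B i\<close> indexed by a finite type (so the number of branches is \<open>r = CARD('r) \<ge> 1\<close>) and a
  normalization \<open>\<nu> i\<close> of each of them. That every component is one-dimensional is contained in
  the existence of its parametrization by a disc.\<close>

definition curve_singularity ::
  "complex^'n \<Rightarrow> (complex^'n) set \<Rightarrow> ('r::finite \<Rightarrow> (complex^'n) set) \<Rightarrow>
   ('r \<Rightarrow> complex \<Rightarrow> complex^'n) \<Rightarrow> bool" where
  "curve_singularity p C B \<nu> \<longleftrightarrow>
     analytic_germ p C \<and>
     (\<forall>i. irreducible_germ p (B i)) \<and>
     germ_eq p C (\<Union>i. B i) \<and>
     (\<forall>i j. i \<noteq> j \<longrightarrow> \<not> germ_subset p (B i) (B j)) \<and>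
     (\<forall>i. normalization_germ p (B i) (\<nu> i))"

definition smooth_curve_germ :: "complex^'n \<Rightarrow> (complex^'n) set \<Rightarrow> bool" where
  "smooth_curve_germ p C \<longleftrightarrow> germ_isomorphic p C (0 :: complex^1) UNIV"

subsection \<open>The local ring\<close>

definition ambient_ring :: "complex^'n \<Rightarrow> (complex^'n \<Rightarrow> complex) ring" where
  "ambient_ring p =
     \<lparr>carrier = {f. holomorphic_germ p f}, monoid.mult = (\<lambda>f g x. f x * g x), one = (\<lambda>x. 1),
      zero = (\<lambda>x. 0), add = (\<lambda>f g x. f x + g x)\<rparr>"

definition vanishing_ideal :: "complex^'n \<Rightarrow> (complex^'n) set \<Rightarrow> (complex^'n \<Rightarrow> complex) set" where
  "vanishing_ideal p C = {f. holomorphic_germ p f \<and> (\<forall>\<^sub>F x in nhds p. x \<in> C \<longrightarrow> f x = 0)}"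

text \<open>Functions that agree near \<open>p\<close> differ by an element of the vanishing ideal, so this quotient
  also identifies functions with the same germ.\<close>

definition local_ring :: "complex^'n \<Rightarrow> (complex^'n) set \<Rightarrow> (complex^'n \<Rightarrow> complex) set ring" where
  "local_ring p C = ambient_ring p Quot vanishing_ideal p C"

definition local_const :: "complex^'n \<Rightarrow> (complex^'n) set \<Rightarrow> complex \<Rightarrow> (complex^'n \<Rightarrow> complex) set" where
  "local_const p C c = vanishing_ideal p C +>\<^bsub>ambient_ring p\<^esub> (\<lambda>x. c)"

text \<open>\<open>dim\<^sub>\<complex> \<O>/J\<close> for an ideal \<open>J\<close> of the local ring \<open>\<O>\<close>, the scalars being the classes of the
  constant functions.\<close>

definition codim_ideal ::
  "complex^'n \<Rightarrow> (complex^'n) set \<Rightarrow> (complex^'n \<Rightarrow> complex) set set \<Rightarrow> nat" where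
  "codim_ideal p C J =
     (let Q = local_ring p C Quot J
      in ring.dim Q (range (\<lambda>c. J +>\<^bsub>local_ring p C\<^esub> local_const p C c)) (carrier Q))"

definition max_ideal :: "complex^'n \<Rightarrow> (complex^'n) set \<Rightarrow> (complex^'n \<Rightarrow> complex) set set" where
  "max_ideal p C = {g \<in> carrier (local_ring p C). \<forall>f\<in>g. f p = 0}"

primrec max_ideal_power ::
  "complex^'n \<Rightarrow> (complex^'n) set \<Rightarrow> nat \<Rightarrow> (complex^'n \<Rightarrow> complex) set set" where
  "max_ideal_power p C 0 = carrier (local_ring p C)"
| "max_ideal_power p C (Suc k) =
     ideal_prod (local_ring p C) (max_ideal_power p C k) (max_ideal p C)"

text \<open>The Hilbert--Samuel multiplicity
  \<open>e(\<O>) = lim d! \<cdot> length (\<O>/\<m>\<^sup>k) / k\<^sup>d\<close>, here in dimension \<open>d = 1\<close>.\<close>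

definition multiplicity_curve :: "complex^'n \<Rightarrow> (complex^'n) set \<Rightarrow> real" where
  "multiplicity_curve p C =
     lim (\<lambda>k. real (codim_ideal p C (max_ideal_power p C k)) / real k)"

subsection \<open>Valuations, Hilbert function and weights\<close>

definition ord0 :: "(complex \<Rightarrow> complex) \<Rightarrow> enat" where
  "ord0 f = (if \<forall>\<^sub>F t in nhds 0. f t = 0 then \<infinity> else enat (nat (zorder f 0)))"

text \<open>The value does not depend on the chosen representative \<open>f\<close> of the class \<open>g\<close>.\<close>

definition branch_val ::
  "('r \<Rightarrow> complex \<Rightarrow> complex^'n) \<Rightarrow> 'r \<Rightarrow> (complex^'n \<Rightarrow> complex) set \<Rightarrow> enat" where
  "branch_val \<nu> i g = ord0 ((SOME f. f \<in> g) \<circ> \<nu> i)"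

definition val_filtration ::
  "complex^'n \<Rightarrow> (complex^'n) set \<Rightarrow> ('r::finite \<Rightarrow> complex \<Rightarrow> complex^'n) \<Rightarrow> nat^'r \<Rightarrow>
   (complex^'n \<Rightarrow> complex) set set" where
  "val_filtration p C \<nu> l =
     {g \<in> carrier (local_ring p C). \<forall>i. enat (l $ i) \<le> branch_val \<nu> i g}"

definition hilbert_fun ::
  "complex^'n \<Rightarrow> (complex^'n) set \<Rightarrow> ('r::finite \<Rightarrow> complex \<Rightarrow> complex^'n) \<Rightarrow> nat^'r \<Rightarrow> nat" where
  "hilbert_fun p C \<nu> l = codim_ideal p C (val_filtration p C \<nu> l)"

definition weight0 ::
  "complex^'n \<Rightarrow> (complex^'n) set \<Rightarrow> ('r::finite \<Rightarrow> complex \<Rightarrow> complex^'n) \<Rightarrow> nat^'r \<Rightarrow> int" where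
  "weight0 p C \<nu> l = 2 * int (hilbert_fun p C \<nu> l) - int (\<Sum>i\<in>UNIV. l $ i)"

subsection \<open>Cubes and sublevel sets\<close>

definition cube_vertices :: "nat^'r \<Rightarrow> 'r set \<Rightarrow> (nat^'r) set" where
  "cube_vertices l J = {\<chi> i. l $ i + (if i \<in> K then 1 else 0) | K. K \<subseteq> J}"

definition closed_cube :: "nat^'r \<Rightarrow> 'r set \<Rightarrow> (real^'r) set" where
  "closed_cube l J =
     {x. \<forall>i. real (l $ i) \<le> x $ i \<and> x $ i \<le> real (l $ i) + (if i \<in> J then 1 else 0)}"

definition cube_weight ::
  "complex^'n \<Rightarrow> (complex^'n) set \<Rightarrow> ('r::finite \<Rightarrow> complex \<Rightarrow> complex^'n) \<Rightarrow> nat^'r \<Rightarrow> 'r set \<Rightarrow> int" where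
  "cube_weight p C \<nu> l J = Max (weight0 p C \<nu> ` cube_vertices l J)"

definition sublevel ::
  "complex^'n \<Rightarrow> (complex^'n) set \<Rightarrow> ('r::finite \<Rightarrow> complex \<Rightarrow> complex^'n) \<Rightarrow> int \<Rightarrow> (real^'r) set" where
  "sublevel p C \<nu> n = (\<Union>{closed_cube l J | l J. cube_weight p C \<nu> l J \<le> n})"

subsection \<open>Integral singular cohomology in degree zero\<close>

definition cochain_group :: "nat \<Rightarrow> 'a topology \<Rightarrow> ('a chain \<Rightarrow> int) monoid" where
  "cochain_group q X =
     \<lparr>carrier = hom (chain_group q X) integer_group \<inter> extensional (carrier (chain_group q X)),
      monoid.mult = (\<lambda>\<phi> \<psi>. \<lambda>c\<in>carrier (chain_group q X). \<phi> c + \<psi> c),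
      one = (\<lambda>c\<in>carrier (chain_group q X). 0)\<rparr>"

definition cochain_coboundary :: "nat \<Rightarrow> 'a topology \<Rightarrow> ('a chain \<Rightarrow> int) \<Rightarrow> 'a chain \<Rightarrow> int" where
  "cochain_coboundary q X \<phi> =
     (\<lambda>c\<in>carrier (chain_group (Suc q) X). \<phi> (chain_boundary (Suc q) c))"

text \<open>There are no cochains in degree \<open>-1\<close>, so \<open>H\<^sup>0\<close> is the group of \<open>0\<close>-cocycles.\<close>

definition cohomology0 :: "'a topology \<Rightarrow> ('a chain \<Rightarrow> int) monoid" where
  "cohomology0 X =
     (cochain_group 0 X)
       \<lparr>carrier := kernel (cochain_group 0 X) (cochain_group 1 X) (cochain_coboundary 0 X)\<rparr>"

text \<open>The degree-zero cohomology of the cochain complex augmented by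
  \<open>\<int> \<rightarrow> C\<^sup>0(X)\<close>, \<open>m \<mapsto> m \<cdot> \<epsilon>\<close>, where \<open>\<epsilon>\<close> is the sum of the coefficients of a \<open>0\<close>-chain. For
  \<open>X = \<emptyset>\<close> this is the trivial group.\<close>

definition augmentation_cocycles :: "'a topology \<Rightarrow> ('a chain \<Rightarrow> int) set" where
  "augmentation_cocycles X =
     range (\<lambda>m. \<lambda>c\<in>carrier (chain_group 0 X).
       m * (\<Sum>\<sigma>\<in>Poly_Mapping.keys c. Poly_Mapping.lookup c \<sigma>))"

definition reduced_cohomology0 :: "'a topology \<Rightarrow> ('a chain \<Rightarrow> int) set monoid" where
  "reduced_cohomology0 X = cohomology0 X Mod augmentation_cocycles X"

subsection \<open>Lattice cohomology\<close>

text \<open>\<open>lattice_cohomology0 p C \<nu> n\<close> is the homogeneous part of \<open>\<bbbH>\<^sup>0\<close> of degree \<open>2n\<close>.\<close>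

definition lattice_cohomology0 ::
  "complex^'n \<Rightarrow> (complex^'n) set \<Rightarrow> ('r::finite \<Rightarrow> complex \<Rightarrow> complex^'n) \<Rightarrow> int \<Rightarrow>
   ((real^'r) chain \<Rightarrow> int) monoid" where
  "lattice_cohomology0 p C \<nu> n = cohomology0 (top_of_set (sublevel p C \<nu> n))"

definition reduced_lattice_cohomology0 ::
  "complex^'n \<Rightarrow> (complex^'n) set \<Rightarrow> ('r::finite \<Rightarrow> complex \<Rightarrow> complex^'n) \<Rightarrow>
   (int \<Rightarrow> ((real^'r) chain \<Rightarrow> int) set) monoid" where
  "reduced_lattice_cohomology0 p C \<nu> =
     sum_group UNIV (\<lambda>n. reduced_cohomology0 (top_of_set (sublevel p C \<nu> n)))"

definition min_weight ::
  "complex^'n \<Rightarrow> (complex^'n) set \<Rightarrow> ('r::finite \<Rightarrow> complex \<Rightarrow> complex^'n) \<Rightarrow> int" where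
  "min_weight p C \<nu> = (LEAST n. sublevel p C \<nu> n \<noteq> {})"

end

theory Submission
  imports Defs "HOL-Library.Function_Algebras"
begin

no_notation fps_nth (infixl "$" 75)

text \<open>Pulling functions back to the normalization embeds \<open>\<O>\<close> into the product of the rings of convergent
  power series in the parameters of the branches, with finite codimension \<open>\<delta>\<close> because a conductor
  exists. Hence \<open>|\<ell>| - \<delta> \<le> \<h>(\<ell>) \<le> |\<ell>|\<close>, so the weights are bounded below, and the multiplicity is
  \<open>M = \<Sum>m\<^sub>i\<close>, where \<open>m\<^sub>i\<close> is the minimal order of the maximal ideal on the \<open>i\<close>-th branch.

  Powers of a generic linear form give \<open>\<h>(\<ell>) \<ge> |\<ell>| / M\<close>, so all weights are nonnegative if \<open>M \<le> 2\<close>, while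
  \<open>\<h>(m) = 1\<close> gives \<open>w\<^sub>0(m) = 2 - M\<close>. Since \<open>w\<^sub>0(0) = 0\<close> and \<open>w\<^sub>0(e\<^sub>i) = 1\<close>, the origin is isolated in
  \<open>S\<^sub>0\<close>, and \<open>S\<^sub>0\<close> is disconnected as soon as \<open>M \<ge> 2\<close>; for \<open>M = 1\<close> every \<open>S\<^sub>n\<close> is a segment or empty.
  If \<open>M = 2\<close>, a generic linear form \<open>y\<close> is a double covering of the line, and the antisymmetric part
  of a suitable coordinate, divided by a unit in \<open>y\<close>, is the second coordinate of the normal form.\<close>

subsection \<open>Codimension of subspaces\<close>

text \<open>Codimension is set up as a relation on chains of subspaces. The spaces of germs and of
  series are infinite-dimensional, finiteness of a codimension is itself a claim, and the definite
  description behind \<open>ring.dim\<close> asks for existence and uniqueness. Most counts are made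
  among tuples of convergent series and pulled back to germs along \<open>T\<close>, which is linear
  only on germs and whose kernel there is the vanishing ideal.

  Finiteness of \<delta> is the analytic core. It comes from a parameter s with x = s^m on the
  branch: injectivity of the normalization makes the m conjugates of a generic linear form distinct,
  so one can interpolate at them, and the product of differences is an explicit conductor element.
  \<delta> enters twice: it bounds the weights below, so that a least nonempty sublevel set exists,
  and it is absorbed by the limit that defines the multiplicity.

  Singular cohomology enters through three tests only: emptiness, path-connectedness, and a clopen
  point beside another point.\<close>

locale codim_space = vector_space scale for scale :: "'a::field \<Rightarrow> 'b::ab_group_add \<Rightarrow> 'b"
begin

definition line_sum :: "'b set \<Rightarrow> 'b \<Rightarrow> 'b set" where
  "line_sum U v = {u + scale c v | u c. u \<in> U}"

text \<open>As a relation, infinite codimension is simply the absence of n. Adding one vector at a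
  time matches the line extensions that generate \<open>ring.dimension\<close>, so the translation
  is an induction.\<close>

inductive codim :: "'b set \<Rightarrow> 'b set \<Rightarrow> nat \<Rightarrow> bool" for W where
  codim_0: "codim W W 0"
| codim_Suc: "codim W U n \<Longrightarrow> v \<notin> U \<Longrightarrow> codim W (line_sum U v) (Suc n)"

lemma line_sumI: "u \<in> U \<Longrightarrow> u + scale c v \<in> line_sum U v"
  unfolding line_sum_def by blast

lemma line_sumE:
  assumes "x \<in> line_sum U v"
  obtains u c where "u \<in> U" "x = u + scale c v"
  using assms unfolding line_sum_def by blast

lemma subset_line_sum: "U \<subseteq> line_sum U v"
  using line_sumI[of _ U 0 v] by auto

lemma in_line_sum: "subspace U \<Longrightarrow> v \<in> line_sum U v"
  using line_sumI[of 0 U 1 v] by (auto simp: subspace_0)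

lemma subspace_line_sum:
  assumes "subspace U" shows "subspace (line_sum U v)"
proof (rule subspaceI)
  show "0 \<in> line_sum U v" using subset_line_sum subspace_0[OF assms] by blast
next
  fix x y assume "x \<in> line_sum U v" "y \<in> line_sum U v"
  then obtain u c u' c' where *: "u \<in> U" "x = u + scale c v" "u' \<in> U" "y = u' + scale c' v"
    by (metis line_sumE)
  have "x + y = (u + u') + scale (c + c') v" using * by (simp add: scale_left_distrib)
  then show "x + y \<in> line_sum U v" using * line_sumI subspace_add[OF assms] by metis
next
  fix c x assume "x \<in> line_sum U v"
  then obtain u d where *: "u \<in> U" "x = u + scale d v" by (metis line_sumE)
  have "scale c x = scale c u + scale (c * d) v" using * by (simp add: scale_right_distrib)
  then show "scale c x \<in> line_sum U v" using * line_sumI subspace_scale[OF assms] by metis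
qed

lemma line_sum_least: "subspace X \<Longrightarrow> U \<subseteq> X \<Longrightarrow> v \<in> X \<Longrightarrow> line_sum U v \<subseteq> X"
  by (auto elim!: line_sumE intro: subspace_add subspace_scale)

text \<open>Steinitz exchange for one vector: since c is invertible, v is recovered from u and u + c
  v.\<close>

lemma line_sum_exchange:
  assumes U: "subspace U" and u: "u \<in> U" and c: "c \<noteq> 0"
  shows "line_sum U (u + scale c v) = line_sum U v"
proof (rule subset_antisym)
  have 1: "u + scale c v \<in> line_sum U v" using u by (rule line_sumI)
  show "line_sum U (u + scale c v) \<subseteq> line_sum U v"
    by (rule line_sum_least[OF subspace_line_sum[OF U] subset_line_sum 1])
  have "v = scale (inverse c) (- u) + scale (inverse c) (u + scale c v)"
    using c by (simp add: scale_right_distrib)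
  then have 2: "v \<in> line_sum U (u + scale c v)"
    using line_sumI subspace_scale[OF U subspace_neg[OF U u]] by metis
  show "line_sum U v \<subseteq> line_sum U (u + scale c v)"
    by (rule line_sum_least[OF subspace_line_sum[OF U] subset_line_sum 2])
qed

lemma codim_subset: "codim W U n \<Longrightarrow> W \<subseteq> U"
  by (induction rule: codim.induct) (use subset_line_sum in blast)+

lemma codim_subspace: "codim W U n \<Longrightarrow> subspace W \<Longrightarrow> subspace U"
  by (induction rule: codim.induct) (auto intro: subspace_line_sum)

lemma codim_trans:
  assumes "codim V U b" "codim W V a" shows "codim W U (a + b)"
  using assms by (induction rule: codim.induct) (auto intro: codim_Suc)

lemma codim_self:
  assumes "codim W W n" "subspace W" shows "n = 0"
  using assms(1)
proof cases
  case (codim_Suc U m v)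
  have "v \<in> line_sum U v" by (rule in_line_sum[OF codim_subspace[OF codim_Suc(3) assms(2)]])
  then show ?thesis using codim_Suc codim_subset[OF codim_Suc(3)] by auto
qed simp

end

section \<open>Codimension under linear maps\<close>

locale codim_space_pair = vs1: codim_space s1 + vs2: codim_space s2
  for s1 :: "'a::field \<Rightarrow> 'b::ab_group_add \<Rightarrow> 'b" and s2 :: "'a \<Rightarrow> 'c::ab_group_add \<Rightarrow> 'c"
begin

text \<open>Linearity is asked only on a subspace because the map of interest, Taylor expansion of
  pullbacks, is additive only where the functions are holomorphic.\<close>

definition linear_on :: "'b set \<Rightarrow> ('b \<Rightarrow> 'c) \<Rightarrow> bool" where
  "linear_on U T \<longleftrightarrow> (\<forall>x\<in>U. \<forall>y\<in>U. T (x + y) = T x + T y) \<and> (\<forall>c. \<forall>x\<in>U. T (s1 c x) = s2 c (T x))"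

lemma linear_onD:
  assumes "linear_on U T"
  shows "x \<in> U \<Longrightarrow> y \<in> U \<Longrightarrow> T (x + y) = T x + T y" "x \<in> U \<Longrightarrow> T (s1 c x) = s2 c (T x)"
  using assms unfolding linear_on_def by auto

lemma linear_on_mono: "linear_on U T \<Longrightarrow> V \<subseteq> U \<Longrightarrow> linear_on V T"
  unfolding linear_on_def by blast

definition img_sum :: "('b \<Rightarrow> 'c) \<Rightarrow> 'b set \<Rightarrow> 'c set \<Rightarrow> 'c set" where
  "img_sum T U W = {T u + w | u w. u \<in> U \<and> w \<in> W}"

lemma subspace_img_sum:
  assumes "vs1.subspace U" "vs2.subspace W" "linear_on U T"
  shows "vs2.subspace (img_sum T U W)"
proof (rule vs2.subspaceI)
  have "T (s1 0 0) = s2 0 (T 0)"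
    by (rule linear_onD(2)[OF assms(3)]) (rule vs1.subspace_0[OF assms(1)])
  then have "T 0 = 0" by simp
  then show "0 \<in> img_sum T U W"
    using vs1.subspace_0[OF assms(1)] vs2.subspace_0[OF assms(2)] unfolding img_sum_def by force
next
  fix x y assume "x \<in> img_sum T U W" "y \<in> img_sum T U W"
  then obtain u w u' w' where *: "u \<in> U" "w \<in> W" "x = T u + w" "u' \<in> U" "w' \<in> W" "y = T u' + w'"
    unfolding img_sum_def by blast
  have "x + y = T (u + u') + (w + w')" using * linear_onD(1)[OF assms(3)] by (simp add: algebra_simps)
  then show "x + y \<in> img_sum T U W"
    using * vs1.subspace_add[OF assms(1)] vs2.subspace_add[OF assms(2)] unfolding img_sum_def by blast
next
  fix c x assume "x \<in> img_sum T U W"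
  then obtain u w where *: "u \<in> U" "w \<in> W" "x = T u + w" unfolding img_sum_def by blast
  have "s2 c x = T (s1 c u) + s2 c w" using * linear_onD(2)[OF assms(3)] by (simp add: vs2.scale_right_distrib)
  then show "s2 c x \<in> img_sum T U W"
    using * vs1.subspace_scale[OF assms(1)] vs2.subspace_scale[OF assms(2)] unfolding img_sum_def by blast
qed

lemma subspace_preimage:
  assumes "vs1.subspace U" "vs2.subspace W" "linear_on U T"
  shows "vs1.subspace {u \<in> U. T u \<in> W}"
proof -
  have "T (s1 0 0) = s2 0 (T 0)"
    by (rule linear_onD(2)[OF assms(3)]) (rule vs1.subspace_0[OF assms(1)])
  then have "T 0 = 0" by simp
  then show ?thesis
    using assms vs2.subspace_0[OF assms(2)]
    by (intro vs1.subspaceI)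
      (auto simp: linear_onD[OF assms(3)] vs1.subspace_0 vs1.subspace_add vs2.subspace_add
         vs1.subspace_scale vs2.subspace_scale)
qed

lemma linear_on_diff:
  assumes "vs1.subspace U" "linear_on U T" "x \<in> U" "y \<in> U"
  shows "T (x - y) = T x - T y"
proof -
  have "T (x + s1 (-1) y) = T x + T (s1 (-1) y)"
    by (rule linear_onD(1)[OF assms(2,3) vs1.subspace_scale[OF assms(1,4)]])
  then show ?thesis using linear_onD(2)[OF assms(2,4), of "-1"] by simp
qed

text \<open>As W is the full preimage of W' in U, the map T induces an isomorphism of U/W onto (T U
  + W')/W'; along the chain each new vector v contributes T v.\<close>

lemma codim_image:
  assumes "vs1.codim W U n" "vs1.subspace W" "vs2.subspace W'" "linear_on U T"
    and "{u \<in> U. T u \<in> W'} = W"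
  shows "vs2.codim W' (img_sum T U W') n"
  using assms
proof (induction rule: vs1.codim.induct)
  case codim_0
  have z: "T 0 = 0" using linear_onD(2)[OF codim_0(3), of 0 0] vs1.subspace_0[OF codim_0(1)] by simp
  have "img_sum T W W' = W'"
  proof
    show "img_sum T W W' \<subseteq> W'"
      using codim_0 by (auto simp: img_sum_def intro: vs2.subspace_add)
    show "W' \<subseteq> img_sum T W W'"
      using vs1.subspace_0[OF codim_0(1)] z by (force simp: img_sum_def)
  qed
  then show ?case using vs2.codim_0[of W'] by simp
next
  case (codim_Suc U n v)
  have sU: "vs1.subspace U" by (rule vs1.codim_subspace[OF codim_Suc(1,4)])
  have sL: "vs1.subspace (vs1.line_sum U v)" by (rule vs1.subspace_line_sum[OF sU])
  have vL: "v \<in> vs1.line_sum U v" by (rule vs1.in_line_sum[OF sU])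
  have lU: "linear_on U T" by (rule linear_on_mono[OF codim_Suc(6) vs1.subset_line_sum])
  have "{u \<in> U. T u \<in> W'} = W"
    using codim_Suc.prems(4) vs1.subset_line_sum[of U v] vs1.codim_subset[OF codim_Suc(1)] by blast
  then have IH: "vs2.codim W' (img_sum T U W') n" using codim_Suc lU by blast
  \<comment> \<open>From T v = T u + w it would follow that v - u lies in the preimage W of W',
    hence in U, against the choice of v.\<close>
  have nin: "T v \<notin> img_sum T U W'"
  proof
    assume "T v \<in> img_sum T U W'"
    then obtain u w where *: "u \<in> U" "w \<in> W'" "T v = T u + w" unfolding img_sum_def by blast
    have uL: "u \<in> vs1.line_sum U v" using * vs1.subset_line_sum by blast
    have "T (v - u) = w" using linear_on_diff[OF sL codim_Suc(6) vL uL] * by simp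
    moreover have "v - u \<in> vs1.line_sum U v" using vs1.subspace_diff[OF sL vL uL] .
    ultimately have "v - u \<in> W" using codim_Suc.prems(4) * by blast
    then have "v - u \<in> U" using vs1.codim_subset[OF codim_Suc(1)] by blast
    then have "v \<in> U" using vs1.subspace_add[OF sU _ *(1)] by fastforce
    then show False using codim_Suc by blast
  qed
  have eq: "vs2.line_sum (img_sum T U W') (T v) = img_sum T (vs1.line_sum U v) W'"
  proof
    show "vs2.line_sum (img_sum T U W') (T v) \<subseteq> img_sum T (vs1.line_sum U v) W'"
    proof (rule vs2.line_sum_least)
      show "vs2.subspace (img_sum T (vs1.line_sum U v) W')"
        using subspace_img_sum[OF sL codim_Suc(5,6)] .
      show "img_sum T U W' \<subseteq> img_sum T (vs1.line_sum U v) W'"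
        using vs1.subset_line_sum unfolding img_sum_def by blast
      show "T v \<in> img_sum T (vs1.line_sum U v) W'"
        using vL vs2.subspace_0[OF codim_Suc(5)] unfolding img_sum_def by force
    qed
    show "img_sum T (vs1.line_sum U v) W' \<subseteq> vs2.line_sum (img_sum T U W') (T v)"
    proof
      fix x assume "x \<in> img_sum T (vs1.line_sum U v) W'"
      then obtain u w where *: "u \<in> vs1.line_sum U v" "w \<in> W'" "x = T u + w" unfolding img_sum_def by blast
      then obtain u' c where **: "u' \<in> U" "u = u' + s1 c v" by (metis vs1.line_sumE)
      have "T u = T u' + s2 c (T v)"
        using ** vL linear_onD[OF codim_Suc(6)] vs1.subset_line_sum vs1.subspace_scale[OF sL vL] by (metis subsetD)
      then have "x = (T u' + w) + s2 c (T v)" using * by (simp add: algebra_simps)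
      moreover have "T u' + w \<in> img_sum T U W'" using * ** unfolding img_sum_def by blast
      ultimately show "x \<in> vs2.line_sum (img_sum T U W') (T v)" by (metis vs2.line_sumI)
    qed
  qed
  show ?case using vs2.codim_Suc[OF IH nin] unfolding eq .
qed

text \<open>The converse transport: a chain from W' up to T U + W' is lifted by choosing a preimage
  modulo W' of every new vector. This is how codimensions found among series become codimensions
  among germs.\<close>

lemma codim_preimage:
  assumes "vs2.codim W' U' n" "vs1.subspace U" "vs2.subspace W'" "linear_on U T"
    and "img_sum T U W' = U'"
  shows "vs1.codim {u \<in> U. T u \<in> W'} U n"
  using assms
proof (induction arbitrary: U rule: vs2.codim.induct)
  case codim_0
  then have "{u \<in> U. T u \<in> W'} = U"
    using vs2.subspace_0[OF codim_0(2)] unfolding img_sum_def by force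
  then show ?case using vs1.codim_0[of U] by simp
next
  case (codim_Suc X' n v')
  let ?X = "{u \<in> U. T u \<in> X'}"
  have sX': "vs2.subspace X'" by (rule vs2.codim_subspace[OF codim_Suc(1,5)])
  have WX: "W' \<subseteq> X'" using vs2.codim_subset[OF codim_Suc(1)] .
  have sX: "vs1.subspace ?X" by (rule subspace_preimage[OF codim_Suc(4) sX' codim_Suc(6)])
  have lX: "linear_on ?X T" by (rule linear_on_mono[OF codim_Suc(6)]) blast
  have im: "img_sum T ?X W' = X'"
  proof
    show "img_sum T ?X W' \<subseteq> X'"
      using WX vs2.subspace_add[OF sX'] unfolding img_sum_def by blast
    show "X' \<subseteq> img_sum T ?X W'"
    proof
      fix x assume x: "x \<in> X'"
      then have "x \<in> img_sum T U W'" using codim_Suc(7) vs2.subset_line_sum by blast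
      then obtain u w where *: "u \<in> U" "w \<in> W'" "x = T u + w" unfolding img_sum_def by blast
      then have "T u = x - w" by simp
      then have "T u \<in> X'" using vs2.subspace_diff[OF sX' x, of w] * WX by auto
      then show "x \<in> img_sum T ?X W'" using * unfolding img_sum_def by blast
    qed
  qed
  have IH: "vs1.codim {u \<in> ?X. T u \<in> W'} ?X n"
    by (rule codim_Suc.IH[OF sX codim_Suc(5) lX im])
  have eq1: "{u \<in> ?X. T u \<in> W'} = {u \<in> U. T u \<in> W'}" using WX by blast
  have "v' \<in> img_sum T U W'" using codim_Suc(7) vs2.in_line_sum[OF sX'] by blast
  then obtain v w where v: "v \<in> U" "w \<in> W'" "v' = T v + w" unfolding img_sum_def by blast
  have nin: "v \<notin> ?X"
  proof
    assume "v \<in> ?X"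
    then have "v' \<in> X'" using v WX vs2.subspace_add[OF sX'] by blast
    then show False using codim_Suc by blast
  qed
  have "vs1.line_sum ?X v = U"
  proof
    show "vs1.line_sum ?X v \<subseteq> U" by (rule vs1.line_sum_least[OF codim_Suc(4)]) (use v in auto)
    show "U \<subseteq> vs1.line_sum ?X v"
    proof
      fix u assume u: "u \<in> U"
      have "T u \<in> img_sum T U W'" using u vs2.subspace_0[OF codim_Suc(5)] unfolding img_sum_def by force
      then have "T u \<in> vs2.line_sum X' v'" using codim_Suc(7) by blast
      then obtain y c where y: "y \<in> X'" "T u = y + s2 c v'" by (metis vs2.line_sumE)
      have cv: "s1 c v \<in> U" using vs1.subspace_scale[OF codim_Suc(4) v(1)] .
      have "T (u - s1 c v) = T u - s2 c (T v)"
        using linear_on_diff[OF codim_Suc(4) codim_Suc(6) u cv] linear_onD(2)[OF codim_Suc(6) v(1)] by simp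
      also have "\<dots> = y + s2 c w" using y v by (simp add: vs2.scale_right_distrib)
      also have "\<dots> \<in> X'" using vs2.subspace_add[OF sX' y(1)] vs2.subspace_scale[OF sX'] v WX by blast
      finally have "u - s1 c v \<in> ?X" using vs1.subspace_diff[OF codim_Suc(4) u cv] by blast
      then show "u \<in> vs1.line_sum ?X v" using vs1.line_sumI[of "u - s1 c v" ?X c v] by simp
    qed
  qed
  then show ?case using vs1.codim_Suc[OF IH nin] eq1 by simp
qed

end

context codim_space
begin

text \<open>The second isomorphism theorem is \<open>codim_image\<close> for the identity map with
  target subspace V.\<close>

lemma codim_second_iso:
  assumes "codim (V \<inter> U) U n" "subspace V" "subspace U"
  shows "codim V {u + v | u v. u \<in> U \<and> v \<in> V} n"
proof -
  interpret codim_space_pair scale scale ..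
  have "codim V (img_sum (\<lambda>x. x) U V) n"
    by (rule codim_image[OF assms(1)])
      (auto simp: linear_on_def assms subspace_inter)
  then show ?thesis unfolding img_sum_def by simp
qed

text \<open>The induction runs over the chain from W to U; its hypothesis is applied to the trace of
  V on the penultimate subspace.\<close>

lemma codim_between:
  assumes "codim W U n" "subspace W" "subspace V" "W \<subseteq> V" "V \<subseteq> U"
  obtains a b where "codim W V a" "codim V U b" "a + b = n"
proof -
  have "\<exists>a b. codim W V a \<and> codim V U b \<and> a + b = n"
    using assms
  proof (induction arbitrary: V rule: codim.induct)
    case codim_0
    then have "V = W" by blast
    then show ?case using codim.codim_0 by blast
  next
    case (codim_Suc U n v)
    have sU: "subspace U" by (rule codim_subspace[OF codim_Suc(1,4)])
    have "\<exists>a b. codim W (V \<inter> U) a \<and> codim (V \<inter> U) U b \<and> a + b = n"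
      using codim_Suc sU codim_subset[OF codim_Suc(1)] by (intro codim_Suc.IH) (auto intro: subspace_inter)
    then obtain a b where ab: "codim W (V \<inter> U) a" "codim (V \<inter> U) U b" "a + b = n" by blast
    show ?case
    proof (cases "V \<subseteq> U")
      case True
      then have "V \<inter> U = V" by blast
      then show ?thesis using ab codim.codim_Suc[OF _ codim_Suc(2), of V b] by (metis add_Suc_right)
    next
      \<comment> \<open>V leaves the penultimate subspace U, so a vector v' of V can replace the
        last vector v of the chain. Then V is its trace on U plus one line, and U + V is the whole
        top space, in which the second isomorphism theorem gives the codimension of V.\<close>
      case False
      then obtain v' where v': "v' \<in> V" "v' \<notin> U" by blast
      then obtain u c where uc: "u \<in> U" "v' = u + scale c v" using codim_Suc(7) by (metis line_sumE subsetD)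
      have "c \<noteq> 0" using uc v' by auto
      then have L: "line_sum U v' = line_sum U v" using line_sum_exchange[OF sU] uc by simp
      have 1: "line_sum (V \<inter> U) v' = V"
      proof
        show "line_sum (V \<inter> U) v' \<subseteq> V" by (rule line_sum_least[OF codim_Suc(5)]) (use v' in auto)
        show "V \<subseteq> line_sum (V \<inter> U) v'"
        proof
          fix x assume x: "x \<in> V"
          then obtain y d where y: "y \<in> U" "x = y + scale d v'" using codim_Suc(7) L by (metis line_sumE subsetD)
          have "y = x - scale d v'" using y by simp
          then have "y \<in> V" using subspace_diff[OF codim_Suc(5) x] subspace_scale[OF codim_Suc(5) v'(1)] by metis
          then show "x \<in> line_sum (V \<inter> U) v'" using y by (auto intro: line_sumI)
        qed
      qed
      have A: "codim W V (Suc a)" using codim.codim_Suc[OF ab(1), of v'] v' 1 by simp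
      have 2: "{u + v | u v. u \<in> U \<and> v \<in> V} = line_sum U v"
      proof
        show "{u + v | u v. u \<in> U \<and> v \<in> V} \<subseteq> line_sum U v"
          using codim_Suc(7) subspace_add[OF subspace_line_sum[OF sU]] subset_line_sum by blast
        show "line_sum U v \<subseteq> {u + v | u v. u \<in> U \<and> v \<in> V}"
        proof
          fix x assume "x \<in> line_sum U v"
          then obtain y d where "y \<in> U" "x = y + scale d v'" unfolding L[symmetric] by (metis line_sumE)
          then show "x \<in> {u + v | u v. u \<in> U \<and> v \<in> V}" using subspace_scale[OF codim_Suc(5) v'(1)] by blast
        qed
      qed
      have "codim V (line_sum U v) b" using codim_second_iso[OF ab(2) codim_Suc(5) sU] unfolding 2 .
      then show ?thesis using A ab(3) by (metis add_Suc)
    qed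
  qed
  then show thesis using that by blast
qed

lemma codim_line_sum:
  assumes "codim X (line_sum X v) b" "v \<notin> X" "subspace X"
  shows "b = 1"
  using assms(1)
proof cases
  case codim_0
  then show ?thesis using in_line_sum[OF assms(3), of v] assms(2) by simp
next
  case (codim_Suc Y n w)
  have sY: "subspace Y" using codim_subspace[OF codim_Suc(3) assms(3)] .
  have XY: "X \<subseteq> Y" using codim_subset[OF codim_Suc(3)] .
  have "Y \<subseteq> X"
  proof
    fix y assume y: "y \<in> Y"
    then obtain x c where x: "x \<in> X" "y = x + scale c v"
      using codim_Suc(1) subset_line_sum by (metis line_sumE subsetD)
    show "y \<in> X"
    proof (cases "c = 0")
      case False
      then have "line_sum X v = line_sum X y" using line_sum_exchange[OF assms(3)] x by simp
      also have "\<dots> \<subseteq> Y" by (rule line_sum_least[OF sY XY y])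
      finally show ?thesis using codim_Suc in_line_sum[OF sY, of w] by blast
    qed (use x in simp)
  qed
  then have "Y = X" using XY by blast
  then show ?thesis using codim_Suc codim_self assms(3) by auto
qed

text \<open>The penultimate subspace of one chain is inserted into the other by
  \<open>codim_between\<close>; the top piece of the split then has length 1.\<close>

lemma codim_unique:
  assumes "codim W U n" "codim W U m" "subspace W"
  shows "n = m"
  using assms
proof (induction arbitrary: m rule: codim.induct)
  case codim_0
  then show ?case using codim_self by auto
next
  case (codim_Suc U n v)
  have sU: "subspace U" by (rule codim_subspace[OF codim_Suc(1,5)])
  obtain a b where ab: "codim W U a" "codim U (line_sum U v) b" "a + b = m"
    using codim_between[OF codim_Suc(4,5) sU codim_subset[OF codim_Suc(1)] subset_line_sum] .
  show ?case using codim_Suc.IH[OF ab(1) codim_Suc(5)] codim_line_sum[OF ab(2) codim_Suc(2) sU] ab(3) by simp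
qed

lemma codim_pos: "codim W U n \<Longrightarrow> W \<noteq> U \<Longrightarrow> n \<ge> 1"
  by (cases rule: codim.cases) auto

lemma codim_kernel:
  assumes "subspace U" and add: "\<And>x y. x \<in> U \<Longrightarrow> y \<in> U \<Longrightarrow> \<phi> (x + y) = \<phi> x + \<phi> y"
    and scl: "\<And>c x. x \<in> U \<Longrightarrow> \<phi> (scale c x) = c * \<phi> x"
    and v: "v \<in> U" "\<phi> v \<noteq> 0"
  shows "codim {u \<in> U. \<phi> u = 0} U 1"
proof -
  let ?K = "{u \<in> U. \<phi> u = 0}"
  have "line_sum ?K v = U"
  proof
    show "line_sum ?K v \<subseteq> U" by (rule line_sum_least[OF assms(1)]) (use v in auto)
    show "U \<subseteq> line_sum ?K v"
    proof
      fix u assume u: "u \<in> U"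
      let ?c = "\<phi> u / \<phi> v"
      have "\<phi> (u + scale (- ?c) v) = 0"
        using u v subspace_scale[OF assms(1) v(1)] by (simp only: add scl) simp
      moreover have "u + scale (- ?c) v \<in> U"
        using u v subspace_scale[OF assms(1) v(1)] subspace_add[OF assms(1)] by blast
      ultimately have "(u + scale (- ?c) v) + scale ?c v \<in> line_sum ?K v" by (intro line_sumI) simp
      then show "u \<in> line_sum ?K v" by simp
    qed
  qed
  then show ?thesis using codim_Suc[OF codim_0, of v ?K] v by simp
qed

text \<open>The source of lower bounds: every strict step of a descending chain costs at least one
  dimension.\<close>

lemma codim_chain:
  assumes "codim W U n" "subspace W" "\<And>k. k \<le> K \<Longrightarrow> subspace (E k)" "E 0 = U"
    and "\<And>k. k < K \<Longrightarrow> E (Suc k) \<subset> E k" "W \<subseteq> E K"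
  shows "K \<le> n"
  using assms
proof (induction K arbitrary: U n E)
  case (Suc K)
  have "W \<subseteq> E 1"
  proof -
    have "E (Suc K) \<subseteq> E (Suc j)" if "j \<le> K" for j
      using that by (induction rule: inc_induct) (use Suc.prems(5) in \<open>auto simp: psubset_eq\<close>)
    from this[of 0] show ?thesis using Suc.prems(6) by auto
  qed
  moreover have "E 1 \<subset> U" using Suc.prems(4) Suc.prems(5)[of 0] by simp
  ultimately obtain a b where ab: "codim W (E 1) a" "codim (E 1) U b" "a + b = n"
    using codim_between[OF Suc.prems(1,2), of "E 1"] Suc.prems(3)[of 1] by auto
  have "K \<le> a"
    by (rule Suc.IH[OF ab(1) Suc.prems(2), of "\<lambda>k. E (Suc k)"]) (use Suc.prems in auto)
  moreover have "b \<ge> 1" using codim_pos[OF ab(2)] \<open>E 1 \<subset> U\<close> by blast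
  ultimately show ?case using ab by linarith
qed simp

end

subsection \<open>The local ring as a quotient of the space of holomorphic germs\<close>

definition fscale :: "complex \<Rightarrow> ('a \<Rightarrow> complex) \<Rightarrow> 'a \<Rightarrow> complex" where
  "fscale c f = (\<lambda>x. c * f x)"

definition sscale :: "complex \<Rightarrow> ('r \<Rightarrow> complex fps) \<Rightarrow> 'r \<Rightarrow> complex fps" where
  "sscale c g = (\<lambda>i. fps_const c * g i)"

global_interpretation fn: codim_space "fscale :: complex \<Rightarrow> ('a \<Rightarrow> complex) \<Rightarrow> 'a \<Rightarrow> complex"
  by unfold_locales (auto simp: fscale_def fun_eq_iff algebra_simps)

global_interpretation ser: codim_space "sscale :: complex \<Rightarrow> ('r \<Rightarrow> complex fps) \<Rightarrow> 'r \<Rightarrow> complex fps"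
  by unfold_locales
    (auto simp: sscale_def fun_eq_iff algebra_simps fps_const_mult[symmetric] fps_const_add[symmetric]
       simp del: fps_const_mult fps_const_add)

global_interpretation fs: codim_space_pair
  "fscale :: complex \<Rightarrow> ('a \<Rightarrow> complex) \<Rightarrow> 'a \<Rightarrow> complex"
  "sscale :: complex \<Rightarrow> ('r \<Rightarrow> complex fps) \<Rightarrow> 'r \<Rightarrow> complex fps" ..

global_interpretation ss: codim_space_pair
  "sscale :: complex \<Rightarrow> ('r \<Rightarrow> complex fps) \<Rightarrow> 'r \<Rightarrow> complex fps"
  "sscale :: complex \<Rightarrow> ('r \<Rightarrow> complex fps) \<Rightarrow> 'r \<Rightarrow> complex fps" ..

section \<open>Holomorphic germs under algebraic operations and composition\<close>

lemma holomorphic_vec_on_imp_continuous: "holomorphic_vec_on f U \<Longrightarrow> continuous_on U f"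
  unfolding holomorphic_vec_on_def
  by (meson has_derivative_continuous continuous_at_imp_continuous_on)

lemma holomorphic_germ_const [simp]: "holomorphic_germ p (\<lambda>x. c)"
  unfolding holomorphic_germ_def holomorphic_vec_on_def
  by (intro exI[of _ UNIV]) (auto intro!: exI[of _ "\<lambda>x. 0"])

lemma holomorphic_germ_nth [simp]: "holomorphic_germ p (\<lambda>x. x $ j)"
  unfolding holomorphic_germ_def holomorphic_vec_on_def
  by (intro exI[of _ UNIV]) (auto intro!: exI[of _ "\<lambda>x. x $ j"] bounded_linear_imp_has_derivative bounded_linear_vec_nth)

lemma holomorphic_germ_add:
  assumes "holomorphic_germ p f" "holomorphic_germ p g"
  shows "holomorphic_germ p (\<lambda>x. f x + g x)"
proof -
  obtain U V where U: "open U" "p \<in> U" "holomorphic_vec_on f U" and V: "open V" "p \<in> V" "holomorphic_vec_on g V"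
    using assms unfolding holomorphic_germ_def by blast
  have "holomorphic_vec_on (\<lambda>x. f x + g x) (U \<inter> V)"
    unfolding holomorphic_vec_on_def
  proof
    fix x assume "x \<in> U \<inter> V"
    then obtain D E where "(f has_derivative D) (at x)" "\<forall>c v. D (c *s v) = c * D v"
      "(g has_derivative E) (at x)" "\<forall>c v. E (c *s v) = c * E v"
      using U V unfolding holomorphic_vec_on_def by blast
    then show "\<exists>D. ((\<lambda>x. f x + g x) has_derivative D) (at x) \<and> (\<forall>c v. D (c *s v) = c * D v)"
      by (intro exI[of _ "\<lambda>v. D v + E v"]) (auto intro!: derivative_eq_intros simp: algebra_simps)
  qed
  then show ?thesis unfolding holomorphic_germ_def using U V by (intro exI[of _ "U \<inter> V"]) auto
qed

lemma holomorphic_germ_mult: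
  assumes "holomorphic_germ p f" "holomorphic_germ p g"
  shows "holomorphic_germ p (\<lambda>x. f x * g x)"
proof -
  obtain U V where U: "open U" "p \<in> U" "holomorphic_vec_on f U" and V: "open V" "p \<in> V" "holomorphic_vec_on g V"
    using assms unfolding holomorphic_germ_def by blast
  have "holomorphic_vec_on (\<lambda>x. f x * g x) (U \<inter> V)"
    unfolding holomorphic_vec_on_def
  proof
    fix x assume "x \<in> U \<inter> V"
    then obtain D E where "(f has_derivative D) (at x)" "\<forall>c v. D (c *s v) = c * D v"
      "(g has_derivative E) (at x)" "\<forall>c v. E (c *s v) = c * E v"
      using U V unfolding holomorphic_vec_on_def by blast
    then show "\<exists>D. ((\<lambda>x. f x * g x) has_derivative D) (at x) \<and> (\<forall>c v. D (c *s v) = c * D v)"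
      by (intro exI[of _ "\<lambda>v. f x * E v + D v * g x"]) (auto intro!: derivative_eq_intros simp: algebra_simps)
  qed
  then show ?thesis unfolding holomorphic_germ_def using U V by (intro exI[of _ "U \<inter> V"]) auto
qed

lemma holomorphic_germ_minus: "holomorphic_germ p f \<Longrightarrow> holomorphic_germ p (\<lambda>x. - f x)"
  using holomorphic_germ_mult[OF holomorphic_germ_const[of p "-1"]] by simp

lemma holomorphic_germ_diff:
  "holomorphic_germ p f \<Longrightarrow> holomorphic_germ p g \<Longrightarrow> holomorphic_germ p (\<lambda>x. f x - g x)"
  using holomorphic_germ_add[OF _ holomorphic_germ_minus] by fastforce

lemma holomorphic_germ_sum:
  "(\<And>i. i \<in> A \<Longrightarrow> holomorphic_germ p (f i)) \<Longrightarrow> holomorphic_germ p (\<lambda>x. \<Sum>i\<in>A. f i x)"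
  by (induction A rule: infinite_finite_induct) (auto intro: holomorphic_germ_add)

lemma holomorphic_germ_prod:
  "(\<And>i. i \<in> A \<Longrightarrow> holomorphic_germ p (f i)) \<Longrightarrow> holomorphic_germ p (\<lambda>x. \<Prod>i\<in>A. f i x)"
  by (induction A rule: infinite_finite_induct) (auto intro: holomorphic_germ_mult)

lemma holomorphic_germ_power: "holomorphic_germ p f \<Longrightarrow> holomorphic_germ p (\<lambda>x. f x ^ k)"
  by (induction k) (auto intro: holomorphic_germ_mult)

lemma holomorphic_germ_compose:
  assumes "holomorphic_germ p f" "\<phi> analytic_on {f p}"
  shows "holomorphic_germ p (\<lambda>x. \<phi> (f x))"
proof -
  obtain U where U: "open U" "p \<in> U" "holomorphic_vec_on f U"
    using assms unfolding holomorphic_germ_def by blast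
  obtain S where S: "open S" "f p \<in> S" "\<phi> holomorphic_on S"
    using assms(2) by (auto simp: analytic_at)
  define W where "W = U \<inter> f -` S"
  have "open W" unfolding W_def
    using continuous_open_preimage[OF holomorphic_vec_on_imp_continuous[OF U(3)] U(1) S(1)] .
  moreover have "holomorphic_vec_on (\<lambda>x. \<phi> (f x)) W"
    unfolding holomorphic_vec_on_def
  proof
    fix x assume "x \<in> W"
    then have x: "x \<in> U" "f x \<in> S" unfolding W_def by auto
    obtain D where D: "(f has_derivative D) (at x)" "\<forall>c v. D (c *s v) = c * D v"
      using U x unfolding holomorphic_vec_on_def by blast
    have "(\<phi> has_derivative (*) (deriv \<phi> (f x))) (at (f x))"
      using holomorphic_derivI[OF S(3,1) x(2)] unfolding has_field_derivative_def .
    from has_derivative_compose[OF D(1) this]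
    show "\<exists>D. ((\<lambda>x. \<phi> (f x)) has_derivative D) (at x) \<and> (\<forall>c v. D (c *s v) = c * D v)"
      using D(2) by (intro exI[of _ "\<lambda>v. deriv \<phi> (f x) * D v"]) auto
  qed
  ultimately show ?thesis unfolding holomorphic_germ_def using U S W_def by (intro exI[of _ W]) auto
qed

lemma holomorphic_germ_continuous: "holomorphic_germ p f \<Longrightarrow> isCont f p"
  unfolding holomorphic_germ_def holomorphic_vec_on_def using has_derivative_continuous by blast

text \<open>This linear bound takes the place of power series in several variables when the order of
  a pullback is estimated.\<close>

lemma holomorphic_germ_bound:
  assumes "holomorphic_germ p f" "f p = 0"
  obtains K where "K \<ge> 0" "\<forall>\<^sub>F z in nhds p. norm (f z) \<le> K * norm (z - p)"
proof -
  obtain D where D: "(f has_derivative D) (at p)"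
    using assms unfolding holomorphic_germ_def holomorphic_vec_on_def by blast
  interpret bounded_linear D using D by (rule has_derivative_bounded_linear)
  obtain K where K: "\<And>x. norm (D x) \<le> norm x * K" "K > 0" using pos_bounded by blast
  have "\<forall>e>0. \<exists>d>0. \<forall>y. norm (y - p) < d \<longrightarrow> norm (f y - f p - D (y - p)) \<le> e * norm (y - p)"
    using D unfolding has_derivative_within_alt by simp
  then obtain d where d: "d > 0" "\<And>y. norm (y - p) < d \<Longrightarrow> norm (f y - f p - D (y - p)) \<le> 1 * norm (y - p)"
    by (metis zero_less_one)
  have "\<forall>\<^sub>F z in nhds p. z \<in> ball p d" by (rule eventually_nhds_in_open) (use d in auto)
  then have "\<forall>\<^sub>F z in nhds p. norm (f z) \<le> (1 + K) * norm (z - p)"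
  proof eventually_elim
    case (elim z)
    then have "norm (f z - D (z - p)) \<le> norm (z - p)" using d(2)[of z] assms(2) by (simp add: dist_norm norm_minus_commute)
    moreover have "norm (f z) \<le> norm (f z - D (z - p)) + norm (D (z - p))"
      using norm_triangle_sub[of "f z" "D (z - p)"] by simp
    ultimately show ?case using K(1)[of "z - p"] by (simp add: algebra_simps)
  qed
  then show thesis using that[of "1 + K"] K by simp
qed

section \<open>Germ classes and the quotient ring\<close>

lemma cring_ambient: "cring (ambient_ring p)"
proof (rule cringI)
  show "abelian_group (ambient_ring p)"
  proof (rule abelian_groupI)
    fix x assume "x \<in> carrier (ambient_ring p)"
    then show "\<exists>y\<in>carrier (ambient_ring p). y \<oplus>\<^bsub>ambient_ring p\<^esub> x = \<zero>\<^bsub>ambient_ring p\<^esub>"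
      by (intro bexI[of _ "\<lambda>z. - x z"]) (auto simp: ambient_ring_def intro: holomorphic_germ_minus)
  qed (auto simp: ambient_ring_def intro: holomorphic_germ_add)
  show "comm_monoid (ambient_ring p)"
    by (rule comm_monoidI) (auto simp: ambient_ring_def intro: holomorphic_germ_mult)
qed (auto simp: ambient_ring_def algebra_simps)

lemma ideal_vanishing: "ideal (vanishing_ideal p C) (ambient_ring p)"
proof -
  interpret cring "ambient_ring p" by (rule cring_ambient)
  have inv: "inv\<^bsub>add_monoid (ambient_ring p)\<^esub> f = (\<lambda>x. - f x)" if "holomorphic_germ p f" for f
    unfolding a_inv_def[symmetric] by (rule minus_equality) (use that in \<open>auto simp: ambient_ring_def intro: holomorphic_germ_minus\<close>)
  show ?thesis
  proof (rule idealI)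
    show "ring (ambient_ring p)" by (rule ring_axioms)
    show "subgroup (vanishing_ideal p C) (add_monoid (ambient_ring p))"
    proof
      fix x y assume xy: "x \<in> vanishing_ideal p C" "y \<in> vanishing_ideal p C"
      then have "\<forall>\<^sub>F z in nhds p. (z \<in> C \<longrightarrow> x z = 0) \<and> (z \<in> C \<longrightarrow> y z = 0)"
        unfolding vanishing_ideal_def by (auto intro: eventually_conj)
      then have "\<forall>\<^sub>F z in nhds p. z \<in> C \<longrightarrow> x z + y z = 0" by eventually_elim auto
      then show "x \<otimes>\<^bsub>add_monoid (ambient_ring p)\<^esub> y \<in> vanishing_ideal p C"
        using xy by (auto simp: vanishing_ideal_def ambient_ring_def intro: holomorphic_germ_add)
    next
      fix x assume "x \<in> vanishing_ideal p C"
      then show "inv\<^bsub>add_monoid (ambient_ring p)\<^esub> x \<in> vanishing_ideal p C"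
        using inv by (auto simp: vanishing_ideal_def intro: holomorphic_germ_minus)
    qed (auto simp: vanishing_ideal_def ambient_ring_def)
    fix a x assume ax: "a \<in> vanishing_ideal p C" "x \<in> carrier (ambient_ring p)"
    then have "\<forall>\<^sub>F z in nhds p. z \<in> C \<longrightarrow> a z = 0" unfolding vanishing_ideal_def by auto
    then have "\<forall>\<^sub>F z in nhds p. z \<in> C \<longrightarrow> x z * a z = 0" "\<forall>\<^sub>F z in nhds p. z \<in> C \<longrightarrow> a z * x z = 0"
      by (eventually_elim; auto)+
    then show "x \<otimes>\<^bsub>ambient_ring p\<^esub> a \<in> vanishing_ideal p C" "a \<otimes>\<^bsub>ambient_ring p\<^esub> x \<in> vanishing_ideal p C"
      using ax by (auto simp: vanishing_ideal_def ambient_ring_def intro: holomorphic_germ_mult)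
  qed
qed

abbreviation germs :: "complex^'n \<Rightarrow> (complex^'n \<Rightarrow> complex) set" where
  "germs p \<equiv> {f. holomorphic_germ p f}"

definition germ_class :: "complex^'n \<Rightarrow> (complex^'n) set \<Rightarrow> (complex^'n \<Rightarrow> complex) \<Rightarrow> (complex^'n \<Rightarrow> complex) set" where
  "germ_class p C f = vanishing_ideal p C +>\<^bsub>ambient_ring p\<^esub> f"

lemma subspace_germs: "fn.subspace (germs p)"
  by (rule fn.subspaceI)
    (auto simp: fscale_def zero_fun_def plus_fun_def intro: holomorphic_germ_add holomorphic_germ_mult)

lemma cring_local: "cring (local_ring p C)"
  unfolding local_ring_def by (rule ideal.quotient_is_cring[OF ideal_vanishing cring_ambient])

lemma carrier_local: "carrier (local_ring p C) = germ_class p C ` germs p"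
  unfolding local_ring_def FactRing_def A_RCOSETS_def RCOSETS_def germ_class_def a_r_coset_def
  by (auto simp: ambient_ring_def)

lemma cls_hom: "germ_class p C \<in> ring_hom (ambient_ring p) (local_ring p C)"
proof -
  have "germ_class p C = (+>\<^bsub>ambient_ring p\<^esub>) (vanishing_ideal p C)" by (auto simp: germ_class_def)
  then show ?thesis using ideal.rcos_ring_hom[OF ideal_vanishing, of p C] unfolding local_ring_def by simp
qed

lemma cls_add:
  "holomorphic_germ p f \<Longrightarrow> holomorphic_germ p g \<Longrightarrow>
    germ_class p C f \<oplus>\<^bsub>local_ring p C\<^esub> germ_class p C g = germ_class p C (f + g)"
  using ring_hom_add[OF cls_hom, of f p g C] by (simp add: ambient_ring_def plus_fun_def)

lemma cls_mult:
  "holomorphic_germ p f \<Longrightarrow> holomorphic_germ p g \<Longrightarrow>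
    germ_class p C f \<otimes>\<^bsub>local_ring p C\<^esub> germ_class p C g = germ_class p C (\<lambda>x. f x * g x)"
  using ring_hom_mult[OF cls_hom, of f p g C] by (simp add: ambient_ring_def)

lemma cls_zero: "germ_class p C 0 = \<zero>\<^bsub>local_ring p C\<^esub>"
proof -
  interpret cring "ambient_ring p" by (rule cring_ambient)
  interpret O: cring "local_ring p C" by (rule cring_local)
  have "ring_hom_ring (ambient_ring p) (local_ring p C) (germ_class p C)"
    by (intro ring_hom_ringI2 cls_hom ring_axioms O.ring_axioms)
  then interpret h: ring_hom_ring "ambient_ring p" "local_ring p C" "germ_class p C" .
  show ?thesis using h.hom_zero by (simp add: ambient_ring_def zero_fun_def)
qed

lemma mem_cls_iff:
  assumes "holomorphic_germ p f"
  shows "g \<in> germ_class p C f \<longleftrightarrow> holomorphic_germ p g \<and> (\<forall>\<^sub>F x in nhds p. x \<in> C \<longrightarrow> g x = f x)"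
proof
  assume "g \<in> germ_class p C f"
  then obtain a where a: "a \<in> vanishing_ideal p C" "g = (\<lambda>x. a x + f x)"
    unfolding germ_class_def a_r_coset_def r_coset_def by (auto simp: ambient_ring_def)
  then have "\<forall>\<^sub>F x in nhds p. x \<in> C \<longrightarrow> a x = 0" unfolding vanishing_ideal_def by auto
  then have "\<forall>\<^sub>F x in nhds p. x \<in> C \<longrightarrow> g x = f x" by eventually_elim (use a in auto)
  then show "holomorphic_germ p g \<and> (\<forall>\<^sub>F x in nhds p. x \<in> C \<longrightarrow> g x = f x)"
    using a assms by (auto simp: vanishing_ideal_def intro: holomorphic_germ_add)
next
  assume g: "holomorphic_germ p g \<and> (\<forall>\<^sub>F x in nhds p. x \<in> C \<longrightarrow> g x = f x)"
  then have "\<forall>\<^sub>F x in nhds p. x \<in> C \<longrightarrow> g x - f x = 0" by simp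
  then have "(\<lambda>x. g x - f x) \<in> vanishing_ideal p C"
    using g assms unfolding vanishing_ideal_def by (auto intro: holomorphic_germ_diff)
  then show "g \<in> germ_class p C f"
    unfolding germ_class_def a_r_coset_def r_coset_def
    by (auto simp: ambient_ring_def intro!: bexI[of _ "\<lambda>x. g x - f x"])
qed

lemma cls_self: "holomorphic_germ p f \<Longrightarrow> f \<in> germ_class p C f"
  by (simp add: mem_cls_iff)

lemma cls_eq_iff:
  assumes "holomorphic_germ p f" "holomorphic_germ p g"
  shows "germ_class p C f = germ_class p C g \<longleftrightarrow> (\<forall>\<^sub>F x in nhds p. x \<in> C \<longrightarrow> f x = g x)"
proof
  assume "germ_class p C f = germ_class p C g"
  then show "\<forall>\<^sub>F x in nhds p. x \<in> C \<longrightarrow> f x = g x" using cls_self[OF assms(1)] mem_cls_iff[OF assms(2)] by blast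
next
  assume ev: "\<forall>\<^sub>F x in nhds p. x \<in> C \<longrightarrow> f x = g x"
  have "(\<forall>\<^sub>F x in nhds p. x \<in> C \<longrightarrow> h x = f x) \<longleftrightarrow> (\<forall>\<^sub>F x in nhds p. x \<in> C \<longrightarrow> h x = g x)" for h
    by (rule iffI; erule eventually_elim2[OF _ ev]) auto
  then show "germ_class p C f = germ_class p C g" by (auto simp: mem_cls_iff assms)
qed

text \<open>\<open>codim_ideal\<close> is a definite description, so one has to show both that the
  codimension is a dimension and that every dimension equals it. This is the second half: a
  dimension in Q is read on V through the surjection \<pi>, with \<kappa> c in the role of the
  scalar c.\<close>

lemma dimension_imp_codim:
  assumes "ring Q" and V: "fn.subspace V" and \<pi>: "\<pi> ` V = carrier Q"
    and add: "\<And>f g. f \<in> V \<Longrightarrow> g \<in> V \<Longrightarrow> \<pi> (f + g) = \<pi> f \<oplus>\<^bsub>Q\<^esub> \<pi> g"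
    and scl: "\<And>c f. f \<in> V \<Longrightarrow> \<pi> (fscale c f) = \<kappa> c \<otimes>\<^bsub>Q\<^esub> \<pi> f"
    and \<kappa>: "range \<kappa> \<subseteq> carrier Q"
    and "ring.dimension Q n (range \<kappa>) E"
  shows "E \<subseteq> carrier Q \<and> fn.codim {f \<in> V. \<pi> f = \<zero>\<^bsub>Q\<^esub>} {f \<in> V. \<pi> f \<in> E} n"
proof -
  interpret ring Q by fact
  define K where "K = range \<kappa>"
  have "dimension n K E" using assms(7) unfolding K_def .
  then show ?thesis
    using K_def
  proof (induction rule: dimension.induct)
    case (zero_dim K)
    then show ?case using fn.codim_0[of "{f \<in> V. \<pi> f = \<zero>\<^bsub>Q\<^esub>}"] by simp
  next
    case (Suc_dim v E n K)
    then have IH: "E \<subseteq> carrier Q" "fn.codim {f \<in> V. \<pi> f = \<zero>\<^bsub>Q\<^esub>} {f \<in> V. \<pi> f \<in> E} n" by auto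
    obtain g where g: "g \<in> V" "v = \<pi> g" using Suc_dim(1) \<pi> by blast
    have Kc: "K \<subseteq> carrier Q" using \<kappa> Suc_dim by simp
    have eq: "fn.line_sum {f \<in> V. \<pi> f \<in> E} g = {f \<in> V. \<pi> f \<in> line_extension K v E}"
    proof (intro subset_antisym subsetI)
      fix f assume "f \<in> fn.line_sum {f \<in> V. \<pi> f \<in> E} g"
      then obtain u c where "u \<in> {f \<in> V. \<pi> f \<in> E}" and u3: "f = u + fscale c g" by (rule fn.line_sumE)
      then have u: "u \<in> V" "\<pi> u \<in> E" "f = u + fscale c g" by auto
      have cg: "fscale c g \<in> V" by (rule fn.subspace_scale[OF V g(1)])
      have uc: "\<pi> u \<in> carrier Q" using u \<pi> by blast
      have vc: "\<kappa> c \<otimes>\<^bsub>Q\<^esub> v \<in> carrier Q" using \<kappa> Suc_dim(1) by blast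
      have "\<pi> f = \<kappa> c \<otimes>\<^bsub>Q\<^esub> v \<oplus>\<^bsub>Q\<^esub> \<pi> u"
        using add[OF u(1) cg] scl[OF g(1), of c] u g a_comm[OF uc vc] by simp
      then show "f \<in> {f \<in> V. \<pi> f \<in> line_extension K v E}"
        using u cg fn.subspace_add[OF V] Suc_dim by (auto simp: line_extension_mem_iff)
    next
      fix f assume "f \<in> {f \<in> V. \<pi> f \<in> line_extension K v E}"
      then obtain c e where f: "f \<in> V" and e: "e \<in> E" "\<pi> f = \<kappa> c \<otimes>\<^bsub>Q\<^esub> v \<oplus>\<^bsub>Q\<^esub> e"
        using Suc_dim by (auto simp: line_extension_mem_iff)
      have cg: "fscale c g \<in> V" by (rule fn.subspace_scale[OF V g(1)])
      have d: "f - fscale c g \<in> V" by (rule fn.subspace_diff[OF V f cg])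
      have "\<pi> f = \<pi> (fscale c g + (f - fscale c g))" by simp
      also have "\<dots> = \<kappa> c \<otimes>\<^bsub>Q\<^esub> v \<oplus>\<^bsub>Q\<^esub> \<pi> (f - fscale c g)"
        using add[OF cg d] scl[OF g(1)] g by simp
      finally have "\<kappa> c \<otimes>\<^bsub>Q\<^esub> v \<oplus>\<^bsub>Q\<^esub> e = \<kappa> c \<otimes>\<^bsub>Q\<^esub> v \<oplus>\<^bsub>Q\<^esub> \<pi> (f - fscale c g)" using e by simp
      moreover have "\<kappa> c \<otimes>\<^bsub>Q\<^esub> v \<in> carrier Q" "e \<in> carrier Q" "\<pi> (f - fscale c g) \<in> carrier Q"
        using \<kappa> Suc_dim(1) e IH d \<pi> by auto
      ultimately have "\<pi> (f - fscale c g) \<in> E" using e by (metis r_neg1)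
      then have "f - fscale c g \<in> {f \<in> V. \<pi> f \<in> E}" using d by blast
      from fn.line_sumI[OF this, of c g] show "f \<in> fn.line_sum {f \<in> V. \<pi> f \<in> E} g" by simp
    qed
    have "g \<notin> {f \<in> V. \<pi> f \<in> E}" using g Suc_dim(2) by blast
    from fn.codim_Suc[OF IH(2) this] show ?case
      unfolding eq using line_extension_in_carrier[OF Kc Suc_dim(1) IH(1)] Suc_dim by simp
  qed
qed

text \<open>The existence half of the translation: a chain of subspaces above the kernel W is mapped
  by \<pi> to a chain of line extensions of the zero space.\<close>

lemma codim_imp_dimension:
  assumes "ring Q" and V: "fn.subspace V" and \<pi>: "\<pi> ` V = carrier Q"
    and add: "\<And>f g. f \<in> V \<Longrightarrow> g \<in> V \<Longrightarrow> \<pi> (f + g) = \<pi> f \<oplus>\<^bsub>Q\<^esub> \<pi> g"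
    and scl: "\<And>c f. f \<in> V \<Longrightarrow> \<pi> (fscale c f) = \<kappa> c \<otimes>\<^bsub>Q\<^esub> \<pi> f"
    and \<kappa>: "range \<kappa> \<subseteq> carrier Q"
    and W: "fn.subspace W" "W = {f \<in> V. \<pi> f = \<zero>\<^bsub>Q\<^esub>}"
    and "fn.codim W U n" "U \<subseteq> V"
  shows "ring.dimension Q n (range \<kappa>) (\<pi> ` U)"
  using assms(9,10)
proof (induction rule: fn.codim.induct)
  interpret ring Q by fact
  case codim_0
  have "\<pi> ` W = {\<zero>\<^bsub>Q\<^esub>}" using W fn.subspace_0[OF W(1)] by auto
  then show ?case by (simp add: zero_dim)
next
  interpret ring Q by fact
  case (codim_Suc U n v)
  have sU: "fn.subspace U" by (rule fn.codim_subspace[OF codim_Suc(1) W(1)])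
  have UV: "U \<subseteq> V" using codim_Suc(4) fn.subset_line_sum by blast
  have vV: "v \<in> V" using codim_Suc(4) fn.in_line_sum[OF sU] by blast
  have IH: "dimension n (range \<kappa>) (\<pi> ` U)" using codim_Suc UV by blast
  have "\<pi> v \<notin> \<pi> ` U"
  proof
    assume "\<pi> v \<in> \<pi> ` U"
    then obtain u where u: "u \<in> U" "\<pi> v = \<pi> u" by blast
    have d: "v - u \<in> V" using fn.subspace_diff[OF V vV] u UV by blast
    have "\<pi> v = \<pi> (u + (v - u))" by simp
    also have "\<dots> = \<pi> u \<oplus>\<^bsub>Q\<^esub> \<pi> (v - u)" using add[OF _ d] u UV by blast
    finally have "\<pi> u = \<pi> u \<oplus>\<^bsub>Q\<^esub> \<pi> (v - u)" using u by simp
    moreover have "\<pi> u \<in> carrier Q" "\<pi> (v - u) \<in> carrier Q" using u UV d \<pi> by auto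
    ultimately have "\<pi> (v - u) = \<zero>\<^bsub>Q\<^esub>" by (metis r_neg1 l_neg)
    then have "v - u \<in> U" using W d fn.codim_subset[OF codim_Suc(1)] by blast
    then have "v \<in> U" using fn.subspace_add[OF sU _ u(1)] by fastforce
    then show False using codim_Suc by blast
  qed
  moreover have "\<pi> v \<in> carrier Q" using vV \<pi> by blast
  moreover have "line_extension (range \<kappa>) (\<pi> v) (\<pi> ` U) = \<pi> ` fn.line_sum U v"
  proof -
    have e: "\<pi> (u + fscale c v) = \<kappa> c \<otimes>\<^bsub>Q\<^esub> \<pi> v \<oplus>\<^bsub>Q\<^esub> \<pi> u" if "u \<in> U" for u c
    proof -
      have "\<pi> (u + fscale c v) = \<pi> u \<oplus>\<^bsub>Q\<^esub> \<kappa> c \<otimes>\<^bsub>Q\<^esub> \<pi> v"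
        using add[of u "fscale c v"] scl[OF vV, of c] that UV fn.subspace_scale[OF V vV] by auto
      also have "\<dots> = \<kappa> c \<otimes>\<^bsub>Q\<^esub> \<pi> v \<oplus>\<^bsub>Q\<^esub> \<pi> u"
      proof (rule a_comm)
        show "\<pi> u \<in> carrier Q" using that UV \<pi> by blast
        show "\<kappa> c \<otimes>\<^bsub>Q\<^esub> \<pi> v \<in> carrier Q" using vV \<pi> \<kappa> by blast
      qed
      finally show ?thesis .
    qed
    show ?thesis
    proof (intro subset_antisym subsetI)
      fix x assume "x \<in> line_extension (range \<kappa>) (\<pi> v) (\<pi> ` U)"
      then obtain c u where "u \<in> U" "x = \<kappa> c \<otimes>\<^bsub>Q\<^esub> \<pi> v \<oplus>\<^bsub>Q\<^esub> \<pi> u" by (auto simp: line_extension_mem_iff)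
      then show "x \<in> \<pi> ` fn.line_sum U v" using e fn.line_sumI by (metis imageI)
    next
      fix x assume "x \<in> \<pi> ` fn.line_sum U v"
      then obtain c u where "u \<in> U" "x = \<pi> (u + fscale c v)" by (auto elim: fn.line_sumE)
      then show "x \<in> line_extension (range \<kappa>) (\<pi> v) (\<pi> ` U)" using e by (auto simp: line_extension_mem_iff)
    qed
  qed
  ultimately show ?case using Suc_dim[OF _ _ IH, of "\<pi> v"] by simp
qed

text \<open>After this lemma the dimension of O/J is handled as the codimension of the preimage of J
  in the space of germs.\<close>

lemma codim_ideal_eq:
  assumes J: "ideal J (local_ring p C)" and cd: "fn.codim {f \<in> germs p. germ_class p C f \<in> J} (germs p) n"
  shows "codim_ideal p C J = n"
proof -
  interpret J: ideal J "local_ring p C" by fact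
  interpret R: cring "ambient_ring p" by (rule cring_ambient)
  define Q where "Q = local_ring p C Quot J"
  define \<pi> where "\<pi> = (\<lambda>f. J +>\<^bsub>local_ring p C\<^esub> germ_class p C f)"
  define \<kappa> where "\<kappa> = (\<lambda>c. J +>\<^bsub>local_ring p C\<^esub> local_const p C c)"
  have Q: "ring Q" unfolding Q_def by (rule J.quotient_is_ring)
  interpret Q: ring Q by (rule Q)
  have \<kappa>\<pi>: "\<kappa> c = \<pi> (\<lambda>x. c)" for c unfolding \<kappa>_def \<pi>_def local_const_def germ_class_def by simp
  have "(\<lambda>f. J +>\<^bsub>local_ring p C\<^esub> germ_class p C f) \<in> ring_hom (ambient_ring p) Q"
    using ring_hom_trans[OF cls_hom J.rcos_ring_hom] unfolding Q_def comp_def .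
  then have hom: "\<pi> \<in> ring_hom (ambient_ring p) Q" unfolding \<pi>_def .
  have add: "\<pi> (f + g) = \<pi> f \<oplus>\<^bsub>Q\<^esub> \<pi> g" if "f \<in> germs p" "g \<in> germs p" for f g
    using ring_hom_add[OF hom, of f g] that by (simp add: ambient_ring_def plus_fun_def)
  have scl: "\<pi> (fscale c f) = \<kappa> c \<otimes>\<^bsub>Q\<^esub> \<pi> f" if "f \<in> germs p" for c f
    using ring_hom_mult[OF hom, of "\<lambda>x. c" f] that unfolding \<kappa>\<pi> by (simp add: ambient_ring_def fscale_def)
  have im: "\<pi> ` germs p = carrier Q"
    unfolding Q_def \<pi>_def FactRing_def A_RCOSETS_def RCOSETS_def carrier_local a_r_coset_def
    by auto
  have \<kappa>: "range \<kappa> \<subseteq> carrier Q" using im unfolding \<kappa>\<pi> by auto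
  have zero: "\<pi> f = \<zero>\<^bsub>Q\<^esub> \<longleftrightarrow> germ_class p C f \<in> J" if "f \<in> germs p" for f
  proof -
    have "germ_class p C f \<in> carrier (local_ring p C)" using that carrier_local by blast
    then show ?thesis
      unfolding \<pi>_def Q_def FactRing_def
      using J.a_coset_join1[OF _ _ J.a_subgroup] J.a_coset_join2[OF _ J.a_subgroup] by auto
  qed
  then have W: "{f \<in> germs p. germ_class p C f \<in> J} = {f \<in> germs p. \<pi> f = \<zero>\<^bsub>Q\<^esub>}" by blast
  have sW: "fn.subspace {f \<in> germs p. germ_class p C f \<in> J}"
    unfolding W
  proof (rule fn.subspaceI)
    have "germ_class p C 0 \<in> J" using cls_zero[of p C] additive_subgroup.zero_closed[OF J.is_additive_subgroup] by simp
    then show "0 \<in> {f \<in> germs p. \<pi> f = \<zero>\<^bsub>Q\<^esub>}" using zero[of 0] fn.subspace_0[OF subspace_germs] by blast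
  next
    fix x y assume "x \<in> {f \<in> germs p. \<pi> f = \<zero>\<^bsub>Q\<^esub>}" "y \<in> {f \<in> germs p. \<pi> f = \<zero>\<^bsub>Q\<^esub>}"
    then show "x + y \<in> {f \<in> germs p. \<pi> f = \<zero>\<^bsub>Q\<^esub>}"
      using add[of x y] fn.subspace_add[OF subspace_germs] by auto
  next
    fix c x assume x: "x \<in> {f \<in> germs p. \<pi> f = \<zero>\<^bsub>Q\<^esub>}"
    have "\<kappa> c \<in> carrier Q" using \<kappa> by auto
    then show "fscale c x \<in> {f \<in> germs p. \<pi> f = \<zero>\<^bsub>Q\<^esub>}"
      using scl[of x c] x fn.subspace_scale[OF subspace_germs] by auto
  qed
  have d: "Q.dimension n (range \<kappa>) (carrier Q)"
    using codim_imp_dimension[where \<pi> = \<pi>, OF Q subspace_germs im add scl \<kappa> sW W cd] im by simp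
  have u: "m = n" if "Q.dimension m (range \<kappa>) (carrier Q)" for m
  proof -
    have "fn.codim {f \<in> germs p. \<pi> f = \<zero>\<^bsub>Q\<^esub>} {f \<in> germs p. \<pi> f \<in> carrier Q} m"
      using dimension_imp_codim[where \<pi> = \<pi>, OF Q subspace_germs im add scl \<kappa> that] by blast
    moreover have "{f \<in> germs p. \<pi> f \<in> carrier Q} = germs p" using im by blast
    ultimately show ?thesis using fn.codim_unique[OF _ cd sW, of m] unfolding W by simp
  qed
  have "codim_ideal p C J = Q.dim (range \<kappa>) (carrier Q)"
    unfolding codim_ideal_def Let_def Q_def \<kappa>_def ..
  also have "\<dots> = n" unfolding Q.dim_def using d u by (rule the_equality)
  finally show ?thesis .
qed

subsection \<open>Branches and pullbacks to the normalization\<close>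

lemma has_derivative_vec:
  fixes f :: "'a::euclidean_space \<Rightarrow> complex^'n"
  assumes "\<And>j. ((\<lambda>t. f t $ j) has_derivative D j) (at t)"
  shows "(f has_derivative (\<lambda>h. \<chi> j. D j h)) (at t)"
  unfolding has_derivative_def
proof
  have "linear (D j)" for j using has_derivative_linear[OF assms] .
  then have "linear (\<lambda>h. \<chi> j. D j h)"
    by (intro linearI) (auto simp: vec_eq_iff linear_add linear_scale)
  then show "bounded_linear (\<lambda>h. \<chi> j. D j h)" by (simp add: linear_conv_bounded_linear)
  show "((\<lambda>y. ((f y - f (netlimit (at t))) - (\<chi> j. D j (y - netlimit (at t)))) /\<^sub>R norm (y - netlimit (at t))) \<longlongrightarrow> 0) (at t)"
  proof (rule vec_tendstoI)
    fix j
    show "((\<lambda>y. (((f y - f (netlimit (at t))) - (\<chi> j. D j (y - netlimit (at t)))) /\<^sub>R norm (y - netlimit (at t))) $ j) \<longlongrightarrow> 0 $ j) (at t)"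
      using assms[of j] unfolding has_derivative_def by simp
  qed
qed

definition analytic_curve :: "(complex \<Rightarrow> complex^'n) \<Rightarrow> bool" where
  "analytic_curve \<gamma> \<longleftrightarrow> (\<forall>j. (\<lambda>t. \<gamma> t $ j) analytic_on {0})"

lemma analytic_curve_isCont: "analytic_curve \<gamma> \<Longrightarrow> isCont \<gamma> 0"
  unfolding analytic_curve_def isCont_def
  by (rule vec_tendstoI) (metis analytic_at_imp_isCont isCont_def)

lemma tendsto_nhds_isCont: "isCont f a \<Longrightarrow> (f \<longlongrightarrow> f a) (nhds a)"
  by (simp add: continuous_at_imp_continuous_within isCont_def tendsto_at_iff_tendsto_nhds)

lemma eventually_curve:
  assumes "analytic_curve \<gamma>" "\<forall>\<^sub>F z in nhds (\<gamma> 0). P z"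
  shows "\<forall>\<^sub>F t in nhds 0. P (\<gamma> t)"
  by (rule eventually_compose_filterlim[OF assms(2) tendsto_nhds_isCont[OF analytic_curve_isCont[OF assms(1)]]])

lemma pullback_analytic:
  assumes "analytic_curve \<gamma>" "holomorphic_germ (\<gamma> 0) f"
  shows "(f \<circ> \<gamma>) analytic_on {0}"
proof -
  obtain U where U: "open U" "\<gamma> 0 \<in> U" "holomorphic_vec_on f U"
    using assms unfolding holomorphic_germ_def by blast
  have "\<forall>\<^sub>F z in nhds (\<gamma> 0). z \<in> U" using eventually_nhds_in_open U by blast
  then have ev1: "\<forall>\<^sub>F t in nhds 0. \<gamma> t \<in> U" using eventually_curve[OF assms(1)] by blast
  have ev2: "\<forall>\<^sub>F t in nhds 0. \<forall>j. (\<lambda>s. \<gamma> s $ j) field_differentiable at t"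
  proof (rule eventually_all_finite)
    fix j
    obtain S where S: "open S" "0 \<in> S" "(\<lambda>t. \<gamma> t $ j) holomorphic_on S"
      using assms(1) unfolding analytic_curve_def analytic_at by blast
    then show "\<forall>\<^sub>F t in nhds 0. (\<lambda>s. \<gamma> s $ j) field_differentiable at t"
      unfolding eventually_nhds by (metis holomorphic_on_imp_differentiable_at)
  qed
  obtain S where S: "open S" "0 \<in> S" "\<And>t. t \<in> S \<Longrightarrow> \<gamma> t \<in> U \<and> (\<forall>j. (\<lambda>s. \<gamma> s $ j) field_differentiable at t)"
    using eventually_conj[OF ev1 ev2] unfolding eventually_nhds by blast
  have "(f \<circ> \<gamma>) field_differentiable at t" if t: "t \<in> S" for t
  proof -
    obtain D where D: "(f has_derivative D) (at (\<gamma> t))" "\<forall>c v. D (c *s v) = c * D v"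
      using U S(3)[OF t] unfolding holomorphic_vec_on_def by blast
    have "((\<lambda>s. \<gamma> s $ j) has_derivative (*) (deriv (\<lambda>s. \<gamma> s $ j) t)) (at t)" for j
      using S(3)[OF t] field_differentiable_derivI unfolding has_field_derivative_def by blast
    from has_derivative_vec[OF this] have "(\<gamma> has_derivative (\<lambda>h. \<chi> j. deriv (\<lambda>s. \<gamma> s $ j) t * h)) (at t)" .
    then have "(f \<circ> \<gamma> has_derivative (D \<circ> (\<lambda>h. \<chi> j. deriv (\<lambda>s. \<gamma> s $ j) t * h))) (at t)"
      by (rule diff_chain_at) (rule D(1))
    \<comment> \<open>Complex homogeneity of D turns the real derivative of the composite into
      multiplication by one complex number.\<close>
    moreover have "D \<circ> (\<lambda>h. \<chi> j. deriv (\<lambda>s. \<gamma> s $ j) t * h) = (*) (D (\<chi> j. deriv (\<lambda>s. \<gamma> s $ j) t))"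
    proof
      fix h
      have "(\<chi> j. deriv (\<lambda>s. \<gamma> s $ j) t * h) = h *s (\<chi> j. deriv (\<lambda>s. \<gamma> s $ j) t)" by (simp add: vec_eq_iff)
      then show "(D \<circ> (\<lambda>h. \<chi> j. deriv (\<lambda>s. \<gamma> s $ j) t * h)) h = D (\<chi> j. deriv (\<lambda>s. \<gamma> s $ j) t) * h"
        using D(2) by simp
    qed
    ultimately show ?thesis unfolding field_differentiable_def has_field_derivative_def by auto
  qed
  then show ?thesis unfolding analytic_at using S
    by (intro exI[of _ S]) (auto simp: holomorphic_on_def field_differentiable_at_within)
qed

text \<open>Stated by coefficients, so that the zero series qualifies for every n, in agreement with
  the value \<infinity> of \<open>ord0\<close>.\<close>

definition ordge :: "nat \<Rightarrow> complex fps \<Rightarrow> bool" where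
  "ordge n F \<longleftrightarrow> (\<forall>k<n. fps_nth F k = 0)"

lemma ordge_0 [simp]: "ordge 0 F" and ordge_zero [simp]: "ordge n 0"
  by (auto simp: ordge_def)

lemma ordge_add: "ordge n F \<Longrightarrow> ordge n G \<Longrightarrow> ordge n (F + G)"
  by (simp add: ordge_def)

lemma ordge_mono: "ordge n F \<Longrightarrow> m \<le> n \<Longrightarrow> ordge m F"
  by (simp add: ordge_def)

lemma ordge_iff_subdegree: "F \<noteq> 0 \<Longrightarrow> ordge n F \<longleftrightarrow> n \<le> subdegree F"
  unfolding ordge_def by (metis linorder_not_le nth_less_subdegree_zero nth_subdegree_nonzero order_less_le_trans)

lemma ordge_mult: "ordge m F \<Longrightarrow> ordge n G \<Longrightarrow> ordge (m + n) (F * G)"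
  by (cases "F = 0 \<or> G = 0") (auto simp: ordge_iff_subdegree)

lemma ordge_imp_factor:
  assumes "ordge n F" shows "F = fps_X ^ n * fps_shift n F"
  using assms
  by (intro fps_ext) (auto simp: fps_X_power_mult_nth ordge_def)

text \<open>Here and in the converse below, orders are exchanged for growth rates, because growth
  passes through changes of parameter and through functions of several variables.\<close>

lemma ordge_imp_bound:
  assumes "f has_fps_expansion F" "ordge n F"
  obtains K where "K \<ge> 0" "\<forall>\<^sub>F t in nhds 0. norm (f t) \<le> K * norm t ^ n"
proof -
  define G where "G = fps_shift n F"
  have r: "fps_conv_radius G > 0"
    using assms(1) unfolding G_def fps_conv_radius_shift by (simp add: has_fps_expansion_def)
  then have Ge: "eval_fps G has_fps_expansion G" by (rule eval_fps_has_fps_expansion)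
  have "(\<lambda>t. t ^ n * eval_fps G t) has_fps_expansion fps_X ^ n * G"
    by (intro has_fps_expansion_mult has_fps_expansion_fps_X_power Ge)
  then have "(\<lambda>t. t ^ n * eval_fps G t) has_fps_expansion F"
    using ordge_imp_factor[OF assms(2)] unfolding G_def by simp
  then have ev: "\<forall>\<^sub>F t in nhds 0. f t = t ^ n * eval_fps G t"
    using assms(1) unfolding has_fps_expansion_def by (auto elim: eventually_elim2)
  have "isCont (eval_fps G) 0"
    using has_fps_expansion_imp_continuous[OF Ge, of UNIV] by simp
  then have "(eval_fps G \<longlongrightarrow> eval_fps G 0) (nhds 0)" by (rule tendsto_nhds_isCont)
  then have "\<forall>\<^sub>F t in nhds 0. dist (eval_fps G t) (eval_fps G 0) < 1" by (rule tendstoD) simp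
  with ev have "\<forall>\<^sub>F t in nhds 0. norm (f t) \<le> (norm (eval_fps G 0) + 1) * norm t ^ n"
  proof eventually_elim
    case (elim t)
    have "norm (eval_fps G t) \<le> norm (eval_fps G 0) + norm (eval_fps G t - eval_fps G 0)"
      by (rule norm_triangle_sub)
    then have "norm (eval_fps G t) \<le> norm (eval_fps G 0) + 1" using elim by (simp add: dist_norm)
    then show ?case using elim by (simp add: norm_mult norm_power mult.commute mult_left_mono)
  qed
  then show thesis using that by (metis add_nonneg_nonneg norm_ge_zero zero_le_one)
qed

lemma bound_imp_ordge:
  assumes f: "f has_fps_expansion F" and b: "\<forall>\<^sub>F t in nhds 0. norm (f t) \<le> K * norm t ^ n"
  shows "ordge n F"
proof (rule ccontr)
  assume nt: "\<not> ordge n F"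
  then have F: "F \<noteq> 0" by auto
  define m where "m = subdegree F"
  have m: "m < n" using nt F ordge_iff_subdegree m_def by force
  define c where "c = fps_nth F m"
  have c: "c \<noteq> 0" using F unfolding c_def m_def by simp
  let ?h = "\<lambda>x. if x = 0 then c else f x / x ^ m"
  have "?h has_fps_expansion fps_shift m F"
    by (rule has_fps_expansion_shift[OF f]) (auto simp: m_def c_def)
  then have "(?h \<longlongrightarrow> c) (nhds 0)"
    using has_fps_expansion_imp_tendsto_0 by (metis (no_types, lifting) add_0 c_def fps_shift_nth)
  \<comment> \<open>f / t^m tends to the nonzero leading coefficient c, whereas the bound with
    exponent n > m forces the limit 0.\<close>
  then have l1: "(?h \<longlongrightarrow> c) (at 0)" using tendsto_mono[OF at_within_le_nhds] by blast
  have "(?h \<longlongrightarrow> 0) (at 0)"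
  proof (rule Lim_null_comparison)
    have "\<forall>\<^sub>F t in at 0. norm (f t) \<le> K * norm t ^ n \<and> t \<noteq> 0"
      using b by (auto simp: eventually_at_filter elim: eventually_mono)
    then show "\<forall>\<^sub>F t in at 0. norm (?h t) \<le> K * norm t ^ (n - m)"
    proof eventually_elim
      case (elim t)
      have "norm t ^ n = norm t ^ (n - m) * norm t ^ m" using m by (simp flip: power_add)
      then show ?case using elim by (simp add: norm_divide norm_power divide_simps mult.assoc)
    qed
    have "((\<lambda>t::complex. K * norm t ^ (n - m)) \<longlongrightarrow> K * norm (0::complex) ^ (n - m)) (at 0)"
      by (intro tendsto_intros)
    then show "((\<lambda>t::complex. K * norm t ^ (n - m)) \<longlongrightarrow> 0) (at 0)" using m by (simp add: power_0_left)
  qed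
  then have "c = 0" using tendsto_unique[OF _ l1] by simp
  then show False using c by simp
qed

locale curve =
  fixes p :: "complex^'n" and C :: "(complex^'n) set"
    and B :: "'r::finite \<Rightarrow> (complex^'n) set" and \<nu> :: "'r \<Rightarrow> complex \<Rightarrow> complex^'n"
  assumes curve: "curve_singularity p C B \<nu>"
begin

lemma nu_0 [simp]: "\<nu> i 0 = p"
  using curve unfolding curve_singularity_def normalization_germ_def by blast

lemma nu_normalization:
  obtains \<epsilon> U g where "\<epsilon> > 0" "open U" "p \<in> U" "\<forall>j. (\<lambda>t. \<nu> i t $ j) holomorphic_on ball 0 \<epsilon>"
    "homeomorphism (ball 0 \<epsilon>) (B i \<inter> U) (\<nu> i) g"
  using curve unfolding curve_singularity_def normalization_germ_def by metis

lemma nu_analytic: "analytic_curve (\<nu> i)"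
proof -
  obtain \<epsilon> U g where *: "\<epsilon> > 0" "open U" "p \<in> U" "\<forall>j. (\<lambda>t. \<nu> i t $ j) holomorphic_on ball 0 \<epsilon>"
    "homeomorphism (ball 0 \<epsilon>) (B i \<inter> U) (\<nu> i) g" by (rule nu_normalization[where i = i])
  show ?thesis unfolding analytic_curve_def analytic_at
    using * by (intro allI exI[of _ "ball 0 \<epsilon>"]) auto
qed

lemma nu_in_branch: "\<forall>\<^sub>F t in nhds 0. \<nu> i t \<in> B i"
proof -
  obtain \<epsilon> U g where *: "\<epsilon> > 0" "open U" "p \<in> U" "\<forall>j. (\<lambda>t. \<nu> i t $ j) holomorphic_on ball 0 \<epsilon>"
    "homeomorphism (ball 0 \<epsilon>) (B i \<inter> U) (\<nu> i) g" by (rule nu_normalization[where i = i])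
  have "\<forall>\<^sub>F t in nhds 0. t \<in> ball 0 \<epsilon>" by (rule eventually_nhds_in_open) (use * in auto)
  then show ?thesis by eventually_elim (use *(5) in \<open>auto simp: homeomorphism_def\<close>)
qed

lemma nu_inj: obtains \<epsilon> where "\<epsilon> > 0" "inj_on (\<nu> i) (ball 0 \<epsilon>)"
proof -
  obtain \<epsilon> U g where *: "\<epsilon> > 0" "open U" "p \<in> U" "\<forall>j. (\<lambda>t. \<nu> i t $ j) holomorphic_on ball 0 \<epsilon>"
    "homeomorphism (ball 0 \<epsilon>) (B i \<inter> U) (\<nu> i) g" by (rule nu_normalization[where i = i])
  have "inj_on (\<nu> i) (ball 0 \<epsilon>)"
    by (rule inj_on_inverseI[of _ g]) (use homeomorphism_apply1[OF *(5)] in auto)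
  then show thesis using that *(1) by blast
qed

lemma p_in_branch: "p \<in> B i"
  using curve unfolding curve_singularity_def irreducible_germ_def by blast

text \<open>Continuity of the inverse of the normalization map carries a property of small
  parameters to all points of the branch near p.\<close>

lemma nu_covers:
  assumes "\<forall>\<^sub>F t in nhds 0. P t"
  shows "\<forall>\<^sub>F z in nhds p. z \<in> B i \<longrightarrow> (\<exists>t. P t \<and> \<nu> i t = z)"
proof -
  obtain \<epsilon> U g where *: "\<epsilon> > 0" "open U" "p \<in> U" "\<forall>j. (\<lambda>t. \<nu> i t $ j) holomorphic_on ball 0 \<epsilon>"
    "homeomorphism (ball 0 \<epsilon>) (B i \<inter> U) (\<nu> i) g" by (rule nu_normalization[where i = i])
  have pU: "p \<in> B i \<inter> U" using p_in_branch * by blast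
  have g0: "g p = 0" using * nu_0 by (metis centre_in_ball homeomorphism_apply1)
  have "continuous_on (B i \<inter> U) g" using * by (simp add: homeomorphism_def)
  then have "(g \<longlongrightarrow> 0) (at p within B i \<inter> U)" using pU g0 unfolding continuous_on_def by metis
  then have "\<forall>\<^sub>F z in at p within B i \<inter> U. P (g z)"
    by (rule eventually_compose_filterlim[OF assms])
  moreover have "P (g p)" using eventually_nhds_x_imp_x[OF assms] g0 by simp
  ultimately have "\<forall>\<^sub>F z in nhds p. z \<in> B i \<inter> U \<longrightarrow> P (g z)"
    unfolding eventually_at_filter by (auto elim: eventually_mono)
  moreover have "\<forall>\<^sub>F z in nhds p. z \<in> U" using eventually_nhds_in_open * by blast
  ultimately show ?thesis
    by eventually_elim (use * in \<open>metis IntI homeomorphism_apply2\<close>)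
qed

lemma germ_C: "\<forall>\<^sub>F z in nhds p. z \<in> C \<longleftrightarrow> (\<exists>i. z \<in> B i)"
proof -
  have "\<forall>\<^sub>F z in nhds p. z \<in> C \<longrightarrow> z \<in> (\<Union>i. B i)" "\<forall>\<^sub>F z in nhds p. z \<in> (\<Union>i. B i) \<longrightarrow> z \<in> C"
    using curve unfolding curve_singularity_def germ_eq_def germ_subset_def by blast+
  then show ?thesis by eventually_elim auto
qed

lemma nu_in_C: "\<forall>\<^sub>F t in nhds 0. \<nu> i t \<in> C"
proof -
  have "\<forall>\<^sub>F t in nhds 0. \<nu> i t \<in> C \<longleftrightarrow> (\<exists>k. \<nu> i t \<in> B k)"
    using eventually_curve[OF nu_analytic, where P = "\<lambda>z. z \<in> C \<longleftrightarrow> (\<exists>k. z \<in> B k)"] germ_C by simp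
  with nu_in_branch[of i] show ?thesis by eventually_elim auto
qed

lemma nu_covers_C:
  assumes "\<And>i. \<forall>\<^sub>F t in nhds 0. P i t"
  shows "\<forall>\<^sub>F z in nhds p. z \<in> C \<longrightarrow> (\<exists>i t. P i t \<and> \<nu> i t = z)"
proof -
  have "\<forall>\<^sub>F z in nhds p. \<forall>i. z \<in> B i \<longrightarrow> (\<exists>t. P i t \<and> \<nu> i t = z)"
    by (intro eventually_all_finite nu_covers assms)
  with germ_C show ?thesis by eventually_elim blast
qed

text \<open>The bridge between germs on C and one-variable functions: one direction is continuity of
  the parametrizations, the other is that together they fill C near p.\<close>

lemma vanish_iff:
  "(\<forall>\<^sub>F z in nhds p. z \<in> C \<longrightarrow> P z) \<longleftrightarrow> (\<forall>i. \<forall>\<^sub>F t in nhds 0. P (\<nu> i t))"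
proof
  assume ev: "\<forall>\<^sub>F z in nhds p. z \<in> C \<longrightarrow> P z"
  show "\<forall>i. \<forall>\<^sub>F t in nhds 0. P (\<nu> i t)"
  proof
    fix i
    have "\<forall>\<^sub>F t in nhds 0. \<nu> i t \<in> C \<longrightarrow> P (\<nu> i t)"
      using eventually_curve[OF nu_analytic, where P = "\<lambda>z. z \<in> C \<longrightarrow> P z"] ev by simp
    with nu_in_C[of i] show "\<forall>\<^sub>F t in nhds 0. P (\<nu> i t)" by eventually_elim auto
  qed
next
  assume "\<forall>i. \<forall>\<^sub>F t in nhds 0. P (\<nu> i t)"
  then have "\<forall>\<^sub>F z in nhds p. z \<in> C \<longrightarrow> (\<exists>i t. P (\<nu> i t) \<and> \<nu> i t = z)" by (intro nu_covers_C) auto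
  then show "\<forall>\<^sub>F z in nhds p. z \<in> C \<longrightarrow> P z" by eventually_elim auto
qed

text \<open>The embedding of O into the product of the power series rings of the branches, written
  on representatives.\<close>

definition T :: "(complex^'n \<Rightarrow> complex) \<Rightarrow> 'r \<Rightarrow> complex fps" where
  "T f i = fps_expansion (f \<circ> \<nu> i) 0"

lemma T_expansion: "holomorphic_germ p f \<Longrightarrow> (\<lambda>t. f (\<nu> i t)) has_fps_expansion T f i"
  using analytic_at_imp_has_fps_expansion_0[OF pullback_analytic[OF nu_analytic, of i f]]
  unfolding T_def by (simp add: comp_def)

lemma T_eqI: "(\<lambda>t. f (\<nu> i t)) has_fps_expansion F \<Longrightarrow> T f i = F"
  unfolding T_def using fps_expansion_eqI by (simp add: comp_def)

lemma T_cong: "\<forall>\<^sub>F t in nhds 0. f (\<nu> i t) = g (\<nu> i t) \<Longrightarrow> holomorphic_germ p g \<Longrightarrow> T f i = T g i"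
  by (rule T_eqI) (simp add: has_fps_expansion_cong[OF _ refl] T_expansion)

lemma T_add: "holomorphic_germ p f \<Longrightarrow> holomorphic_germ p g \<Longrightarrow> T (f + g) i = T f i + T g i"
  by (rule T_eqI) (simp add: T_expansion has_fps_expansion_add)

lemma T_mult: "holomorphic_germ p f \<Longrightarrow> holomorphic_germ p g \<Longrightarrow> T (\<lambda>z. f z * g z) i = T f i * T g i"
  by (rule T_eqI) (simp add: T_expansion has_fps_expansion_mult)

lemma T_const: "T (\<lambda>z. c) i = fps_const c"
  by (rule T_eqI) simp

lemma T_fscale: "holomorphic_germ p f \<Longrightarrow> T (fscale c f) i = fps_const c * T f i"
  by (simp add: T_mult T_const fscale_def)

lemma T_power: "holomorphic_germ p f \<Longrightarrow> T (\<lambda>z. f z ^ k) i = T f i ^ k"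
  by (rule T_eqI) (simp add: T_expansion has_fps_expansion_power)

lemma T_zero_iff: "holomorphic_germ p f \<Longrightarrow> T f i = 0 \<longleftrightarrow> (\<forall>\<^sub>F t in nhds 0. f (\<nu> i t) = 0)"
  using T_expansion[of f i] T_eqI[of f i 0] by (auto simp flip: has_fps_expansion_0_iff)

lemma T_nth_0: "holomorphic_germ p f \<Longrightarrow> fps_nth (T f i) 0 = f p"
  using has_fps_expansion_imp_0_eq_fps_nth_0[OF T_expansion] by fastforce

lemma T_linear: "fs.linear_on (germs p) T"
  unfolding fs.linear_on_def by (auto simp: T_add T_fscale sscale_def fun_eq_iff)

text \<open>\<open>branch_val\<close> looks at a representative picked by \<open>SOME\<close>; it
  agrees with f on C near p and so has the same series on every branch.\<close>

lemma branch_val_cls: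
  assumes f: "holomorphic_germ p f"
  shows "enat n \<le> branch_val \<nu> i (germ_class p C f) \<longleftrightarrow> ordge n (T f i)"
proof -
  define f' where "f' = (SOME f'. f' \<in> germ_class p C f)"
  have "f' \<in> germ_class p C f" unfolding f'_def by (rule someI[of _ f]) (rule cls_self[OF f])
  then have f': "holomorphic_germ p f'" "\<forall>\<^sub>F z in nhds p. z \<in> C \<longrightarrow> f' z = f z"
    by (auto simp: mem_cls_iff[OF f])
  then have T: "T f' i = T f i" using T_cong[OF _ f] vanish_iff[of "\<lambda>z. f' z = f z"] by blast
  have e: "(\<lambda>t. f' (\<nu> i t)) has_fps_expansion T f i" using T_expansion[OF f'(1), of i] T by simp
  show ?thesis
  proof (cases "T f i = 0")
    case True
    then have "\<forall>\<^sub>F t in nhds 0. f' (\<nu> i t) = 0" using T T_zero_iff[OF f'(1), of i] by simp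
    then show ?thesis unfolding branch_val_def f'_def[symmetric] ord0_def using True by (simp add: comp_def)
  next
    case False
    then have "\<not> (\<forall>\<^sub>F t in nhds 0. f' (\<nu> i t) = 0)" using T T_zero_iff[OF f'(1), of i] by simp
    moreover have "zorder (\<lambda>t. f' (\<nu> i t)) 0 = int (subdegree (T f i))"
      by (rule has_fps_expansion_zorder_0[OF e False])
    ultimately show ?thesis
      unfolding branch_val_def f'_def[symmetric] ord0_def
      using ordge_iff_subdegree[OF False] by (simp add: comp_def)
  qed
qed

text \<open>One of the finitely many equations of B j must be nonzero along branch i: otherwise the
  covering property would put B i inside B j near p, but no component contains another.\<close>

lemma separate_branches:
  assumes "i \<noteq> j"
  obtains f where "holomorphic_germ p f" "T f j = 0" "T f i \<noteq> 0"
proof -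
  have an: "analytic_germ p (B j)" and ns: "\<not> germ_subset p (B i) (B j)"
    using curve assms unfolding curve_singularity_def irreducible_germ_def by blast+
  obtain U fs where U: "open U" "p \<in> U" "finite fs" "\<And>f. f \<in> fs \<Longrightarrow> holomorphic_vec_on f U"
    "B j \<inter> U = {x\<in>U. \<forall>f\<in>fs. f x = 0}"
    using an unfolding analytic_germ_def by blast
  have g: "holomorphic_germ p f" if "f \<in> fs" for f
    unfolding holomorphic_germ_def using U that by blast
  have evU: "\<forall>\<^sub>F z in nhds p. z \<in> U" using eventually_nhds_in_open U by blast
  have zj: "T f j = 0" if "f \<in> fs" for f
  proof -
    have "\<forall>\<^sub>F t in nhds 0. \<nu> j t \<in> U" using eventually_curve[OF nu_analytic] evU by simp
    with nu_in_branch[of j] have "\<forall>\<^sub>F t in nhds 0. f (\<nu> j t) = 0"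
      by eventually_elim (use U that in blast)
    then show ?thesis using T_zero_iff[OF g[OF that]] by blast
  qed
  have "\<exists>f\<in>fs. T f i \<noteq> 0"
  proof (rule ccontr)
    assume "\<not> (\<exists>f\<in>fs. T f i \<noteq> 0)"
    then have "\<forall>\<^sub>F t in nhds 0. \<forall>f\<in>fs. f (\<nu> i t) = 0"
      using U(3) T_zero_iff[OF g] by (auto intro: eventually_ball_finite)
    from nu_covers[OF this, of i] evU
    have "\<forall>\<^sub>F z in nhds p. z \<in> B i \<longrightarrow> z \<in> B j"
      by eventually_elim (use U in blast)
    then show False using ns unfolding germ_subset_def by blast
  qed
  then show thesis using that g zj by blast
qed

end

subsection \<open>The conductor of a branch\<close>

text \<open>Bilinear, without conjugation, so that it is holomorphic in w.\<close>

definition lin :: "complex^'n \<Rightarrow> complex^'n \<Rightarrow> complex" where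
  "lin \<alpha> w = (\<Sum>j\<in>UNIV. \<alpha> $ j * w $ j)"

text \<open>Finitely many hyperplanes do not cover the dual space; a form that works for S is
  perturbed by a coordinate in which w is nonzero.\<close>

lemma generic_linear_form:
  assumes "finite S" "0 \<notin> S"
  obtains \<alpha> where "\<forall>w\<in>S. lin \<alpha> w \<noteq> 0"
proof -
  have "\<exists>\<alpha>. \<forall>w\<in>S. lin \<alpha> w \<noteq> 0"
    using assms
  proof (induction S)
    case (insert w S)
    then obtain \<alpha> where \<alpha>: "\<forall>w\<in>S. lin \<alpha> w \<noteq> 0" by auto
    obtain k where k: "w $ k \<noteq> 0" using insert.prems by (metis insertI1 vec_eq_iff zero_index)
    define \<mu> :: "complex^'a" where "\<mu> = axis k 1"
    have \<mu>: "lin \<mu> v = v $ k" for v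
      unfolding lin_def \<mu>_def axis_def by (simp add: if_distrib if_distribR cong: if_cong)
    have add: "lin (\<alpha> + \<epsilon> *s \<mu>) v = lin \<alpha> v + \<epsilon> * v $ k" for \<epsilon> v
      unfolding \<mu>[symmetric] lin_def by (simp add: sum.distrib algebra_simps sum_distrib_left)
    \<comment> \<open>Each v with nonzero k-th coordinate forbids one value of \<epsilon>. If that
      coordinate is zero, then v lies in S and the perturbation does not change the value at
      v.\<close>
    have "finite ((\<lambda>v. - lin \<alpha> v / v $ k) ` insert w S)" using insert by simp
    then obtain \<epsilon> where \<epsilon>: "\<epsilon> \<notin> insert 0 ((\<lambda>v. - lin \<alpha> v / v $ k) ` insert w S)"
      using ex_new_if_finite[OF infinite_UNIV_char_0] by (metis finite_insert)
    have "lin (\<alpha> + \<epsilon> *s \<mu>) v \<noteq> 0" if v: "v \<in> insert w S" for v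
    proof (cases "v $ k = 0")
      case True
      then show ?thesis using v k \<alpha> by (auto simp: add)
    next
      case False
      show ?thesis
      proof
        assume "lin (\<alpha> + \<epsilon> *s \<mu>) v = 0"
        then have "\<epsilon> = - lin \<alpha> v / v $ k" using False unfolding add by (simp add: field_simps eq_neg_iff_add_eq_0)
        then show False using \<epsilon> v by blast
      qed
    qed
    then show ?case by blast
  qed simp
  then show thesis using that by blast
qed

lemma holomorphic_germ_lin: "holomorphic_germ p (\<lambda>z. lin \<alpha> (z - q))"
  unfolding lin_def by (intro holomorphic_germ_sum holomorphic_germ_mult) (auto intro: holomorphic_germ_diff)

text \<open>Writing f = t^m u with u(0) = c nonzero, the root is h = t u^(1/m), whose derivative at
  0 is an m-th root of c.\<close>

lemma nth_root_expansion:
  assumes f: "f has_fps_expansion F" and F: "F \<noteq> 0" and m: "subdegree F = m" "m \<ge> 1"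
  obtains h where "h analytic_on {0}" "h 0 = 0" "deriv h 0 \<noteq> 0" "\<forall>\<^sub>F t in nhds 0. f t = h t ^ m"
proof -
  define c where "c = fps_nth F m"
  have c: "c \<noteq> 0" unfolding c_def m(1)[symmetric] using F by simp
  define u where "u = (\<lambda>x. if x = 0 then c else f x / x ^ m)"
  have "u has_fps_expansion fps_shift m F"
    unfolding u_def by (rule has_fps_expansion_shift[OF f]) (auto simp: m c_def)
  then have u: "u analytic_on {0}" by (rule has_fps_expansion_imp_analytic_0)
  \<comment> \<open>Splitting off c leaves u / c with value 1 at 0, away from the cut of
    \<open>Ln\<close>; the root of c is a mere constant factor.\<close>
  define v where "v = (\<lambda>t. exp (Ln c / of_nat m) * exp (Ln (u t / c) / of_nat m))"
  have v: "v analytic_on {0}"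
    unfolding v_def using u c m by (intro analytic_intros) (auto simp: u_def)
  define h where "h = (\<lambda>t. t * v t)"
  have h: "h analytic_on {0}" unfolding h_def by (intro analytic_intros v)
  have vd: "v field_differentiable at 0"
    using v analytic_on_imp_differentiable_at by blast
  have "(h has_field_derivative (1 * v 0 + deriv v 0 * 0)) (at 0)"
    unfolding h_def using DERIV_mult[OF DERIV_ident field_differentiable_derivI[OF vd]] .
  then have "deriv h 0 = v 0" by (simp add: DERIV_imp_deriv)
  then have d: "deriv h 0 \<noteq> 0" unfolding v_def by simp
  have f0: "f 0 = 0"
    using has_fps_expansion_imp_0_eq_fps_nth_0[OF f] nth_less_subdegree_zero[of 0 F] m by simp
  have "isCont u 0" using analytic_at_imp_isCont[OF u] .
  then have "(u \<longlongrightarrow> c) (nhds 0)" using tendsto_nhds_isCont[of 0 u] by (simp add: u_def)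
  then have "\<forall>\<^sub>F t in nhds 0. u t \<noteq> 0" by (rule tendsto_imp_eventually_ne) (rule c)
  then have "\<forall>\<^sub>F t in nhds 0. f t = h t ^ m"
  proof eventually_elim
    case (elim t)
    have "v t ^ m = exp (Ln c) * exp (Ln (u t / c))"
      unfolding v_def power_mult_distrib using m by (simp flip: exp_of_nat_mult)
    then have "v t ^ m = u t" using c elim by simp
    then show ?case using elim m f0 by (cases "t = 0") (auto simp: h_def power_mult_distrib u_def power_0_left)
  qed
  then show thesis using that[OF h _ d] by (simp add: h_def)
qed

lemma analytic_local_inverse:
  assumes h: "h analytic_on {0}" "h 0 = 0" "deriv h 0 \<noteq> 0"
  obtains \<psi> where "\<psi> analytic_on {0}" "\<psi> 0 = 0" "\<forall>\<^sub>F s in nhds 0. h (\<psi> s) = s" "\<forall>\<^sub>F t in nhds 0. \<psi> (h t) = t"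
proof -
  obtain S where S: "open S" "0 \<in> S" "h holomorphic_on S" using h(1) by (auto simp: analytic_at)
  obtain r where r: "r > 0" "ball 0 r \<subseteq> S" "open (h ` ball 0 r)" "inj_on h (ball 0 r)"
    using has_complex_derivative_locally_invertible[OF S(3,2,1) h(3)] .
  have hb: "h holomorphic_on ball 0 r" using S r holomorphic_on_subset by blast
  obtain g where g: "g holomorphic_on h ` ball 0 r" "\<And>z. z \<in> ball 0 r \<Longrightarrow> g (h z) = z"
    using holomorphic_has_inverse[OF hb open_ball r(4)] by metis
  have 0: "0 \<in> h ` ball 0 r" using h(2) r(1) by force
  show thesis
  proof (rule that[of g])
    show "g analytic_on {0}" using g r 0 by (auto simp: analytic_at)
    show "g 0 = 0" using g(2)[of 0] h(2) r by simp
    have "\<forall>\<^sub>F s in nhds 0. s \<in> h ` ball 0 r" by (rule eventually_nhds_in_open[OF r(3) 0])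
    then show "\<forall>\<^sub>F s in nhds 0. h (g s) = s" by eventually_elim (use g in auto)
    have "\<forall>\<^sub>F t in nhds 0. t \<in> ball 0 r" by (rule eventually_nhds_in_open) (use r in auto)
    then show "\<forall>\<^sub>F t in nhds 0. g (h t) = t" by eventually_elim (use g in auto)
  qed
qed

text \<open>The series is e(s^m) with e reindexed; summability of c at r is summability of e at r^m,
  so e has positive radius as well.\<close>

lemma expansion_in_power:
  assumes c: "fps_conv_radius c > 0" and m: "m \<ge> 1" and z: "\<And>n. \<not> m dvd n \<Longrightarrow> fps_nth c n = 0"
  obtains E where "E analytic_on {0}" "(\<lambda>s::complex. E (s ^ m)) has_fps_expansion c"
proof -
  define e where "e = Abs_fps (\<lambda>n. fps_nth c (m * n))"
  have mono: "strict_mono (\<lambda>n. m * n)" using m by (auto simp: strict_mono_def)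
  have out: "fps_nth c n * s ^ n = 0" if "n \<notin> range (\<lambda>n. m * n)" for n and s :: complex
    using z[of n] that by (auto simp: dvd_def)
  obtain r where r: "r > 0" "ereal r < fps_conv_radius c"
    using c by (metis ereal_dense2 ereal_less(2) less_ereal.simps(1) zero_ereal_def)
  have "summable (\<lambda>n. fps_nth c n * of_real r ^ n)" by (rule summable_fps) (use r in simp)
  then have "summable (\<lambda>n. fps_nth c (m * n) * of_real r ^ (m * n))"
    by (subst summable_mono_reindex[OF mono, where f = "\<lambda>n. fps_nth c n * of_real r ^ n"]) (use out in auto)
  then have "summable (\<lambda>n. fps_nth e n * (of_real r ^ m) ^ n)" by (simp add: e_def power_mult)
  then have "conv_radius (fps_nth e) \<ge> norm (of_real r ^ m :: complex)" by (rule conv_radius_geI)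
  moreover have "norm (of_real r ^ m :: complex) > 0" using r by simp
  ultimately have e: "fps_conv_radius e > 0" unfolding fps_conv_radius_def
    by (metis ereal_less(2) less_le_trans)
  have Ee: "eval_fps e has_fps_expansion e" using eval_fps_has_fps_expansion[OF e] .
  show thesis
  proof (rule that)
    show "eval_fps e analytic_on {0}" by (rule has_fps_expansion_imp_analytic_0[OF Ee])
    have "\<forall>\<^sub>F u in nhds 0. (\<lambda>n. fps_nth e n * u ^ n) sums eval_fps e u"
    proof -
      have "\<forall>\<^sub>F u in nhds 0. u \<in> eball 0 (fps_conv_radius e)"
        by (rule eventually_nhds_in_open) (use e in \<open>auto simp: zero_ereal_def\<close>)
      then show ?thesis by eventually_elim (auto intro: sums_eval_fps)
    qed
    moreover have "filterlim (\<lambda>s::complex. s ^ m) (nhds 0) (nhds 0)"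
    proof -
      have "isCont (\<lambda>s::complex. s ^ m) 0" by (intro continuous_intros)
      then show ?thesis using tendsto_nhds_isCont[of 0 "\<lambda>s::complex. s ^ m"] m by (simp add: power_0_left)
    qed
    ultimately have "\<forall>\<^sub>F s in nhds 0. (\<lambda>n. fps_nth e n * (s ^ m) ^ n) sums eval_fps e (s ^ m)"
      by (rule eventually_compose_filterlim)
    then have "\<forall>\<^sub>F s in nhds 0. (\<lambda>n. fps_nth c n * s ^ n) sums eval_fps e (s ^ m)"
    proof eventually_elim
      case (elim s)
      then have "(\<lambda>n. fps_nth c (m * n) * s ^ (m * n)) sums eval_fps e (s ^ m)" by (simp add: e_def power_mult)
      then show ?case by (subst (asm) sums_mono_reindex[OF mono, where f = "\<lambda>n. fps_nth c n * s ^ n"]) (use out in auto)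
    qed
    then show "(\<lambda>s. eval_fps e (s ^ m)) has_fps_expansion c" by (rule has_fps_expansionI)
  qed
qed

section \<open>Substitution of u s for s in series and in polynomials over series\<close>

definition rot :: "complex \<Rightarrow> complex fps \<Rightarrow> complex fps" where
  "rot u F = Abs_fps (\<lambda>n. u ^ n * fps_nth F n)"

lemma rot_compose: "rot u F = fps_compose F (fps_const u * fps_X)"
  unfolding rot_def fps_compose_linear ..

lemma rot_add: "rot u (F + G) = rot u F + rot u G" and rot_0 [simp]: "rot u 0 = 0"
  and rot_minus: "rot u (- F) = - rot u F" and rot_1 [simp]: "rot 1 F = F" and rot_one [simp]: "rot u 1 = 1"
  and rot_rot: "rot u (rot v F) = rot (u * v) F"
  by (auto simp: rot_def fps_eq_iff algebra_simps power_mult_distrib)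

lemma rot_mult: "rot u (F * G) = rot u F * rot u G"
  unfolding rot_compose by (rule fps_compose_mult_distrib) simp

lemma rot_sum: "rot u (sum f A) = (\<Sum>a\<in>A. rot u (f a))"
  by (induction A rule: infinite_finite_induct) (auto simp: rot_add)

lemma rot_expansion:
  assumes "f has_fps_expansion F" shows "(\<lambda>s. f (u * s)) has_fps_expansion rot u F"
proof -
  have "(\<lambda>s. u * s) has_fps_expansion fps_const u * fps_X"
    by (intro has_fps_expansion_cmult_left has_fps_expansion_fps_X)
  from has_fps_expansion_compose[OF assms this] show ?thesis by (simp add: rot_compose comp_def)
qed

lemma rot_conv:
  assumes "fps_conv_radius F > 0" shows "fps_conv_radius (rot u F) > 0"
  using rot_expansion[OF eval_fps_has_fps_expansion[OF assms], of u] by (simp add: has_fps_expansion_def)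

lemma coeff_rot_poly [simp]: "Polynomial.coeff (map_poly (rot u) P) n = rot u (Polynomial.coeff P n)"
  by (rule coeff_map_poly) simp

lemma rot_poly_mult: "map_poly (rot u) (P * Q) = map_poly (rot u) P * map_poly (rot u) Q"
  by (rule poly_eqI) (simp add: coeff_mult rot_sum rot_mult)

lemma rot_poly_sum: "map_poly (rot u) (sum P A) = (\<Sum>a\<in>A. map_poly (rot u) (P a))"
  by (rule poly_eqI) (simp add: coeff_sum rot_sum)

lemma rot_poly_prod: "map_poly (rot u) (prod P A) = (\<Prod>a\<in>A. map_poly (rot u) (P a))"
  by (induction A rule: infinite_finite_induct) (auto simp: rot_poly_mult map_poly_1)

section \<open>Convergent series under ring operations and division\<close>

lemma conv_add: "fps_conv_radius F > 0 \<Longrightarrow> fps_conv_radius G > 0 \<Longrightarrow> fps_conv_radius (F + G :: complex fps) > 0"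
  using fps_conv_radius_add[of F G] by (metis less_le_trans min_less_iff_conj)

lemma conv_mult: "fps_conv_radius F > 0 \<Longrightarrow> fps_conv_radius G > 0 \<Longrightarrow> fps_conv_radius (F * G :: complex fps) > 0"
  using fps_conv_radius_mult[of F G] by (metis less_le_trans min_less_iff_conj)

lemma conv_sum: "(\<And>a. a \<in> A \<Longrightarrow> fps_conv_radius (F a) > 0) \<Longrightarrow> fps_conv_radius (sum F A :: complex fps) > 0"
  by (induction A rule: infinite_finite_induct) (auto intro: conv_add)

lemma conv_prod: "(\<And>a. a \<in> A \<Longrightarrow> fps_conv_radius (F a) > 0) \<Longrightarrow> fps_conv_radius (prod F A :: complex fps) > 0"
  by (induction A rule: infinite_finite_induct) (auto intro: conv_mult)

lemma conv_poly_mult: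
  "(\<And>n. fps_conv_radius (Polynomial.coeff P n) > 0) \<Longrightarrow> (\<And>n. fps_conv_radius (Polynomial.coeff Q n) > 0) \<Longrightarrow>
    fps_conv_radius (Polynomial.coeff (P * Q) n :: complex fps) > 0"
  unfolding coeff_mult by (intro conv_sum conv_mult)

lemma conv_poly_prod:
  "(\<And>a n. a \<in> A \<Longrightarrow> fps_conv_radius (Polynomial.coeff (P a) n) > 0) \<Longrightarrow> fps_conv_radius (Polynomial.coeff (prod P A) n :: complex fps) > 0"
proof (induction A arbitrary: n rule: infinite_finite_induct)
  case (insert a A)
  then show ?case by (auto intro: conv_poly_mult)
qed (auto simp: coeff_1)

text \<open>Once the power of the variable is split off, the divisor is a unit among convergent
  series. The last conclusion records that division lowers an order by no more than the order of
  D.\<close>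

lemma conv_quotient:
  assumes G: "fps_conv_radius G > 0" and D: "fps_conv_radius D > 0" "D \<noteq> 0" and o: "ordge (subdegree D) G"
  obtains q :: "complex fps" where "fps_conv_radius q > 0" "G = D * q" "\<And>n. ordge (subdegree D + n) G \<Longrightarrow> ordge n q"
proof -
  let ?d = "subdegree D"
  define q where "q = fps_shift ?d G * inverse (fps_shift ?d D)"
  have u: "fps_nth (fps_shift ?d D) 0 \<noteq> 0" using D by simp
  have "(\<lambda>x. inverse (eval_fps (fps_shift ?d D) x)) has_fps_expansion inverse (fps_shift ?d D)"
    using D u by (intro has_fps_expansion_inverse eval_fps_has_fps_expansion) auto
  then have q: "fps_conv_radius q > 0" unfolding q_def using G by (intro conv_mult) (auto simp: has_fps_expansion_def)
  have "D * q = fps_X ^ ?d * fps_shift ?d G * (fps_shift ?d D * inverse (fps_shift ?d D))"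
    using ordge_imp_factor[of ?d D] D(2) ordge_iff_subdegree[of D ?d] unfolding q_def by (simp add: ac_simps)
  also have "\<dots> = G" using ordge_imp_factor[OF o] u by (simp add: inverse_mult_eq_1')
  finally have Dq: "G = D * q" by simp
  have "ordge n q" if "ordge (?d + n) G" for n
    using that D(2) unfolding Dq by (cases "q = 0") (auto simp: ordge_iff_subdegree)
  then show thesis using that q Dq by blast
qed

text \<open>With \<open>x = s\<^sup>m\<close>, every \<open>g\<close> is multiplied into the subring generated by \<open>x\<close> and a
  generic linear form \<open>Y\<close> by \<open>\<Delta> = \<Prod>(Y - Y(u s))\<close>, the product running over the nontrivial
  \<open>m\<close>-th roots of unity \<open>u\<close>: Lagrange interpolation over all of them writes \<open>g \<Delta>\<close> as a polynomial
  in \<open>Y\<close> whose coefficients are invariant under \<open>s \<mapsto> u s\<close>, that is, series in \<open>x\<close>.\<close>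

lemma conductor_power:
  assumes x: "holomorphic_germ p x" and \<gamma>: "analytic_curve \<gamma>" "\<gamma> 0 = p" and m: "m \<ge> 1"
    and xs: "\<forall>\<^sub>F s in nhds 0. x (\<gamma> s) = s ^ m"
    and inj: "\<epsilon> > 0" "inj_on \<gamma> (ball 0 \<epsilon>)"
  obtains d where "\<And>g. fps_conv_radius g > 0 \<Longrightarrow> ordge d g \<Longrightarrow>
    \<exists>f. holomorphic_germ p f \<and> (\<lambda>s. f (\<gamma> s)) has_fps_expansion g"
proof -
  define Z where "Z = {u::complex. u ^ m = 1}"
  have finZ: "finite Z" unfolding Z_def using m by (intro finite_roots_unity) auto
  have Z1: "1 \<in> Z" unfolding Z_def by simp
  have Zmult: "u * v \<in> Z" if "u \<in> Z" "v \<in> Z" for u v using that unfolding Z_def by (simp add: power_mult_distrib)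
  have Z0: "u \<noteq> 0" if "u \<in> Z" for u using that m unfolding Z_def by (auto simp: power_0_left)
  have Zinv: "inverse u \<in> Z" if "u \<in> Z" for u using that unfolding Z_def by (simp add: power_inverse)
  have Znorm: "norm u = 1" if "u \<in> Z" for u
  proof -
    have "norm u ^ m = 1" using that unfolding Z_def by (metis (mono_tags) mem_Collect_eq norm_one norm_power)
    then show ?thesis using m power_eq_imp_eq_base[of "norm u" m 1] by simp
  qed
  define \<Gamma> where "\<Gamma> = (\<lambda>j. fps_expansion (\<lambda>s. \<gamma> s $ j) 0)"
  have \<Gamma>: "(\<lambda>s. \<gamma> s $ j) has_fps_expansion \<Gamma> j" for j
    unfolding \<Gamma>_def using \<gamma> analytic_curve_def by (intro analytic_at_imp_has_fps_expansion_0) auto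
  \<comment> \<open>The k-th Taylor coefficient vector of \<gamma>(s) - \<gamma>(u s). One nonzero
    such vector per u reduces genericity of the linear form to finitely many conditions.\<close>
  define w where "w = (\<lambda>u k. (\<chi> j. fps_nth (\<Gamma> j - rot u (\<Gamma> j)) k))"
  \<comment> \<open>Otherwise \<gamma>(u s) = \<gamma>(s) near 0. As |u| = 1, both parameters lie in
    the disc of injectivity, and a small s > 0 yields u = 1.\<close>
  have "\<exists>k. w u k \<noteq> 0" if u: "u \<in> Z - {1}" for u
  proof (rule ccontr)
    assume "\<not> (\<exists>k. w u k \<noteq> 0)"
    then have "\<Gamma> j = rot u (\<Gamma> j)" for j
      unfolding w_def by (simp add: fps_eq_iff vec_eq_iff)
    then have e0: "(\<lambda>s. \<gamma> (u * s) $ j - \<gamma> s $ j) has_fps_expansion 0" for j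
      using has_fps_expansion_diff[OF rot_expansion[OF \<Gamma>[of j], of u] \<Gamma>[of j]] by simp
    have "\<forall>\<^sub>F s in nhds 0. \<forall>j. \<gamma> (u * s) $ j - \<gamma> s $ j = 0"
      by (intro eventually_all_finite) (rule e0[unfolded has_fps_expansion_0_iff])
    then obtain \<delta> where \<delta>: "\<delta> > 0" "\<And>s. dist s 0 < \<delta> \<Longrightarrow> \<forall>j. \<gamma> (u * s) $ j - \<gamma> s $ j = 0"
      unfolding eventually_nhds_metric by blast
    define s :: complex where "s = of_real (min \<delta> \<epsilon> / 2)"
    have ns: "norm s = min \<delta> \<epsilon> / 2" unfolding s_def norm_of_real using \<delta> inj by simp
    have s: "norm s < \<delta>" "norm s < \<epsilon>" "s \<noteq> 0" using \<delta> inj ns by auto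
    have "\<gamma> (u * s) = \<gamma> s" using \<delta>(2)[of s] s by (simp add: vec_eq_iff)
    moreover have "s \<in> ball 0 \<epsilon>" "u * s \<in> ball 0 \<epsilon>" using s Znorm u by (auto simp: norm_mult)
    ultimately have "u * s = s" using inj(2) by (auto dest: inj_onD)
    then show False using s u by simp
  qed
  then obtain k where k: "\<And>u. u \<in> Z - {1} \<Longrightarrow> w u (k u) \<noteq> 0" by metis
  have fin: "finite ((\<lambda>u. w u (k u)) ` (Z - {1}))" using finZ by simp
  have n0: "0 \<notin> (\<lambda>u. w u (k u)) ` (Z - {1})" using k by force
  obtain \<alpha> where \<alpha>: "\<forall>v\<in>(\<lambda>u. w u (k u)) ` (Z - {1}). lin \<alpha> v \<noteq> 0"
    by (rule generic_linear_form[OF fin n0])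
  define y where "y = (\<lambda>z. lin \<alpha> (z - 0))"
  define Y where "Y = (\<Sum>j\<in>UNIV. fps_const (\<alpha> $ j) * \<Gamma> j)"
  have y: "holomorphic_germ p y" unfolding y_def by (rule holomorphic_germ_lin)
  have Y: "(\<lambda>s. y (\<gamma> s)) has_fps_expansion Y"
    unfolding y_def Y_def lin_def by (intro has_fps_expansion_sum) (use has_fps_expansion_cmult_left[OF \<Gamma>] in auto)
  have Yr: "fps_conv_radius Y > 0" using Y by (simp add: has_fps_expansion_def)
  have Yrot: "Y - rot u Y \<noteq> 0" if u: "u \<in> Z - {1}" for u
  proof -
    have "fps_nth (Y - rot u Y) (k u) = lin \<alpha> (w u (k u))"
      unfolding Y_def lin_def w_def
      by (simp add: rot_def fps_sum_nth sum_distrib_left algebra_simps sum_subtractf)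
    then have "fps_nth (Y - rot u Y) (k u) \<noteq> 0" using \<alpha> u by auto
    then show ?thesis by auto
  qed
  define \<Delta> where "\<Delta> = (\<Prod>v\<in>Z - {1}. Y - rot v Y)"
  have \<Delta>0: "\<Delta> \<noteq> 0" unfolding \<Delta>_def using Yrot finZ by simp
  have \<Delta>r: "fps_conv_radius \<Delta> > 0"
  proof -
    have "fps_conv_radius (Y - rot v Y) > 0" for v
      using has_fps_expansion_diff[OF Y rot_expansion[OF Y, of v]] by (simp add: has_fps_expansion_def)
    then show ?thesis unfolding \<Delta>_def by (intro conv_prod)
  qed
  show thesis
  proof (rule that[of "subdegree \<Delta>"])
    fix G :: "complex fps" assume G: "fps_conv_radius G > 0" "ordge (subdegree \<Delta>) G"
    obtain g where g: "fps_conv_radius g > 0" "G = \<Delta> * g" using conv_quotient[OF G(1) \<Delta>r \<Delta>0 G(2)] by metis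
    \<comment> \<open>Lagrange numerators without their denominators: at Y only the summand of u = 1
      survives, and its product is \<Delta>.\<close>
    define Q where "Q = (\<Sum>u\<in>Z. Polynomial.smult (rot u g) (\<Prod>v\<in>Z - {u}. [:- rot v Y, 1:]))"
    have QY: "poly Q Y = G"
    proof -
      have "poly Q Y = (\<Sum>u\<in>Z. rot u g * (\<Prod>v\<in>Z - {u}. Y - rot v Y))"
        unfolding Q_def by (simp add: poly_sum poly_prod)
      also have "\<dots> = (\<Sum>u\<in>{1}. rot u g * (\<Prod>v\<in>Z - {u}. Y - rot v Y))"
      proof (rule sum.mono_neutral_right)
        show "\<forall>u\<in>Z - {1}. rot u g * (\<Prod>v\<in>Z - {u}. Y - rot v Y) = 0"
        proof
          fix u assume "u \<in> Z - {1}"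
          then have "1 \<in> Z - {u}" using Z1 by auto
          then have "(\<Prod>v\<in>Z - {u}. Y - rot v Y) = 0" using finZ by (intro prod_zero) (auto intro: bexI[of _ 1])
          then show "rot u g * (\<Prod>v\<in>Z - {u}. Y - rot v Y) = 0" by simp
        qed
      qed (use finZ Z1 in auto)
      also have "\<dots> = G" using g unfolding \<Delta>_def by (simp add: mult.commute)
      finally show ?thesis .
    qed
    \<comment> \<open>Rotation by \<zeta> permutes the interpolation nodes and sends the summand of
      u to that of \<zeta> u.\<close>
    have Qrot: "map_poly (rot \<zeta>) Q = Q" if \<zeta>: "\<zeta> \<in> Z" for \<zeta>
    proof -
      have c: "inverse \<zeta> * (\<zeta> * a) = a" "\<zeta> * (inverse \<zeta> * a) = a" for a
        using Z0[OF \<zeta>] by auto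
      have bij: "bij_betw ((*) \<zeta>) (Z - {u}) (Z - {\<zeta> * u})" for u
      proof (rule bij_betw_byWitness[of _ "(*) (inverse \<zeta>)"])
        show "(*) \<zeta> ` (Z - {u}) \<subseteq> Z - {\<zeta> * u}" using Zmult[OF \<zeta>] Z0[OF \<zeta>] by auto
        show "(*) (inverse \<zeta>) ` (Z - {\<zeta> * u}) \<subseteq> Z - {u}"
        proof
          fix x assume "x \<in> (*) (inverse \<zeta>) ` (Z - {\<zeta> * u})"
          then obtain a where a: "a \<in> Z" "a \<noteq> \<zeta> * u" "x = inverse \<zeta> * a" by auto
          then have "x \<noteq> u" using c(2)[of a] by auto
          then show "x \<in> Z - {u}" using a Zmult[OF Zinv[OF \<zeta>]] by blast
        qed
      qed (use c in auto)
      have bijZ: "bij_betw ((*) \<zeta>) Z Z"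
        by (rule bij_betw_byWitness[of _ "(*) (inverse \<zeta>)"]) (use c Zmult[OF \<zeta>] Zmult[OF Zinv[OF \<zeta>]] in auto)
      have "map_poly (rot \<zeta>) Q = (\<Sum>u\<in>Z. Polynomial.smult (rot (\<zeta> * u) g) (\<Prod>v\<in>Z - {u}. [:- rot (\<zeta> * v) Y, 1:]))"
        unfolding Q_def rot_poly_sum
        by (intro sum.cong refl)
          (simp add: map_poly_smult rot_mult rot_poly_prod map_poly_pCons rot_minus rot_rot)
      also have "\<dots> = (\<Sum>u\<in>Z. Polynomial.smult (rot (\<zeta> * u) g) (\<Prod>v\<in>Z - {\<zeta> * u}. [:- rot v Y, 1:]))"
        by (intro sum.cong refl arg_cong2[where f = Polynomial.smult] prod.reindex_bij_betw[OF bij, where g = "\<lambda>v. [:- rot v Y, 1:]"])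
      also have "\<dots> = Q"
        unfolding Q_def by (rule sum.reindex_bij_betw[OF bijZ, where g = "\<lambda>u. Polynomial.smult (rot u g) (\<Prod>v\<in>Z - {u}. [:- rot v Y, 1:])"])
      finally show ?thesis .
    qed
    have inv: "fps_nth (Polynomial.coeff Q n) l = 0" if l: "\<not> m dvd l" for n l
    proof -
      \<comment> \<open>A primitive m-th root of unity: its l-th power is 1 only if m divides l, so
        invariance kills all other coefficients.\<close>
      define \<zeta> where "\<zeta> = exp (2 * of_real pi * \<i> * of_nat 1 / of_nat m :: complex)"
      have e: "\<zeta> ^ j = exp (2 * of_real pi * \<i> * of_nat j / of_nat m)" for j
        unfolding \<zeta>_def by (simp add: mult_ac flip: exp_of_nat_mult)
      have "\<zeta> \<in> Z" unfolding Z_def using e[of m] complex_root_unity_eq_1[OF m, of m] by simp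
      then have "rot \<zeta> (Polynomial.coeff Q n) = Polynomial.coeff Q n" using Qrot by (metis coeff_rot_poly)
      then have "\<zeta> ^ l * fps_nth (Polynomial.coeff Q n) l = fps_nth (Polynomial.coeff Q n) l"
        by (metis fps_nth_Abs_fps rot_def)
      moreover have "\<zeta> ^ l \<noteq> 1" using e[of l] complex_root_unity_eq_1[OF m, of l] l by simp
      ultimately show ?thesis by simp
    qed
    have Qr: "fps_conv_radius (Polynomial.coeff Q n) > 0" for n
    proof -
      have 1: "fps_conv_radius (Polynomial.coeff [:- rot v Y, 1:] n) > 0" for v n
        using has_fps_expansion_minus[OF rot_expansion[OF Y, of v]]
        by (cases n) (auto simp: has_fps_expansion_def coeff_pCons split: nat.splits)
      show ?thesis unfolding Q_def coeff_sum coeff_smult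
        by (intro conv_sum conv_mult rot_conv g conv_poly_prod 1)
    qed
    have "\<forall>n. \<exists>E. E analytic_on {0} \<and> (\<lambda>s. E (s ^ m)) has_fps_expansion Polynomial.coeff Q n"
      using expansion_in_power[OF Qr m inv] by metis
    then obtain E where E: "\<And>n. E n analytic_on {0}" "\<And>n. (\<lambda>s. E n (s ^ m)) has_fps_expansion Polynomial.coeff Q n"
      by metis
    have x0: "x p = 0" using eventually_nhds_x_imp_x[OF xs] \<gamma> m by (simp add: power_0_left)
    \<comment> \<open>Q evaluated at y, with its coefficients realized as functions of x. Along
      \<gamma> one has x = s^m, so f restricts to Q(Y) = G.\<close>
    define f where "f = (\<lambda>z. \<Sum>n\<le>degree Q. E n (x z) * y z ^ n)"
    have "holomorphic_germ p f"
      unfolding f_def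
      by (intro holomorphic_germ_sum holomorphic_germ_mult holomorphic_germ_power y holomorphic_germ_compose[OF x])
        (use x0 E in auto)
    moreover have "(\<lambda>s. f (\<gamma> s)) has_fps_expansion G"
    proof -
      have "(\<lambda>s. \<Sum>n\<le>degree Q. E n (s ^ m) * y (\<gamma> s) ^ n) has_fps_expansion (\<Sum>n\<le>degree Q. Polynomial.coeff Q n * Y ^ n)"
        by (intro has_fps_expansion_sum has_fps_expansion_mult has_fps_expansion_power Y E)
      then have 1: "(\<lambda>s. \<Sum>n\<le>degree Q. E n (s ^ m) * y (\<gamma> s) ^ n) has_fps_expansion G"
        using QY by (simp add: poly_altdef)
      have 2: "\<forall>\<^sub>F s in nhds 0. f (\<gamma> s) = (\<Sum>n\<le>degree Q. E n (s ^ m) * y (\<gamma> s) ^ n)"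
        using xs by eventually_elim (simp add: f_def)
      show ?thesis by (rule iffD2[OF has_fps_expansion_cong[OF 2 refl] 1])
    qed
    ultimately show "\<exists>f. holomorphic_germ p f \<and> (\<lambda>s. f (\<gamma> s)) has_fps_expansion G" by blast
  qed
qed

section \<open>The order of a branch and its adapted parameter\<close>

lemma analytic_compose_0:
  assumes "f analytic_on {0::complex}" "g analytic_on {0::complex}" "g 0 = 0"
  shows "(\<lambda>s. f (g s)) analytic_on {0}"
  using analytic_on_compose_gen[OF assms(2,1)] assms(3) by (simp add: comp_def)

lemma filterlim_analytic_0:
  assumes "g analytic_on {0::complex}" "g 0 = 0"
  shows "filterlim g (nhds (0::complex)) (nhds 0)"
  using tendsto_nhds_isCont[OF analytic_at_imp_isCont[OF assms(1)]] assms(2) by simp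

definition coefvec :: "(complex \<Rightarrow> complex^'n) \<Rightarrow> nat \<Rightarrow> complex^'n" where
  "coefvec \<gamma> k = (\<chi> j. fps_nth (fps_expansion (\<lambda>s. \<gamma> s $ j) 0) k)"

text \<open>The multiplicity of a parametrized branch: the least order of the coordinates centred at
  the base point, which is why the constant coefficient is left out.\<close>

definition curve_ord :: "(complex \<Rightarrow> complex^'n) \<Rightarrow> nat" where
  "curve_ord \<gamma> = (LEAST k. k \<ge> 1 \<and> coefvec \<gamma> k \<noteq> 0)"

text \<open>The minimum exists because an injective curve is not constant near 0.\<close>

lemma curve_ord:
  assumes "analytic_curve \<gamma>" "\<epsilon> > 0" "inj_on \<gamma> (ball 0 \<epsilon>)"
  shows "curve_ord \<gamma> \<ge> 1" "coefvec \<gamma> (curve_ord \<gamma>) \<noteq> 0"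
    and "\<And>k. 1 \<le> k \<Longrightarrow> k < curve_ord \<gamma> \<Longrightarrow> coefvec \<gamma> k = 0"
proof -
  have ex: "\<exists>k. k \<ge> 1 \<and> coefvec \<gamma> k \<noteq> 0"
  proof (rule ccontr)
    assume n: "\<not> (\<exists>k. k \<ge> 1 \<and> coefvec \<gamma> k \<noteq> 0)"
    have "\<forall>\<^sub>F s in nhds 0. \<forall>j. \<gamma> s $ j = \<gamma> 0 $ j"
    proof (rule eventually_all_finite)
      fix j
      let ?F = "fps_expansion (\<lambda>s. \<gamma> s $ j) 0"
      have F: "(\<lambda>s. \<gamma> s $ j) has_fps_expansion ?F"
        using assms(1) unfolding analytic_curve_def by (intro analytic_at_imp_has_fps_expansion_0) auto
      have "fps_nth ?F k = 0" if "k \<ge> 1" for k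
        using n that unfolding coefvec_def by (metis vec_lambda_beta zero_index)
      moreover have "fps_nth ?F 0 = \<gamma> 0 $ j" using has_fps_expansion_imp_0_eq_fps_nth_0[OF F] by simp
      ultimately have "?F = fps_const (\<gamma> 0 $ j)" by (intro fps_ext) (auto simp: not_less_eq_eq)
      then have "(\<lambda>s. \<gamma> s $ j - \<gamma> 0 $ j) has_fps_expansion 0"
        using has_fps_expansion_diff[OF F has_fps_expansion_const[of "\<gamma> 0 $ j"]] by simp
      then show "\<forall>\<^sub>F s in nhds 0. \<gamma> s $ j = \<gamma> 0 $ j" by (simp add: has_fps_expansion_0_iff)
    qed
    then obtain \<delta> where \<delta>: "\<delta> > 0" "\<And>s. dist s 0 < \<delta> \<Longrightarrow> \<forall>j. \<gamma> s $ j = \<gamma> 0 $ j"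
      unfolding eventually_nhds_metric by blast
    define s :: complex where "s = of_real (min \<delta> \<epsilon> / 2)"
    have ns: "norm s = min \<delta> \<epsilon> / 2" unfolding s_def norm_of_real using \<delta> assms by simp
    have s: "norm s < \<delta>" "norm s < \<epsilon>" "s \<noteq> 0" using \<delta> assms ns by auto
    have "\<gamma> s = \<gamma> 0" using \<delta>(2)[of s] s by (simp add: vec_eq_iff)
    then show False using assms(2,3) s by (auto dest!: inj_onD[where x = s and y = 0])
  qed
  from LeastI_ex[OF ex] show "curve_ord \<gamma> \<ge> 1" "coefvec \<gamma> (curve_ord \<gamma>) \<noteq> 0"
    unfolding curve_ord_def by auto
  fix k assume "1 \<le> k" "k < curve_ord \<gamma>"
  then show "coefvec \<gamma> k = 0" using not_less_Least[of k "\<lambda>k. k \<ge> 1 \<and> coefvec \<gamma> k \<noteq> 0"] unfolding curve_ord_def by auto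
qed

lemma lin_expansion:
  assumes "analytic_curve \<gamma>" "\<gamma> 0 = p"
  obtains F where "(\<lambda>s. lin \<alpha> (\<gamma> s - p)) has_fps_expansion F" "fps_nth F 0 = 0"
    "\<forall>k\<ge>1. fps_nth F k = lin \<alpha> (coefvec \<gamma> k)"
proof -
  let ?\<Gamma> = "\<lambda>j. fps_expansion (\<lambda>s. \<gamma> s $ j) 0"
  have \<Gamma>: "(\<lambda>s. \<gamma> s $ j) has_fps_expansion ?\<Gamma> j" for j
    using assms(1) unfolding analytic_curve_def by (intro analytic_at_imp_has_fps_expansion_0) auto
  define F where "F = (\<Sum>j\<in>UNIV. fps_const (\<alpha> $ j) * (?\<Gamma> j - fps_const (p $ j)))"
  have F: "(\<lambda>s. lin \<alpha> (\<gamma> s - p)) has_fps_expansion F"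
    unfolding lin_def F_def vector_minus_component
    by (intro has_fps_expansion_sum has_fps_expansion_cmult_left has_fps_expansion_diff \<Gamma> has_fps_expansion_const)
  show thesis
  proof (rule that[OF F])
    show "fps_nth F 0 = 0" using has_fps_expansion_imp_0_eq_fps_nth_0[OF F] assms(2) by (simp add: lin_def)
    show "\<forall>k\<ge>1. fps_nth F k = lin \<alpha> (coefvec \<gamma> k)"
      unfolding F_def lin_def coefvec_def by (simp add: fps_sum_nth)
  qed
qed

lemma lin_subdegree:
  assumes "analytic_curve \<gamma>" "\<gamma> 0 = p" "\<epsilon> > 0" "inj_on \<gamma> (ball 0 \<epsilon>)"
    and "lin \<alpha> (coefvec \<gamma> (curve_ord \<gamma>)) \<noteq> 0"
  obtains F where "(\<lambda>s. lin \<alpha> (\<gamma> s - p)) has_fps_expansion F" "F \<noteq> 0" "subdegree F = curve_ord \<gamma>"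
proof -
  obtain F where F: "(\<lambda>s. lin \<alpha> (\<gamma> s - p)) has_fps_expansion F" "fps_nth F 0 = 0"
    "\<forall>k\<ge>1. fps_nth F k = lin \<alpha> (coefvec \<gamma> k)"
    using lin_expansion[OF assms(1,2)] .
  note co = curve_ord[OF assms(1,3,4)]
  have nz: "fps_nth F (curve_ord \<gamma>) \<noteq> 0" using F(3) co(1) assms(5) by simp
  have "fps_nth F k = 0" if "k < curve_ord \<gamma>" for k
    using F(2,3) co(3)[of k] that by (cases "k = 0") (auto simp: lin_def)
  then have "subdegree F = curve_ord \<gamma>" using nz by (intro subdegreeI) auto
  then show thesis using that F(1) nz by (metis fps_zero_nth)
qed

text \<open>An m-th root h of x along the curve has nonzero derivative and becomes the new
  parameter; \<psi> is its local inverse.\<close>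

lemma reparametrize:
  assumes "(\<lambda>s. x (\<gamma> s)) has_fps_expansion F" "F \<noteq> 0" "subdegree F = m" "m \<ge> 1"
  obtains h \<psi> where "h analytic_on {0}" "h 0 = 0" "\<psi> analytic_on {0}" "\<psi> 0 = 0"
    "\<forall>\<^sub>F s in nhds 0. h (\<psi> s) = s" "\<forall>\<^sub>F t in nhds 0. \<psi> (h t) = t"
    "\<forall>\<^sub>F s in nhds 0. x (\<gamma> (\<psi> s)) = s ^ m"
proof -
  obtain h where h: "h analytic_on {0}" "h 0 = 0" "deriv h 0 \<noteq> 0" "\<forall>\<^sub>F t in nhds 0. x (\<gamma> t) = h t ^ m"
    using nth_root_expansion[OF assms] .
  obtain \<psi> where \<psi>: "\<psi> analytic_on {0}" "\<psi> 0 = 0" "\<forall>\<^sub>F s in nhds 0. h (\<psi> s) = s" "\<forall>\<^sub>F t in nhds 0. \<psi> (h t) = t"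
    using analytic_local_inverse[OF h(1-3)] .
  have "\<forall>\<^sub>F s in nhds 0. x (\<gamma> (\<psi> s)) = h (\<psi> s) ^ m"
    by (rule eventually_compose_filterlim[OF h(4) filterlim_analytic_0[OF \<psi>(1,2)]])
  then have "\<forall>\<^sub>F s in nhds 0. x (\<gamma> (\<psi> s)) = s ^ m" using \<psi>(3) by eventually_elim simp
  then show thesis using that h(1,2) \<psi> by blast
qed

lemma analytic_curve_compose:
  assumes "analytic_curve \<gamma>" "\<psi> analytic_on {0}" "\<psi> 0 = 0"
  shows "analytic_curve (\<lambda>s. \<gamma> (\<psi> s))"
  using assms unfolding analytic_curve_def by (auto intro: analytic_compose_0[of _ \<psi>])

text \<open>The given parameter is replaced by s with x = s^m, where \<open>conductor_power\<close>
  applies, and the result is carried back by h. The exponent d survives because substituting \<psi>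
  does not lower orders.\<close>

lemma conductor_curve:
  assumes \<gamma>: "analytic_curve \<gamma>" "\<gamma> 0 = p" and inj: "\<epsilon> > 0" "inj_on \<gamma> (ball 0 \<epsilon>)"
  obtains d where "\<And>g. fps_conv_radius g > 0 \<Longrightarrow> ordge d g \<Longrightarrow>
    \<exists>f. holomorphic_germ p f \<and> (\<lambda>s. f (\<gamma> s)) has_fps_expansion g"
proof -
  note co = curve_ord[OF \<gamma>(1) inj]
  define m where "m = curve_ord \<gamma>"
  obtain \<alpha> where \<alpha>: "lin \<alpha> (coefvec \<gamma> m) \<noteq> 0"
    using generic_linear_form[of "{coefvec \<gamma> m}"] co m_def by auto
  define x where "x = (\<lambda>z. lin \<alpha> (z - p))"
  have x: "holomorphic_germ p x" unfolding x_def by (rule holomorphic_germ_lin)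
  obtain F where F: "(\<lambda>s. x (\<gamma> s)) has_fps_expansion F" "F \<noteq> 0" "subdegree F = m"
    using lin_subdegree[OF \<gamma> inj, of \<alpha>] \<alpha> unfolding m_def x_def by blast
  have m: "m \<ge> 1" using co m_def by simp
  obtain h \<psi> where h: "h analytic_on {0}" "h 0 = 0" and \<psi>: "\<psi> analytic_on {0}" "\<psi> 0 = 0"
    and h\<psi>: "\<forall>\<^sub>F s in nhds 0. h (\<psi> s) = s" and \<psi>h: "\<forall>\<^sub>F t in nhds 0. \<psi> (h t) = t"
    and xs: "\<forall>\<^sub>F s in nhds 0. x (\<gamma> (\<psi> s)) = s ^ m"
    using reparametrize[where x = x and \<gamma> = \<gamma>, OF F m] .
  note lim\<psi> = filterlim_analytic_0[OF \<psi>] and limh = filterlim_analytic_0[OF h]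
  have "\<forall>\<^sub>F s in nhds (0::complex). s \<in> ball 0 \<epsilon>" by (rule eventually_nhds_in_open) (use inj in auto)
  from eventually_compose_filterlim[OF this lim\<psi>] h\<psi>
  have "\<forall>\<^sub>F s in nhds 0. \<psi> s \<in> ball 0 \<epsilon> \<and> h (\<psi> s) = s" by eventually_elim simp
  then obtain \<delta> where \<delta>: "\<delta> > 0" "\<And>s. dist s 0 < \<delta> \<Longrightarrow> \<psi> s \<in> ball 0 \<epsilon> \<and> h (\<psi> s) = s"
    unfolding eventually_nhds_metric by blast
  have inj': "inj_on (\<lambda>s. \<gamma> (\<psi> s)) (ball 0 \<delta>)"
  proof (rule inj_onI)
    fix a b assume *: "a \<in> ball 0 \<delta>" "b \<in> ball 0 \<delta>" "\<gamma> (\<psi> a) = \<gamma> (\<psi> b)"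
    have a: "\<psi> a \<in> ball 0 \<epsilon> \<and> h (\<psi> a) = a" by (rule \<delta>(2)) (use * in \<open>simp add: dist_commute\<close>)
    have b: "\<psi> b \<in> ball 0 \<epsilon> \<and> h (\<psi> b) = b" by (rule \<delta>(2)) (use * in \<open>simp add: dist_commute\<close>)
    have "\<psi> a = \<psi> b" by (rule inj_onD[OF inj(2) *(3)]) (use a b in auto)
    then have "h (\<psi> a) = h (\<psi> b)" by (rule arg_cong)
    then show "a = b" using a b by simp
  qed
  obtain d where d: "\<And>g. fps_conv_radius g > 0 \<Longrightarrow> ordge d g \<Longrightarrow>
      \<exists>f. holomorphic_germ p f \<and> (\<lambda>s. f (\<gamma> (\<psi> s))) has_fps_expansion g"
    using conductor_power[OF x analytic_curve_compose[OF \<gamma>(1) \<psi>] _ m xs \<delta>(1) inj'] \<gamma>(2) \<psi>(2) by auto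
  show thesis
  proof (rule that[of d])
    fix g :: "complex fps" assume g: "fps_conv_radius g > 0" "ordge d g"
    have Ge: "eval_fps g has_fps_expansion g" by (rule eval_fps_has_fps_expansion[OF g(1)])
    define G' where "G' = fps_expansion (\<lambda>s. eval_fps g (\<psi> s)) 0"
    have G': "(\<lambda>s. eval_fps g (\<psi> s)) has_fps_expansion G'"
      unfolding G'_def
      by (intro analytic_at_imp_has_fps_expansion_0 analytic_compose_0[OF has_fps_expansion_imp_analytic_0[OF Ge] \<psi>])
    obtain K where K: "K \<ge> 0" "\<forall>\<^sub>F t in nhds 0. norm (eval_fps g t) \<le> K * norm t ^ d"
      using ordge_imp_bound[OF Ge g(2)] .
    \<comment> \<open>The order of g \<circ> \<psi> is read from growth: |g(t)| \<le> K |t|^d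
      together with |\<psi>(s)| \<le> L |s|.\<close>
    have \<psi>e: "\<psi> has_fps_expansion fps_expansion \<psi> 0" by (rule analytic_at_imp_has_fps_expansion_0[OF \<psi>(1)])
    have "ordge 1 (fps_expansion \<psi> 0)"
      using has_fps_expansion_imp_0_eq_fps_nth_0[OF \<psi>e] \<psi>(2) by (simp add: ordge_def)
    from ordge_imp_bound[OF \<psi>e this] obtain L where L: "L \<ge> 0" "\<forall>\<^sub>F t in nhds 0. norm (\<psi> t) \<le> L * norm t ^ 1"
      by blast
    have "\<forall>\<^sub>F s in nhds 0. norm (eval_fps g (\<psi> s)) \<le> (K * L ^ d) * norm s ^ d"
      using eventually_compose_filterlim[OF K(2) lim\<psi>] L(2)
    proof eventually_elim
      case (elim s)
      have "norm (\<psi> s) ^ d \<le> (L * norm s) ^ d" using elim by (intro power_mono) auto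
      then have "K * norm (\<psi> s) ^ d \<le> K * (L * norm s) ^ d" by (rule mult_left_mono[OF _ K(1)])
      then show ?case using elim by (simp add: power_mult_distrib mult.assoc)
    qed
    then have o: "ordge d G'" by (rule bound_imp_ordge[OF G'])
    obtain f where f: "holomorphic_germ p f" "(\<lambda>s. f (\<gamma> (\<psi> s))) has_fps_expansion G'"
      using d[OF _ o] G' by (auto simp: has_fps_expansion_def)
    have "(\<lambda>s. f (\<gamma> (\<psi> s)) - eval_fps g (\<psi> s)) has_fps_expansion 0"
      using has_fps_expansion_diff[OF f(2) G'] by simp
    then have "\<forall>\<^sub>F s in nhds 0. f (\<gamma> (\<psi> s)) = eval_fps g (\<psi> s)" by (simp add: has_fps_expansion_0_iff)
    from eventually_compose_filterlim[OF this limh] \<psi>h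
    have ev: "\<forall>\<^sub>F t in nhds 0. f (\<gamma> t) = eval_fps g t" by eventually_elim simp
    have "(\<lambda>t. f (\<gamma> t)) has_fps_expansion g" by (rule iffD2[OF has_fps_expansion_cong[OF ev refl] Ge])
    then show "\<exists>f. holomorphic_germ p f \<and> (\<lambda>s. f (\<gamma> s)) has_fps_expansion g" using f by blast
  qed
qed

section \<open>The normalization ring and its filtration by orders\<close>

definition convergent_series :: "('r \<Rightarrow> complex fps) set" where
  "convergent_series = {g. \<forall>i. fps_conv_radius (g i) > 0}"

definition series_filtration :: "nat^'r \<Rightarrow> ('r::finite \<Rightarrow> complex fps) set" where
  "series_filtration l = {g \<in> convergent_series. \<forall>i. ordge (l $ i) (g i)}"

lemma subspace_convergent_series: "ser.subspace convergent_series"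
  by (rule ser.subspaceI) (auto simp: convergent_series_def sscale_def zero_fun_def plus_fun_def intro!: conv_add conv_mult)

lemma subspace_series_filtration: "ser.subspace (series_filtration l)"
  by (rule ser.subspaceI)
    (auto simp: series_filtration_def ordge_def sscale_def zero_fun_def plus_fun_def
      intro!: ser.subspace_add[OF subspace_convergent_series, unfolded plus_fun_def]
        ser.subspace_0[OF subspace_convergent_series, unfolded zero_fun_def]
        ser.subspace_scale[OF subspace_convergent_series, unfolded sscale_def])

text \<open>Lowering one positive entry of l by 1 releases a single Taylor coefficient, whose
  vanishing is a hyperplane condition; a monomial shows that the condition is proper.\<close>

lemma codim_series_filtration: "ser.codim (series_filtration l) convergent_series (\<Sum>i\<in>UNIV. l $ i)"
proof (induction "\<Sum>i\<in>UNIV. l $ i" arbitrary: l)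
  case 0
  then have "series_filtration l = convergent_series" by (auto simp: series_filtration_def)
  then show ?case using ser.codim_0[of "convergent_series"] 0 by simp
next
  case (Suc n)
  then obtain i where i: "l $ i > 0" by (metis Zero_not_Suc gr0I sum.neutral)
  define l' :: "nat^'a" where "l' = (\<chi> j. if j = i then l $ j - 1 else l $ j)"
  have "(\<Sum>j\<in>UNIV. l $ j) = l $ i + (\<Sum>j\<in>UNIV - {i}. l $ j)" by (simp add: sum.remove)
  moreover have "(\<Sum>j\<in>UNIV. l' $ j) = l' $ i + (\<Sum>j\<in>UNIV - {i}. l' $ j)" by (simp add: sum.remove)
  moreover have "(\<Sum>j\<in>UNIV - {i}. l' $ j) = (\<Sum>j\<in>UNIV - {i}. l $ j)"
    by (rule sum.cong) (auto simp: l'_def)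
  moreover have "l' $ i = l $ i - 1" by (simp add: l'_def)
  ultimately have n: "n = (\<Sum>j\<in>UNIV. l' $ j)" using Suc(2) i by linarith
  have ord: "ordge (l $ i) F \<longleftrightarrow> ordge (l $ i - 1) F \<and> fps_nth F (l $ i - 1) = 0" for F
    using i unfolding ordge_def by (metis Suc_pred' less_Suc_eq)
  have eq: "series_filtration l = {g \<in> series_filtration l'. fps_nth (g i) (l $ i - 1) = 0}"
    unfolding series_filtration_def l'_def using ord by (auto split: if_splits)
  define v :: "'a \<Rightarrow> complex fps" where "v = (\<lambda>j. if j = i then fps_X ^ (l $ i - 1) else 0)"
  have "ser.codim {g \<in> series_filtration l'. fps_nth (g i) (l $ i - 1) = 0} (series_filtration l') 1"
  proof (rule ser.codim_kernel[where v = v])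
    show "v \<in> series_filtration l'" by (auto simp: series_filtration_def convergent_series_def v_def ordge_def l'_def fps_X_power_nth)
    show "fps_nth (v i) (l $ i - 1) \<noteq> 0" by (simp add: v_def)
  qed (auto simp: subspace_series_filtration sscale_def)
  then have "ser.codim (series_filtration l) (series_filtration l') 1" unfolding eq .
  from ser.codim_trans[OF Suc(1)[OF n] this] n Suc(2) show ?case by simp
qed

lemma lin_axis [simp]: "lin (axis j 1) v = v $ j"
  unfolding lin_def axis_def by (simp add: if_distrib if_distribR cong: if_cong)

section \<open>Multiplicities of the branches and the conductor of the whole curve\<close>

context curve
begin

definition branch_mult :: "'r \<Rightarrow> nat" where "branch_mult i = curve_ord (\<nu> i)"

definition M :: nat where "M = (\<Sum>i\<in>UNIV. branch_mult i)"

lemma branch_mult_ge_1: "branch_mult i \<ge> 1"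
proof -
  obtain \<epsilon> where "\<epsilon> > 0" "inj_on (\<nu> i) (ball 0 \<epsilon>)" by (rule nu_inj)
  then show ?thesis unfolding branch_mult_def using curve_ord(1)[OF nu_analytic] by blast
qed

text \<open>One linear form attains the least order on all branches at once: it only has to be
  nonzero on the leading vectors of the finitely many branches.\<close>

lemma generic_coordinate:
  obtains x where "holomorphic_germ p x" "x p = 0" "\<forall>i. T x i \<noteq> 0 \<and> subdegree (T x i) = branch_mult i"
proof -
  have c: "coefvec (\<nu> i) (branch_mult i) \<noteq> 0" for i
  proof -
    obtain \<epsilon> where "\<epsilon> > 0" "inj_on (\<nu> i) (ball 0 \<epsilon>)" by (rule nu_inj)
    then show ?thesis unfolding branch_mult_def using curve_ord(2)[OF nu_analytic] by blast
  qed
  have fin: "finite (range (\<lambda>i. coefvec (\<nu> i) (branch_mult i)))" by simp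
  have n0: "0 \<notin> range (\<lambda>i. coefvec (\<nu> i) (branch_mult i))" 
  proof
    assume "0 \<in> range (\<lambda>i. coefvec (\<nu> i) (branch_mult i))"
    then obtain i where "0 = coefvec (\<nu> i) (branch_mult i)" by (rule rangeE)
    then show False using c[of i] by simp
  qed
  obtain \<alpha> where "\<forall>v\<in>range (\<lambda>i. coefvec (\<nu> i) (branch_mult i)). lin \<alpha> v \<noteq> 0"
    by (rule generic_linear_form[OF fin n0])
  then have \<alpha>: "lin \<alpha> (coefvec (\<nu> i) (branch_mult i)) \<noteq> 0" for i by blast
  show thesis
  proof (rule that[of "\<lambda>z. lin \<alpha> (z - p)"], rule holomorphic_germ_lin, simp add: lin_def, rule allI)
    fix i
    obtain \<epsilon> where \<epsilon>: "\<epsilon> > 0" "inj_on (\<nu> i) (ball 0 \<epsilon>)" by (rule nu_inj)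
    obtain F where F: "(\<lambda>s. lin \<alpha> (\<nu> i s - p)) has_fps_expansion F" "F \<noteq> 0" "subdegree F = branch_mult i"
      using lin_subdegree[OF nu_analytic nu_0 \<epsilon>, of \<alpha>] \<alpha>[of i] unfolding branch_mult_def by blast
    have "T (\<lambda>z. lin \<alpha> (z - p)) i = F" by (rule T_eqI[OF F(1)])
    then show "T (\<lambda>z. lin \<alpha> (z - p)) i \<noteq> 0 \<and> subdegree (T (\<lambda>z. lin \<alpha> (z - p)) i) = branch_mult i" using F by simp
  qed
qed

text \<open>|f(z)| is bounded by a multiple of |z - p|, and |\<nu>(t) - p| by a multiple of |t|^m on
  a branch of multiplicity m; growth then gives the order.\<close>

lemma ordge_branch_mult:
  assumes f: "holomorphic_germ p f" "f p = 0"
  shows "ordge (branch_mult i) (T f i)"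
proof -
  obtain \<epsilon> where \<epsilon>: "\<epsilon> > 0" "inj_on (\<nu> i) (ball 0 \<epsilon>)" by (rule nu_inj)
  have "\<forall>j. \<exists>K. K \<ge> 0 \<and> (\<forall>\<^sub>F t in nhds 0. norm ((\<nu> i t - p) $ j) \<le> K * norm t ^ branch_mult i)"
  proof
    fix j
    obtain F where F: "(\<lambda>s. lin (axis j 1) (\<nu> i s - p)) has_fps_expansion F" "fps_nth F 0 = 0"
      "\<forall>k\<ge>1. fps_nth F k = lin (axis j 1) (coefvec (\<nu> i) k)"
      by (rule lin_expansion[OF nu_analytic[of i] nu_0, where \<alpha> = "axis j 1"])
    have "ordge (branch_mult i) F"
      unfolding ordge_def
    proof (intro allI impI)
      fix k assume "k < branch_mult i"
      then show "fps_nth F k = 0"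
        using F(2,3) curve_ord(3)[OF nu_analytic \<epsilon>, of k] by (cases "k = 0") (auto simp: branch_mult_def lin_def)
    qed
    then obtain K where K: "K \<ge> 0" "\<forall>\<^sub>F s in nhds 0. norm (lin (axis j 1) (\<nu> i s - p)) \<le> K * norm s ^ branch_mult i"
      by (rule ordge_imp_bound[OF F(1)])
    then show "\<exists>K. K \<ge> 0 \<and> (\<forall>\<^sub>F t in nhds 0. norm ((\<nu> i t - p) $ j) \<le> K * norm t ^ branch_mult i)"
      unfolding lin_axis by (intro exI[of _ K]) auto
  qed
  from choice[OF this] obtain K
    where K': "\<forall>j. K j \<ge> 0 \<and> (\<forall>\<^sub>F t in nhds 0. norm ((\<nu> i t - p) $ j) \<le> K j * norm t ^ branch_mult i)" ..
  have K: "\<forall>\<^sub>F t in nhds 0. norm ((\<nu> i t - p) $ j) \<le> K j * norm t ^ branch_mult i" for j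
    using K' by blast
  have "\<forall>\<^sub>F t in nhds 0. \<forall>j. norm ((\<nu> i t - p) $ j) \<le> K j * norm t ^ branch_mult i"
    by (intro eventually_all_finite K)
  then have b: "\<forall>\<^sub>F t in nhds 0. norm (\<nu> i t - p) \<le> (\<Sum>j\<in>UNIV. K j) * norm t ^ branch_mult i"
  proof eventually_elim
    case (elim t)
    have "norm (\<nu> i t - p) \<le> (\<Sum>j\<in>UNIV. norm ((\<nu> i t - p) $ j))"
      unfolding norm_vec_def by (rule L2_set_le_sum) simp
    also have "\<dots> \<le> (\<Sum>j\<in>UNIV. K j * norm t ^ branch_mult i)" by (rule sum_mono) (use elim in blast)
    finally show ?case by (simp add: sum_distrib_right)
  qed
  obtain L where L: "L \<ge> 0" "\<forall>\<^sub>F z in nhds p. norm (f z) \<le> L * norm (z - p)"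
    by (rule holomorphic_germ_bound[OF f])
  have "\<forall>\<^sub>F t in nhds 0. norm (f (\<nu> i t)) \<le> L * norm (\<nu> i t - p)"
    using eventually_curve[OF nu_analytic, where P = "\<lambda>z. norm (f z) \<le> L * norm (z - p)"] L(2) by simp
  with b have "\<forall>\<^sub>F t in nhds 0. norm (f (\<nu> i t)) \<le> (L * (\<Sum>j\<in>UNIV. K j)) * norm t ^ branch_mult i"
  proof eventually_elim
    case (elim t)
    have "L * norm (\<nu> i t - p) \<le> L * ((\<Sum>j\<in>UNIV. K j) * norm t ^ branch_mult i)" using elim L by (intro mult_left_mono) auto
    then show ?case using elim by (simp add: mult.assoc)
  qed
  then show ?thesis by (rule bound_imp_ordge[OF T_expansion[OF f(1)]])
qed

text \<open>In the normalization f is a multiple of the i-th idempotent. It is a product of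
  equations, one for each other branch, and stays nonzero on branch i because power series form a
  domain.\<close>

lemma branch_idempotent:
  obtains f where "holomorphic_germ p f" "T f i \<noteq> 0" "\<And>j. j \<noteq> i \<Longrightarrow> T f j = 0"
proof -
  have "\<exists>f. holomorphic_germ p f \<and> T f j = 0 \<and> T f i \<noteq> 0" if "j \<noteq> i" for j
    using separate_branches[of i j] that by metis
  then obtain F where F: "\<And>j. j \<noteq> i \<Longrightarrow> holomorphic_germ p (F j) \<and> T (F j) j = 0 \<and> T (F j) i \<noteq> 0" by metis
  define f where "f = (\<lambda>z. \<Prod>j\<in>UNIV - {i}. F j z)"
  have f: "holomorphic_germ p f" unfolding f_def using F by (intro holomorphic_germ_prod) auto
  have T: "T f k = (\<Prod>j\<in>UNIV - {i}. T (F j) k)" for k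
    by (rule T_eqI) (unfold f_def, intro has_fps_expansion_prod T_expansion, use F in auto)
  show thesis
  proof (rule that[OF f])
    show "T f i \<noteq> 0" unfolding T using F by simp
    fix j assume "j \<noteq> i"
    then show "T f j = 0" unfolding T using F by (intro prod_zero) auto
  qed
qed

text \<open>A germ prescribed on branch i is cut off on the other branches by the factor F i.
  Dividing by this factor costs its order on branch i, which is therefore added to the exponent d i
  of the single branch.\<close>

lemma conductor:
  obtains c where "series_filtration c \<subseteq> T ` germs p"
proof -
  have "\<exists>d. \<forall>g. fps_conv_radius g > 0 \<longrightarrow> ordge d g \<longrightarrow> (\<exists>f. holomorphic_germ p f \<and> T f i = g)" for i
  proof -
    obtain \<epsilon> where \<epsilon>: "\<epsilon> > 0" "inj_on (\<nu> i) (ball 0 \<epsilon>)" by (rule nu_inj)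
    obtain d where "\<And>g. fps_conv_radius g > 0 \<Longrightarrow> ordge d g \<Longrightarrow>
        \<exists>f. holomorphic_germ p f \<and> (\<lambda>s. f (\<nu> i s)) has_fps_expansion g"
      using conductor_curve[OF nu_analytic nu_0 \<epsilon>] by metis
    then show ?thesis using T_eqI by metis
  qed
  then obtain d where d: "\<And>i g. fps_conv_radius g > 0 \<Longrightarrow> ordge (d i) g \<Longrightarrow> \<exists>f. holomorphic_germ p f \<and> T f i = g"
    by metis
  have "\<forall>i. \<exists>f. holomorphic_germ p f \<and> T f i \<noteq> 0 \<and> (\<forall>j. j \<noteq> i \<longrightarrow> T f j = 0)"
    using branch_idempotent by metis
  then obtain F where F: "\<And>i. holomorphic_germ p (F i)" "\<And>i. T (F i) i \<noteq> 0" "\<And>i j. j \<noteq> i \<Longrightarrow> T (F i) j = 0"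
    by metis
  define c :: "nat^'r" where "c = (\<chi> i. subdegree (T (F i) i) + d i)"
  show thesis
  proof (rule that[of c], rule subsetI)
    fix g assume g: "g \<in> series_filtration c"
    have "\<exists>k. holomorphic_germ p k \<and> g i = T (F i) i * T k i" for i
    proof -
      have g1: "fps_conv_radius (g i) > 0" "ordge (subdegree (T (F i) i) + d i) (g i)"
        using g unfolding series_filtration_def convergent_series_def c_def by auto
      have r: "fps_conv_radius (T (F i) i) > 0" using T_expansion[OF F(1)] by (simp add: has_fps_expansion_def)
      obtain q where q: "fps_conv_radius q > 0" "g i = T (F i) i * q"
          "\<And>n. ordge (subdegree (T (F i) i) + n) (g i) \<Longrightarrow> ordge n q"
        using conv_quotient[OF g1(1) r F(2) ordge_mono[OF g1(2)]] by (metis le_add1)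
      then show ?thesis using d[OF q(1) q(3)[OF g1(2)]] by metis
    qed
    then obtain k where k: "\<And>i. holomorphic_germ p (k i)" "\<And>i. g i = T (F i) i * T (k i) i" by metis
    define f where "f = (\<lambda>z. \<Sum>i\<in>UNIV. F i z * k i z)"
    have f: "holomorphic_germ p f" unfolding f_def by (intro holomorphic_germ_sum holomorphic_germ_mult F k)
    have "T f j = g j" for j
    proof -
      have "T f j = (\<Sum>i\<in>UNIV. T (F i) j * T (k i) j)"
        by (rule T_eqI) (unfold f_def, intro has_fps_expansion_sum has_fps_expansion_mult T_expansion F k)
      also have "\<dots> = (\<Sum>i\<in>{j}. T (F i) j * T (k i) j)"
        by (rule sum.mono_neutral_right) (use F(3) in auto)
      finally show ?thesis using k by simp
    qed
    then have "T f = g" by (rule ext)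
    then show "g \<in> T ` germs p" using f by blast
  qed
qed

end

subsection \<open>Hilbert function and multiplicity\<close>

lemma carrier_cls: "f \<in> germs p \<Longrightarrow> germ_class p C f \<in> carrier (local_ring p C)"
  using carrier_local by blast

lemma carrier_clsE:
  assumes "g \<in> carrier (local_ring p C)"
  obtains f where "holomorphic_germ p f" "g = germ_class p C f"
  using assms unfolding carrier_local by auto

lemma inv_cls:
  assumes "holomorphic_germ p f"
  shows "\<ominus>\<^bsub>local_ring p C\<^esub> germ_class p C f = germ_class p C (- f)"
proof -
  interpret cring "local_ring p C" by (rule cring_local)
  have m: "holomorphic_germ p (- f)" using holomorphic_germ_minus[OF assms] by (simp add: fun_Compl_def)
  have "germ_class p C (- f) \<oplus>\<^bsub>local_ring p C\<^esub> germ_class p C f = \<zero>\<^bsub>local_ring p C\<^esub>"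
    using cls_add[OF m assms] cls_zero by simp
  then show ?thesis using carrier_cls m assms by (intro minus_equality) auto
qed

lemma ideal_cls_image:
  assumes S: "S \<subseteq> germs p" and z: "0 \<in> S" and add: "\<And>f g. f \<in> S \<Longrightarrow> g \<in> S \<Longrightarrow> f + g \<in> S"
    and mult: "\<And>f g. f \<in> S \<Longrightarrow> holomorphic_germ p g \<Longrightarrow> (\<lambda>x. g x * f x) \<in> S"
  shows "ideal (germ_class p C ` S) (local_ring p C)"
proof -
  interpret cring "local_ring p C" by (rule cring_local)
  show ?thesis
  proof (rule idealI)
    show "subgroup (germ_class p C ` S) (add_monoid (local_ring p C))"
    proof (rule add.subgroupI)
      show "germ_class p C ` S \<subseteq> carrier (local_ring p C)" using S carrier_local by blast
      show "germ_class p C ` S \<noteq> {}" using z by blast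
      fix a assume "a \<in> germ_class p C ` S"
      then obtain f where f: "f \<in> S" "a = germ_class p C f" by blast
      have "(\<lambda>x. - 1 * f x) \<in> S" using mult[OF f(1) holomorphic_germ_const] .
      moreover have "(\<lambda>x. - 1 * f x) = - f" by auto
      ultimately show "\<ominus>\<^bsub>local_ring p C\<^esub> a \<in> germ_class p C ` S" using inv_cls[of p f C] f S by auto
      fix b assume "b \<in> germ_class p C ` S"
      then obtain g where g: "g \<in> S" "b = germ_class p C g" by blast
      have fg: "holomorphic_germ p f" "holomorphic_germ p g" using f g S by auto
      show "a \<oplus>\<^bsub>local_ring p C\<^esub> b \<in> germ_class p C ` S"
        unfolding f(2) g(2) cls_add[OF fg] using add[OF f(1) g(1)] by blast
    qed
    fix a x assume "a \<in> germ_class p C ` S" "x \<in> carrier (local_ring p C)"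
    then obtain f g where fg: "f \<in> S" "a = germ_class p C f" "holomorphic_germ p g" "x = germ_class p C g"
      by (auto elim: carrier_clsE)
    have f: "holomorphic_germ p f" using fg S by auto
    have "(\<lambda>x. g x * f x) \<in> S" using mult fg by blast
    then show xa: "x \<otimes>\<^bsub>local_ring p C\<^esub> a \<in> germ_class p C ` S"
      unfolding fg(2,4) cls_mult[OF fg(3) f] by (rule imageI)
    have "x \<in> carrier (local_ring p C)" "a \<in> carrier (local_ring p C)"
      using carrier_cls f fg by auto
    then show "a \<otimes>\<^bsub>local_ring p C\<^esub> x \<in> germ_class p C ` S" using xa m_comm by metis
  qed (rule ring_axioms)
qed

context curve
begin

lemma T_convergent: "holomorphic_germ p f \<Longrightarrow> T f \<in> convergent_series"
  using T_expansion unfolding convergent_series_def has_fps_expansion_def by blast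

lemma cls_eq_iff_T:
  assumes "holomorphic_germ p f" "holomorphic_germ p g"
  shows "germ_class p C f = germ_class p C g \<longleftrightarrow> T f = T g"
proof
  assume "germ_class p C f = germ_class p C g"
  then have "\<forall>i. \<forall>\<^sub>F t in nhds 0. f (\<nu> i t) = g (\<nu> i t)"
    using vanish_iff[of "\<lambda>z. f z = g z"] by (simp add: cls_eq_iff assms)
  then show "T f = T g" using T_cong[OF _ assms(2)] by blast
next
  assume e: "T f = T g"
  have "\<forall>\<^sub>F t in nhds 0. f (\<nu> i t) = g (\<nu> i t)" for i
  proof -
    have "(\<lambda>t. f (\<nu> i t) - g (\<nu> i t)) has_fps_expansion T f i - T g i"
      by (intro has_fps_expansion_diff T_expansion assms)
    then show ?thesis using e by (simp add: has_fps_expansion_0_iff)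
  qed
  then show "germ_class p C f = germ_class p C g"
    using vanish_iff[of "\<lambda>z. f z = g z"] by (simp add: cls_eq_iff assms)
qed

abbreviation A :: "('r \<Rightarrow> complex fps) set" where "A \<equiv> T ` germs p"

lemma img_sum_zero: "fs.img_sum T U {0} = T ` U"
  unfolding fs.img_sum_def by auto

lemma subspace_T_image: "fn.subspace U \<Longrightarrow> U \<subseteq> germs p \<Longrightarrow> ser.subspace (T ` U)"
  using fs.subspace_img_sum[OF _ ser.subspace_single_0 fs.linear_on_mono[OF T_linear]] img_sum_zero by metis

lemma subspace_A: "ser.subspace A"
  by (rule subspace_T_image[OF subspace_germs]) simp

lemma A_subset_convergent: "A \<subseteq> convergent_series" using T_convergent by blast

lemma A_subset_img_sum:
  assumes "ser.subspace W" shows "A \<subseteq> fs.img_sum T (germs p) W"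
proof
  fix g assume "g \<in> A"
  then obtain f where f: "f \<in> germs p" "g = T f" by blast
  have "T f + 0 \<in> fs.img_sum T (germs p) W"
    unfolding fs.img_sum_def using f(1) ser.subspace_0[OF assms] by blast
  then show "g \<in> fs.img_sum T (germs p) W" using f(2) by simp
qed

text \<open>\<delta> is the dimension of the normalization modulo O; it is finite because O contains
  a filtration step of finite codimension.\<close>

lemma finite_delta: obtains \<delta> where "ser.codim A convergent_series \<delta>"
proof -
  obtain c where c: "series_filtration c \<subseteq> A" by (rule conductor)
  show thesis
    using ser.codim_between[OF codim_series_filtration[of c] subspace_series_filtration subspace_A c A_subset_convergent] that by blast
qed

definition germ_filtration :: "nat^'r \<Rightarrow> (complex^'n \<Rightarrow> complex) set" where
  "germ_filtration l = {f \<in> germs p. \<forall>i. ordge (l $ i) (T f i)}"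

lemma germ_filtration_eq: "germ_filtration l = {f \<in> germs p. T f \<in> series_filtration l}"
  unfolding germ_filtration_def series_filtration_def using T_convergent by blast

lemma subspace_germ_filtration: "fn.subspace (germ_filtration l)"
  unfolding germ_filtration_eq by (rule fs.subspace_preimage[OF subspace_germs subspace_series_filtration T_linear])

lemma val_filtration_eq: "val_filtration p C \<nu> l = germ_class p C ` germ_filtration l"
  unfolding val_filtration_def germ_filtration_def by (auto elim!: carrier_clsE simp: branch_val_cls carrier_cls)

lemma val_filtration_ideal: "ideal (val_filtration p C \<nu> l) (local_ring p C)"
  unfolding val_filtration_eq
proof (rule ideal_cls_image)
  show "0 \<in> germ_filtration l" by (rule fn.subspace_0[OF subspace_germ_filtration])
  show "f + g \<in> germ_filtration l" if "f \<in> germ_filtration l" "g \<in> germ_filtration l" for f g using that by (rule fn.subspace_add[OF subspace_germ_filtration])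
  show "(\<lambda>x. g x * f x) \<in> germ_filtration l" if "f \<in> germ_filtration l" "holomorphic_germ p g" for f g
    using that ordge_mult[OF ordge_0] by (fastforce simp: germ_filtration_def T_mult intro: holomorphic_germ_mult)
qed (auto simp: germ_filtration_def)

lemma val_filtration_vimage: "{f \<in> germs p. germ_class p C f \<in> val_filtration p C \<nu> l} = germ_filtration l"
  unfolding val_filtration_def germ_filtration_def by (auto simp: branch_val_cls carrier_cls)

lemma hilbert_codim:
  assumes "fn.codim (germ_filtration l) (germs p) n" shows "hilbert_fun p C \<nu> l = n"
  unfolding hilbert_fun_def
  by (rule codim_ideal_eq[OF val_filtration_ideal]) (simp only: val_filtration_vimage assms)

text \<open>O/F(l) is isomorphic to the sum of A and the filtration step, modulo that step. Hence
  h(l) = |l| - b, with b the codimension of the sum in the normalization, and b \<le> \<delta>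
  because the sum contains A.\<close>

lemma hilbert_exists:
  obtains b where "fn.codim (germ_filtration l) (germs p) (hilbert_fun p C \<nu> l)"
    "hilbert_fun p C \<nu> l + b = (\<Sum>i\<in>UNIV. l $ i)" "\<forall>\<delta>. ser.codim A convergent_series \<delta> \<longrightarrow> b \<le> \<delta>"
proof -
  let ?S = "fs.img_sum T (germs p) (series_filtration l)"
  have sS: "ser.subspace ?S" by (rule fs.subspace_img_sum[OF subspace_germs subspace_series_filtration T_linear])
  have 1: "series_filtration l \<subseteq> ?S" using fn.subspace_0[OF subspace_germs, of p] T_const[of 0]
    unfolding fs.img_sum_def by (force simp: zero_fun_def)
  have 2: "?S \<subseteq> convergent_series"
    using T_convergent ser.subspace_add[OF subspace_convergent_series] unfolding fs.img_sum_def series_filtration_def by blast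
  have 3: "A \<subseteq> ?S" by (rule A_subset_img_sum[OF subspace_series_filtration])
  obtain a b where ab: "ser.codim (series_filtration l) ?S a" "ser.codim ?S convergent_series b" "a + b = (\<Sum>i\<in>UNIV. l $ i)"
    using ser.codim_between[OF codim_series_filtration subspace_series_filtration sS 1 2] by blast
  have "fn.codim {u \<in> germs p. T u \<in> series_filtration l} (germs p) a"
    by (rule fs.codim_preimage[OF ab(1) subspace_germs subspace_series_filtration T_linear refl])
  then have c: "fn.codim (germ_filtration l) (germs p) a" unfolding germ_filtration_eq .
  have h: "hilbert_fun p C \<nu> l = a" by (rule hilbert_codim[OF c])
  have "b \<le> \<delta>" if \<delta>: "ser.codim A convergent_series \<delta>" for \<delta>
  proof -
    obtain x y where "ser.codim A ?S x" "ser.codim ?S convergent_series y" "x + y = \<delta>"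
      using ser.codim_between[OF \<delta> subspace_A sS 3 2] by blast
    then show ?thesis using ser.codim_unique[OF ab(2) _ sS] by fastforce
  qed
  then show thesis using that[of b] c ab(3) unfolding h by blast
qed

lemma hilbert_le: "hilbert_fun p C \<nu> l \<le> (\<Sum>i\<in>UNIV. l $ i)"
  by (rule hilbert_exists[of l]) linarith

lemma hilbert_ge: obtains \<delta> where "\<forall>l. (\<Sum>i\<in>UNIV. l $ i) \<le> hilbert_fun p C \<nu> l + \<delta>"
proof -
  obtain \<delta> where \<delta>: "ser.codim A convergent_series \<delta>" by (rule finite_delta)
  have "(\<Sum>i\<in>UNIV. l $ i) \<le> hilbert_fun p C \<nu> l + \<delta>" for l
  proof -
    obtain b where "hilbert_fun p C \<nu> l + b = (\<Sum>i\<in>UNIV. l $ i)" "b \<le> \<delta>"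
      using hilbert_exists[of l] \<delta> by metis
    then show ?thesis by linarith
  qed
  then show thesis using that by blast
qed

lemma hilbert_zero: "hilbert_fun p C \<nu> 0 = 0"
  using hilbert_le[of 0] by simp

text \<open>In this range F(l) is the whole maximal ideal: vanishing at p already forces the order
  \<open>branch_mult i\<close> on each branch.\<close>

lemma hilbert_one:
  assumes "\<And>i. l $ i \<le> branch_mult i" "l \<noteq> 0" shows "hilbert_fun p C \<nu> l = 1"
proof (rule hilbert_codim)
  obtain k where k: "l $ k > 0" using assms(2) by (metis gr0I vec_eq_iff zero_index)
  have "germ_filtration l = {f \<in> germs p. f p = 0}"
  proof (intro subset_antisym subsetI)
    fix f assume "f \<in> germ_filtration l"
    then have f: "holomorphic_germ p f" "ordge (l $ k) (T f k)" by (auto simp: germ_filtration_def)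
    then have "fps_nth (T f k) 0 = 0" using k by (simp add: ordge_def)
    then show "f \<in> {f \<in> germs p. f p = 0}" using f T_nth_0[OF f(1), of k] by simp
  next
    fix f assume "f \<in> {f \<in> germs p. f p = 0}"
    then show "f \<in> germ_filtration l" using ordge_branch_mult ordge_mono assms(1) by (fastforce simp: germ_filtration_def)
  qed
  moreover have "fn.codim {f \<in> germs p. f p = 0} (germs p) 1"
    by (rule fn.codim_kernel[OF subspace_germs, where v = "\<lambda>x. 1"]) (auto simp: fscale_def)
  ultimately show "fn.codim (germ_filtration l) (germs p) 1" by simp
qed

text \<open>With m = \<open>branch_mult i\<close>, the powers of a generic x have orders 0, m, 2m,
  ... on branch i. Those of order below l i are separated by a strictly descending chain above
  F(l).\<close>

lemma hilbert_mult_ge: "l $ i \<le> hilbert_fun p C \<nu> l * branch_mult i"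
proof -
  obtain x where x: "holomorphic_germ p x" "x p = 0" and Tm: "\<forall>i. T x i \<noteq> 0 \<and> subdegree (T x i) = branch_mult i"
    by (rule generic_coordinate)
  \<comment> \<open>K is l i / m rounded up; as a minimum it gives K m \<ge> l i and k m < l i for
    all k < K.\<close>
  define K where "K = (LEAST k. l $ i \<le> k * branch_mult i)"
  have ex: "l $ i \<le> l $ i * branch_mult i" using branch_mult_ge_1[of i] by (cases "branch_mult i") auto
  have K: "l $ i \<le> K * branch_mult i" unfolding K_def by (rule LeastI[where P = "\<lambda>k. l $ i \<le> k * branch_mult i", OF ex])
  have Kless: "k * branch_mult i < l $ i" if "k < K" for k
    using not_less_Least[of k "\<lambda>k. l $ i \<le> k * branch_mult i"] that unfolding K_def by simp
  \<comment> \<open>Truncation at l i keeps F(l) inside the last term of the chain, where K m may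
    exceed l i.\<close>
  define E where "E = (\<lambda>k. {f \<in> germs p. ordge (min (k * branch_mult i) (l $ i)) (T f i)})"
  have sE: "fn.subspace (E k)" for k
  proof -
    define l' :: "nat^'r" where "l' = (\<chi> j. if j = i then min (k * branch_mult i) (l $ i) else 0)"
    have "E k = germ_filtration l'" unfolding E_def germ_filtration_def l'_def by (auto split: if_splits)
    then show ?thesis using subspace_germ_filtration by simp
  qed
  obtain b where cd: "fn.codim (germ_filtration l) (germs p) (hilbert_fun p C \<nu> l)" using hilbert_exists[of l] by metis
  have "K \<le> hilbert_fun p C \<nu> l"
  proof (rule fn.codim_chain[OF cd subspace_germ_filtration, where E = E])
    show "fn.subspace (E k)" for k by (rule sE)
    show "E 0 = germs p" by (auto simp: E_def)
    show "germ_filtration l \<subseteq> E K" using K by (auto simp: germ_filtration_def E_def min_def)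
    fix k assume k: "k < K"
    have "E (Suc k) \<subseteq> E k" unfolding E_def by (auto intro: ordge_mono)
    moreover have xk: "T (\<lambda>z. x z ^ k) i \<noteq> 0" "subdegree (T (\<lambda>z. x z ^ k) i) = k * branch_mult i"
      using Tm unfolding T_power[OF x(1)] by auto
    then have "(\<lambda>z. x z ^ k) \<in> E k" "(\<lambda>z. x z ^ k) \<notin> E (Suc k)"
      using Kless[OF k] branch_mult_ge_1[of i]
      by (auto simp: E_def ordge_iff_subdegree[OF xk(1)] holomorphic_germ_power[OF x(1)])
    ultimately show "E (Suc k) \<subset> E k" by blast
  qed
  then have "K * branch_mult i \<le> hilbert_fun p C \<nu> l * branch_mult i" by simp
  then show ?thesis using K by linarith
qed

lemma hilbert_M_ge: "(\<Sum>i\<in>UNIV. l $ i) \<le> hilbert_fun p C \<nu> l * M"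
  unfolding M_def sum_distrib_left by (intro sum_mono hilbert_mult_ge)

section \<open>Powers of the maximal ideal\<close>

lemma max_ideal_eq: "max_ideal p C = germ_class p C ` {f \<in> germs p. f p = 0}"
proof (intro subset_antisym subsetI)
  fix g assume "g \<in> max_ideal p C"
  then obtain f where f: "holomorphic_germ p f" "g = germ_class p C f" "\<forall>f\<in>g. f p = 0"
    unfolding max_ideal_def by (auto elim: carrier_clsE)
  then show "g \<in> germ_class p C ` {f \<in> germs p. f p = 0}" using cls_self[OF f(1)] by blast
next
  fix g assume "g \<in> germ_class p C ` {f \<in> germs p. f p = 0}"
  then obtain f where f: "holomorphic_germ p f" "g = germ_class p C f" "f p = 0" by blast
  have "h p = 0" if "h \<in> g" for h
  proof -
    have h: "holomorphic_germ p h" "\<forall>\<^sub>F z in nhds p. z \<in> C \<longrightarrow> h z = f z"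
      using that f by (auto simp: mem_cls_iff)
    have "p \<in> C" using eventually_nhds_x_imp_x[OF germ_C] p_in_branch by blast
    then show ?thesis using eventually_nhds_x_imp_x[OF h(2)] f by simp
  qed
  then show "g \<in> max_ideal p C" unfolding max_ideal_def using f carrier_cls by auto
qed

lemma max_ideal_ideal: "ideal (max_ideal p C) (local_ring p C)"
  unfolding max_ideal_eq
  by (rule ideal_cls_image) (auto intro: holomorphic_germ_add holomorphic_germ_mult simp: plus_fun_def zero_fun_def)

lemma max_ideal_power_ideal: "ideal (max_ideal_power p C k) (local_ring p C)"
proof -
  interpret cring "local_ring p C" by (rule cring_local)
  show ?thesis by (induction k) (auto intro: ideal_prod_is_ideal max_ideal_ideal oneideal)
qed

lemma max_ideal_power_carrier: "max_ideal_power p C k \<subseteq> carrier (local_ring p C)"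
  using ideal.Icarr[OF max_ideal_power_ideal] by blast

text \<open>Two nested inductions, over k and over the generation of the ideal product by products
  and sums; f and g are generalized because factors and summands come with their own
  representatives.\<close>

lemma max_ideal_power_ord:
  assumes "g \<in> max_ideal_power p C k" "holomorphic_germ p f" "g = germ_class p C f"
  shows "ordge (k * branch_mult i) (T f i)"
  using assms
proof (induction k arbitrary: f g)
  case (Suc k)
  have "g \<in> ideal_prod (local_ring p C) (max_ideal_power p C k) (max_ideal p C)" using Suc.prems by simp
  then show ?case
    using Suc.prems(2,3)
  proof (induction arbitrary: f rule: ideal_prod.induct)
    case (prod a b)
    have "a \<in> carrier (local_ring p C)" using prod(1) max_ideal_power_carrier by blast
    then obtain f1 where f1: "holomorphic_germ p f1" "a = germ_class p C f1" by (rule carrier_clsE)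
    obtain f2 where f2: "holomorphic_germ p f2" "b = germ_class p C f2" "f2 p = 0"
      using prod(2) unfolding max_ideal_eq by blast
    have "T f = T (\<lambda>z. f1 z * f2 z)"
      using prod(3,4) f1 f2 cls_mult[OF f1(1) f2(1)] cls_eq_iff_T[OF prod(3) holomorphic_germ_mult[OF f1(1) f2(1)]] by simp
    then have "T f i = T f1 i * T f2 i" using T_mult[OF f1(1) f2(1)] by simp
    then show ?case using ordge_mult[OF Suc.IH[OF prod(1) f1] ordge_branch_mult[OF f2(1,3)]] by (simp add: add.commute)
  next
    case (sum a b)
    have c: "a \<in> carrier (local_ring p C)" "b \<in> carrier (local_ring p C)"
      using sum(1,2) max_ideal_power_carrier[of "Suc k"] by auto
    obtain f1 where f1: "holomorphic_germ p f1" "a = germ_class p C f1" using c(1) by (rule carrier_clsE)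
    obtain f2 where f2: "holomorphic_germ p f2" "b = germ_class p C f2" using c(2) by (rule carrier_clsE)
    have s: "holomorphic_germ p (f1 + f2)" using fn.subspace_add[OF subspace_germs] f1 f2 by blast
    have "T f = T (f1 + f2)"
      using sum(5,6) f1 f2 cls_add[OF f1(1) f2(1)] cls_eq_iff_T[OF sum(5) s] by simp
    then have "T f i = T f1 i + T f2 i" using T_add[OF f1(1) f2(1)] by simp
    then show ?case using ordge_add[OF sum(3)[OF f1] sum(4)[OF f2]] by simp
  qed
qed simp

lemma power_in_max_ideal_power:
  assumes "holomorphic_germ p x" "x p = 0" "holomorphic_germ p f"
  shows "germ_class p C (\<lambda>z. x z ^ k * f z) \<in> max_ideal_power p C k"
proof (induction k)
  case 0
  then show ?case using assms carrier_cls by simp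
next
  case (Suc k)
  have g: "holomorphic_germ p (\<lambda>z. x z ^ k * f z)"
    by (intro holomorphic_germ_mult holomorphic_germ_power assms)
  have "germ_class p C x \<in> max_ideal p C" unfolding max_ideal_eq using assms by blast
  from ideal_prod.prod[OF Suc this, of "local_ring p C"]
  have "germ_class p C (\<lambda>z. (x z ^ k * f z) * x z) \<in> max_ideal_power p C (Suc k)"
    using cls_mult[OF g assms(1)] by simp
  moreover have "(\<lambda>z. (x z ^ k * f z) * x z) = (\<lambda>z. x z ^ Suc k * f z)" by (auto simp: algebra_simps)
  ultimately show ?case by simp
qed

text \<open>Sandwiching \<open>x\<^sup>k \<O> \<subseteq> \<m>\<^sup>k \<subseteq> \<F>(k m)\<close>: multiplication by \<open>x\<^sup>k\<close> maps the normalization onto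
  its part of order at least \<open>k m\<close>, so \<open>x\<^sup>k \<O>\<close> has codimension \<open>k M + \<delta>\<close> there.\<close>

lemma codim_max_ideal_power:
  assumes \<delta>: "ser.codim A convergent_series \<delta>"
  shows "codim_ideal p C (max_ideal_power p C k) \<le> k * M" "k * M \<le> codim_ideal p C (max_ideal_power p C k) + \<delta>"
proof -
  obtain x where x: "holomorphic_germ p x" "x p = 0" and Tm: "\<forall>i. T x i \<noteq> 0 \<and> subdegree (T x i) = branch_mult i"
    by (rule generic_coordinate)
  define X where "X = (\<lambda>i. T x i ^ k)"
  have X0: "X i \<noteq> 0" and Xs: "subdegree (X i) = k * branch_mult i" for i
    using Tm unfolding X_def by auto
  have Xr: "fps_conv_radius (X i) > 0" for i
    using T_convergent[OF holomorphic_germ_power[OF x(1), of k]] unfolding convergent_series_def X_def by (simp add: T_power[OF x(1)])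
  \<comment> \<open>Multiplication by x^k, carried out on series and injective because no X i is
    zero.\<close>
  define \<mu> :: "('r \<Rightarrow> complex fps) \<Rightarrow> 'r \<Rightarrow> complex fps" where "\<mu> = (\<lambda>g i. X i * g i)"
  have \<mu>lin: "ss.linear_on U \<mu>" for U
    unfolding ss.linear_on_def \<mu>_def by (auto simp: sscale_def fun_eq_iff algebra_simps)
  have \<mu>inj: "\<mu> g = \<mu> g' \<Longrightarrow> g = g'" for g g'
    using X0 unfolding \<mu>_def by (auto simp: fun_eq_iff)
  define l :: "nat^'r" where "l = (\<chi> i. k * branch_mult i)"
  have ls: "(\<Sum>i\<in>UNIV. l $ i) = k * M" unfolding l_def M_def by (simp add: sum_distrib_left)
  have s\<mu>A: "ser.subspace (\<mu> ` A)"
  proof -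
    have "ss.img_sum \<mu> A {0} = \<mu> ` A" unfolding ss.img_sum_def by auto
    then show ?thesis using ss.subspace_img_sum[OF subspace_A ser.subspace_single_0 \<mu>lin] by simp
  qed
  \<comment> \<open>X i has the exact order l i, so division shows that \<mu> maps the normalization
    onto the filtration step l. The summand \<mu>(A) is already contained in that image; it appears
    because \<open>codim_image\<close> speaks of such sums.\<close>
  have \<mu>convergent_series: "ss.img_sum \<mu> convergent_series (\<mu> ` A) = series_filtration l"
  proof (intro subset_antisym subsetI)
    fix g assume "g \<in> ss.img_sum \<mu> convergent_series (\<mu> ` A)"
    then obtain u a where ua: "u \<in> convergent_series" "a \<in> A" "g = \<mu> u + \<mu> a" unfolding ss.img_sum_def by blast
    then have s: "u + a \<in> convergent_series" "g = \<mu> (u + a)"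
      using A_subset_convergent ser.subspace_add[OF subspace_convergent_series] by (auto simp: \<mu>_def fun_eq_iff algebra_simps)
    have "ordge (k * branch_mult i + 0) (X i * (u + a) i)" for i
      by (rule ordge_mult) (simp_all add: ordge_iff_subdegree[OF X0] Xs)
    moreover have "fps_conv_radius (X i * (u + a) i) > 0" for i
      by (rule conv_mult[OF Xr]) (use s(1) in \<open>simp add: convergent_series_def\<close>)
    ultimately show "g \<in> series_filtration l" unfolding s(2) series_filtration_def convergent_series_def l_def \<mu>_def by simp
  next
    fix g assume g: "g \<in> series_filtration l"
    have "\<exists>q. fps_conv_radius q > 0 \<and> g i = X i * q" for i
    proof -
      have "fps_conv_radius (g i) > 0" "ordge (subdegree (X i)) (g i)"
        using g unfolding series_filtration_def convergent_series_def l_def Xs by auto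
      then show ?thesis using conv_quotient[OF _ Xr X0] by metis
    qed
    then obtain q where q: "\<And>i. fps_conv_radius (q i) > 0" "\<And>i. g i = X i * q i" by metis
    then have "q \<in> convergent_series" "g = \<mu> q" by (auto simp: convergent_series_def \<mu>_def)
    moreover have "0 \<in> \<mu> ` A" by (rule ser.subspace_0[OF s\<mu>A])
    ultimately show "g \<in> ss.img_sum \<mu> convergent_series (\<mu> ` A)" unfolding ss.img_sum_def by force
  qed
  have "{u \<in> convergent_series. \<mu> u \<in> \<mu> ` A} = A" using \<mu>inj A_subset_convergent by blast
  from ss.codim_image[OF \<delta> subspace_A s\<mu>A \<mu>lin this] have "ser.codim (\<mu> ` A) (series_filtration l) \<delta>" unfolding \<mu>convergent_series .
  from ser.codim_trans[OF codim_series_filtration this] have cA: "ser.codim (\<mu> ` A) convergent_series (\<delta> + k * M)" unfolding ls .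
  define Mk where "Mk = {f \<in> germs p. germ_class p C f \<in> max_ideal_power p C k}"
  interpret I: ideal "max_ideal_power p C k" "local_ring p C" by (rule max_ideal_power_ideal)
  have sMk: "fn.subspace Mk"
  proof (rule fn.subspaceI)
    show "0 \<in> Mk" unfolding Mk_def using fn.subspace_0[OF subspace_germs] cls_zero[of p C]
      additive_subgroup.zero_closed[OF I.is_additive_subgroup] by simp
    fix f g assume "f \<in> Mk" "g \<in> Mk"
    then have fg: "holomorphic_germ p f" "holomorphic_germ p g"
      "germ_class p C f \<in> max_ideal_power p C k" "germ_class p C g \<in> max_ideal_power p C k" by (auto simp: Mk_def)
    have "f + g \<in> germs p" using fn.subspace_add[OF subspace_germs] fg by blast
    then show "f + g \<in> Mk" unfolding Mk_def
      using additive_subgroup.a_closed[OF I.is_additive_subgroup fg(3,4)] cls_add[OF fg(1,2), of C] by simp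
  next
    fix c f assume f: "f \<in> Mk"
    then have f: "holomorphic_germ p f" "germ_class p C f \<in> max_ideal_power p C k" by (auto simp: Mk_def)
    have "germ_class p C (\<lambda>x. c) \<in> carrier (local_ring p C)" by (rule carrier_cls) simp
    from I.I_l_closed[OF f(2) this] have "germ_class p C (fscale c f) \<in> max_ideal_power p C k"
      using cls_mult[OF holomorphic_germ_const[of p c] f(1), of C] by (simp add: fscale_def)
    moreover have "fscale c f \<in> germs p" using fn.subspace_scale[OF subspace_germs] f by blast
    ultimately show "fscale c f \<in> Mk" unfolding Mk_def by blast
  qed
  have MkV: "Mk \<subseteq> germs p" unfolding Mk_def by blast
  have sT: "ser.subspace (T ` Mk)" by (rule subspace_T_image[OF sMk MkV])
  have i1: "\<mu> ` A \<subseteq> T ` Mk"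
  proof
    fix g assume "g \<in> \<mu> ` A"
    then obtain f where f: "holomorphic_germ p f" "g = \<mu> (T f)" by blast
    have "T (\<lambda>z. x z ^ k * f z) = g"
      unfolding f(2) \<mu>_def X_def by (rule ext) (simp add: T_mult T_power holomorphic_germ_power x f)
    moreover have "(\<lambda>z. x z ^ k * f z) \<in> Mk"
      unfolding Mk_def using power_in_max_ideal_power[OF x f(1)]
      by (simp add: holomorphic_germ_mult holomorphic_germ_power x f)
    ultimately show "g \<in> T ` Mk" by blast
  qed
  have i2: "T ` Mk \<subseteq> A" using MkV by blast
  have i3: "T ` Mk \<subseteq> series_filtration l"
    using max_ideal_power_ord[OF _ _ refl] T_convergent unfolding Mk_def series_filtration_def l_def by auto
  have i4: "series_filtration l \<subseteq> convergent_series" unfolding series_filtration_def by blast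
  obtain a b where ab: "ser.codim (\<mu> ` A) A a" "ser.codim A convergent_series b" "a + b = \<delta> + k * M"
    using ser.codim_between[OF cA s\<mu>A subspace_A _ A_subset_convergent] i1 i2 by blast
  \<comment> \<open>\<delta> is the codimension of A in the normalization and also that of \<mu>(A)
    in the filtration step l, so it cancels: x^k O has codimension k M in O.\<close>
  have a: "a = k * M" using ser.codim_unique[OF ab(2) \<delta> subspace_A] ab(3) by simp
  obtain b' c where bc: "ser.codim (\<mu> ` A) (T ` Mk) b'" "ser.codim (T ` Mk) A c" "b' + c = k * M"
    using ser.codim_between[OF ab(1) s\<mu>A sT i1 i2] a by blast
  have TA: "fs.img_sum T (germs p) (T ` Mk) = A"
  proof (intro subset_antisym subsetI)
    fix g assume "g \<in> fs.img_sum T (germs p) (T ` Mk)"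
    then show "g \<in> A" unfolding fs.img_sum_def using i2 ser.subspace_add[OF subspace_A] by blast
  next
    fix g assume "g \<in> A"
    then show "g \<in> fs.img_sum T (germs p) (T ` Mk)" using A_subset_img_sum[OF sT] by blast
  qed
  have "fn.codim {u \<in> germs p. T u \<in> T ` Mk} (germs p) c"
    by (rule fs.codim_preimage[OF bc(2) subspace_germs sT T_linear TA])
  moreover have "{u \<in> germs p. T u \<in> T ` Mk} = Mk"
    unfolding Mk_def using cls_eq_iff_T by auto metis
  ultimately have c: "codim_ideal p C (max_ideal_power p C k) = c"
    using codim_ideal_eq[OF max_ideal_power_ideal] unfolding Mk_def by simp
  show "codim_ideal p C (max_ideal_power p C k) \<le> k * M" unfolding c using bc by simp
  \<comment> \<open>The other half of the sandwich: the image of the k-th power of the maximal ideal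
    lies in the filtration step l, of codimension k M in the normalization.\<close>
  have "ser.codim (T ` Mk) convergent_series (c + \<delta>)" by (rule ser.codim_trans[OF \<delta> bc(2)])
  from ser.codim_between[OF this sT subspace_series_filtration i3 i4] obtain d e
    where "ser.codim (series_filtration l) convergent_series e" "d + e = c + \<delta>" by blast
  moreover have "e = k * M" using ser.codim_unique[OF calculation(1) codim_series_filtration subspace_series_filtration] ls by simp
  ultimately show "k * M \<le> codim_ideal p C (max_ideal_power p C k) + \<delta>" unfolding c by simp
qed

text \<open>The codimension of the k-th power differs from k M by at most \<delta>, which disappears
  after division by k.\<close>

lemma multiplicity_eq: "multiplicity_curve p C = real M"
proof -
  obtain \<delta> where \<delta>: "ser.codim A convergent_series \<delta>" by (rule finite_delta)
  let ?c = "\<lambda>k. real (codim_ideal p C (max_ideal_power p C k))"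
  have "(\<lambda>k. ?c k / real k) \<longlonglongrightarrow> real M"
  proof (rule tendsto_sandwich)
    show "\<forall>\<^sub>F k in sequentially. real M - real \<delta> / real k \<le> ?c k / real k"
      using eventually_gt_at_top[of 0]
    proof eventually_elim
      case (elim k)
      have "real (k * M) \<le> ?c k + real \<delta>" using codim_max_ideal_power(2)[OF \<delta>, of k] by linarith
      then have "(real M * real k - real \<delta>) / real k \<le> ?c k / real k"
        by (intro divide_right_mono) (auto simp: mult.commute)
      then show ?case using elim by (simp add: diff_divide_distrib)
    qed
    show "\<forall>\<^sub>F k in sequentially. ?c k / real k \<le> real M"
      using eventually_gt_at_top[of 0]
    proof eventually_elim
      case (elim k)
      have "?c k \<le> real (k * M)" using codim_max_ideal_power(1)[OF \<delta>, of k] by linarith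
      then have "?c k / real k \<le> real (k * M) / real k" by (rule divide_right_mono) simp
      then show ?case using elim by simp
    qed
    have "(\<lambda>k. real M - real \<delta> / real k) \<longlonglongrightarrow> real M - 0"
      by (intro tendsto_intros lim_const_over_n)
    then show "(\<lambda>k. real M - real \<delta> / real k) \<longlonglongrightarrow> real M" by simp
  qed simp
  then show ?thesis unfolding multiplicity_curve_def by (rule limI)
qed

end

subsection \<open>Degree-zero cohomology\<close>

text \<open>Evaluation on a chain of the cochain that takes the value w \<sigma> on the generator
  \<sigma>.\<close>

definition wsum :: "('a \<Rightarrow> int) \<Rightarrow> ('a \<Rightarrow>\<^sub>0 int) \<Rightarrow> int" where
  "wsum w c = (\<Sum>\<sigma>\<in>Poly_Mapping.keys c. Poly_Mapping.lookup c \<sigma> * w \<sigma>)"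

lemma wsum_superset:
  "finite S \<Longrightarrow> Poly_Mapping.keys c \<subseteq> S \<Longrightarrow> wsum w c = (\<Sum>\<sigma>\<in>S. Poly_Mapping.lookup c \<sigma> * w \<sigma>)"
  unfolding wsum_def by (rule sum.mono_neutral_left) (auto simp: in_keys_iff)

lemma wsum_add: "wsum w (a + b) = wsum w a + wsum w b"
proof -
  let ?S = "Poly_Mapping.keys a \<union> Poly_Mapping.keys b"
  have "wsum w (a + b) = (\<Sum>\<sigma>\<in>?S. Poly_Mapping.lookup (a + b) \<sigma> * w \<sigma>)"
    by (rule wsum_superset) (auto dest: subsetD[OF Poly_Mapping.keys_add])
  also have "\<dots> = (\<Sum>\<sigma>\<in>?S. Poly_Mapping.lookup a \<sigma> * w \<sigma>) + (\<Sum>\<sigma>\<in>?S. Poly_Mapping.lookup b \<sigma> * w \<sigma>)"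
    by (simp add: lookup_add distrib_right sum.distrib)
  also have "\<dots> = wsum w a + wsum w b"
    using wsum_superset[of ?S a w] wsum_superset[of ?S b w] by simp
  finally show ?thesis .
qed

lemma wsum_zero [simp]: "wsum w 0 = 0"
  by (simp add: wsum_def)

lemma wsum_diff: "wsum w (a - b) = wsum w a - wsum w b"
  using wsum_add[of w "a - b" b] by simp

lemma wsum_of [simp]: "wsum w (frag_of \<sigma>) = w \<sigma>"
  by (simp add: wsum_def)

lemma boundary_1_of:
  "chain_boundary 1 (frag_of f) = frag_of (singular_face 1 0 f) - frag_of (singular_face 1 1 f)"
  by (simp add: chain_boundary_of)

lemma mem_cohomology0:
  "\<phi> \<in> carrier (cohomology0 X) \<longleftrightarrow>
    \<phi> \<in> hom (chain_group 0 X) integer_group \<and> \<phi> \<in> extensional (singular_chain_set 0 X) \<and>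
    (\<forall>c. singular_chain 1 X c \<longrightarrow> \<phi> (chain_boundary 1 c) = 0)"
proof -
  have "(\<lambda>c\<in>singular_chain_set 1 X. \<phi> (chain_boundary 1 c)) = (\<lambda>c\<in>singular_chain_set 1 X. 0) \<longleftrightarrow>
      (\<forall>c. singular_chain 1 X c \<longrightarrow> \<phi> (chain_boundary 1 c) = 0)"
    by (auto simp: restrict_def fun_eq_iff)
  then show ?thesis
    by (auto simp: cohomology0_def kernel_def cochain_group_def cochain_coboundary_def)
qed

lemma hom_chain_add:
  "\<phi> \<in> hom (chain_group q X) integer_group \<Longrightarrow> singular_chain q X a \<Longrightarrow> singular_chain q X b \<Longrightarrow>
    \<phi> (a + b) = \<phi> a + \<phi> b"
  by (auto simp: hom_def integer_group_def)

lemma boundary_1_chain: "singular_chain 1 X c \<Longrightarrow> singular_chain 0 X (chain_boundary 1 c)"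
  using singular_chain_boundary[of 1 X c] by simp

lemma comm_group_cohomology0: "comm_group (cohomology0 X)"
proof -
  let ?G = "cohomology0 X"
  have mult: "\<phi> \<otimes>\<^bsub>?G\<^esub> \<psi> = (\<lambda>c\<in>singular_chain_set 0 X. \<phi> c + \<psi> c)" for \<phi> \<psi>
    by (simp add: cohomology0_def cochain_group_def)
  have one: "\<one>\<^bsub>?G\<^esub> = (\<lambda>c\<in>singular_chain_set 0 X. 0)"
    by (simp add: cohomology0_def cochain_group_def)
  show ?thesis
  proof (rule comm_groupI)
    fix \<phi> \<psi> assume *: "\<phi> \<in> carrier ?G" "\<psi> \<in> carrier ?G"
    then show "\<phi> \<otimes>\<^bsub>?G\<^esub> \<psi> \<in> carrier ?G"
      unfolding mem_cohomology0 mult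
      by (auto simp: hom_def integer_group_def boundary_1_chain[unfolded One_nat_def] singular_chain_add)
    show "\<phi> \<otimes>\<^bsub>?G\<^esub> \<psi> = \<psi> \<otimes>\<^bsub>?G\<^esub> \<phi>" unfolding mult by (auto simp: add.commute)
  next
    show "\<one>\<^bsub>?G\<^esub> \<in> carrier ?G" unfolding mem_cohomology0 one
      by (auto simp: hom_def integer_group_def boundary_1_chain[unfolded One_nat_def] singular_chain_add)
  next
    fix \<phi> \<psi> \<theta> assume "\<phi> \<in> carrier ?G" "\<psi> \<in> carrier ?G" "\<theta> \<in> carrier ?G"
    show "\<phi> \<otimes>\<^bsub>?G\<^esub> \<psi> \<otimes>\<^bsub>?G\<^esub> \<theta> = \<phi> \<otimes>\<^bsub>?G\<^esub> (\<psi> \<otimes>\<^bsub>?G\<^esub> \<theta>)" unfolding mult by (auto simp: restrict_def)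
  next
    fix \<phi> assume \<phi>: "\<phi> \<in> carrier ?G"
    then have e: "\<phi> \<in> extensional (singular_chain_set 0 X)" unfolding mem_cohomology0 by blast
    show "\<one>\<^bsub>?G\<^esub> \<otimes>\<^bsub>?G\<^esub> \<phi> = \<phi>" unfolding one mult
      by (rule extensionalityI[OF restrict_extensional e]) simp
    show "\<exists>\<psi>\<in>carrier ?G. \<psi> \<otimes>\<^bsub>?G\<^esub> \<phi> = \<one>\<^bsub>?G\<^esub>"
    proof (rule bexI[of _ "\<lambda>c\<in>singular_chain_set 0 X. - \<phi> c"])
      show "(\<lambda>c\<in>singular_chain_set 0 X. - \<phi> c) \<in> carrier ?G"
        using \<phi> unfolding mem_cohomology0
        by (auto simp: hom_def integer_group_def boundary_1_chain[unfolded One_nat_def] singular_chain_add)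
      show "(\<lambda>c\<in>singular_chain_set 0 X. - \<phi> c) \<otimes>\<^bsub>?G\<^esub> \<phi> = \<one>\<^bsub>?G\<^esub>"
        unfolding one mult by (auto simp: restrict_def)
    qed
  qed
qed

text \<open>The two faces of f are the end points of a path, so the hypothesis makes the cochain
  vanish on boundaries of generators; the rest is additivity.\<close>

lemma wsum_cocycle:
  assumes "\<And>f. singular_simplex 1 X f \<Longrightarrow> w (singular_face 1 0 f) = w (singular_face 1 1 f)"
  shows "(\<lambda>c\<in>singular_chain_set 0 X. wsum w c) \<in> carrier (cohomology0 X)"
  unfolding mem_cohomology0
proof (intro conjI allI impI)
  show "(\<lambda>c\<in>singular_chain_set 0 X. wsum w c) \<in> hom (chain_group 0 X) integer_group"
    by (auto simp: hom_def integer_group_def wsum_add singular_chain_add)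
  fix c assume c: "singular_chain 1 X c"
  then have "Poly_Mapping.keys c \<subseteq> singular_simplex_set 1 X" unfolding singular_chain_def .
  then have "wsum w (chain_boundary 1 c) = 0"
  proof (induction c rule: frag_induction)
    case (one f)
    then show ?case unfolding boundary_1_of using assms by (simp add: wsum_diff)
  next
    case (diff a b)
    then show ?case by (simp add: chain_boundary_diff wsum_diff)
  qed simp
  then show "(\<lambda>c\<in>singular_chain_set 0 X. wsum w c) (chain_boundary 1 c) = 0"
    using boundary_1_chain[OF c] by simp
qed simp

lemma augmentation_cocycles_eq:
  "augmentation_cocycles X = range (\<lambda>m. \<lambda>c\<in>singular_chain_set 0 X. wsum (\<lambda>_. m) c)"
  unfolding augmentation_cocycles_def wsum_def by (simp add: sum_distrib_left mult.commute)

lemma augmentation_subgroup: "subgroup (augmentation_cocycles X) (cohomology0 X)"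
proof -
  interpret G: comm_group "cohomology0 X" by (rule comm_group_cohomology0)
  have mult: "\<phi> \<otimes>\<^bsub>cohomology0 X\<^esub> \<psi> = (\<lambda>c\<in>singular_chain_set 0 X. \<phi> c + \<psi> c)" for \<phi> \<psi>
    by (simp add: cohomology0_def cochain_group_def)
  have one: "\<one>\<^bsub>cohomology0 X\<^esub> = (\<lambda>c\<in>singular_chain_set 0 X. 0)"
    by (simp add: cohomology0_def cochain_group_def)
  let ?a = "\<lambda>m. \<lambda>c\<in>singular_chain_set 0 X. wsum (\<lambda>_. m) c"
  have ac: "?a m \<in> carrier (cohomology0 X)" for m by (rule wsum_cocycle) simp
  have am: "?a m \<otimes>\<^bsub>cohomology0 X\<^esub> ?a n = ?a (m + n)" for m n
    unfolding mult by (auto simp: restrict_def wsum_def distrib_left sum.distrib)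
  have a0: "?a 0 = \<one>\<^bsub>cohomology0 X\<^esub>" unfolding one by (auto simp: wsum_def)
  show ?thesis
    unfolding augmentation_cocycles_eq
  proof (rule G.subgroupI)
    fix \<phi> assume "\<phi> \<in> range ?a"
    then obtain m where m: "\<phi> = ?a m" by (rule rangeE)
    have "inv\<^bsub>cohomology0 X\<^esub> \<phi> = ?a (- m)"
      unfolding m by (rule G.inv_equality) (simp_all only: am ac a0 add.left_inverse)
    then show "inv\<^bsub>cohomology0 X\<^esub> \<phi> \<in> range ?a" by simp
    fix \<psi> assume "\<psi> \<in> range ?a"
    then obtain n where "\<psi> = ?a n" by (rule rangeE)
    then show "\<phi> \<otimes>\<^bsub>cohomology0 X\<^esub> \<psi> \<in> range ?a" using am[of m n] m by simp
  qed (use ac in auto)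
qed

lemma group_reduced_cohomology0: "group (reduced_cohomology0 X)"
proof -
  interpret G: comm_group "cohomology0 X" by (rule comm_group_cohomology0)
  show ?thesis unfolding reduced_cohomology0_def
    by (rule normal.factorgroup_is_group[OF G.subgroup_imp_normal[OF augmentation_subgroup]])
qed

text \<open>A factor group is trivial iff every coset is the subgroup itself. Nontriviality is thus
  a matter of exhibiting a cocycle that is not constant.\<close>

lemma trivial_reduced_cohomology0_iff:
  "trivial_group (reduced_cohomology0 X) \<longleftrightarrow> carrier (cohomology0 X) \<subseteq> augmentation_cocycles X"
proof -
  interpret G: comm_group "cohomology0 X" by (rule comm_group_cohomology0)
  let ?H = "augmentation_cocycles X"
  have H: "subgroup ?H (cohomology0 X)" by (rule augmentation_subgroup)
  have "trivial_group (reduced_cohomology0 X) \<longleftrightarrow> carrier (reduced_cohomology0 X) = {?H}"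
    using group_reduced_cohomology0[of X] unfolding trivial_group_def reduced_cohomology0_def by simp
  also have "\<dots> \<longleftrightarrow> (\<forall>x\<in>carrier (cohomology0 X). ?H #>\<^bsub>cohomology0 X\<^esub> x = ?H)"
    unfolding reduced_cohomology0_def carrier_FactGroup using G.one_closed by blast
  also have "\<dots> \<longleftrightarrow> carrier (cohomology0 X) \<subseteq> ?H"
    using G.coset_join1[OF _ _ H] G.coset_join2[OF _ H] by blast
  finally show ?thesis .
qed

lemma cohomology0_empty:
  assumes "topspace X = {}" shows "carrier (cohomology0 X) = {\<one>\<^bsub>cohomology0 X\<^esub>}"
proof -
  interpret G: comm_group "cohomology0 X" by (rule comm_group_cohomology0)
  have one: "\<one>\<^bsub>cohomology0 X\<^esub> = (\<lambda>c\<in>singular_chain_set 0 X. 0)"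
    by (simp add: cohomology0_def cochain_group_def)
  have "\<phi> = \<one>\<^bsub>cohomology0 X\<^esub>" if \<phi>: "\<phi> \<in> carrier (cohomology0 X)" for \<phi>
    unfolding one
  proof (rule extensionalityI[of _ "singular_chain_set 0 X"])
    show "\<phi> \<in> extensional (singular_chain_set 0 X)" using \<phi> mem_cohomology0 by blast
    fix c assume "c \<in> singular_chain_set 0 X"
    then have c: "c = 0" using singular_chain_empty[OF assms] by blast
    have "\<phi> (0 + 0) = \<phi> 0 + \<phi> 0"
      using \<phi> unfolding mem_cohomology0 by (intro hom_chain_add[of \<phi> 0 X]) (auto simp: singular_chain_0)
    then show "\<phi> c = (\<lambda>c\<in>singular_chain_set 0 X. 0) c" using c by (simp add: singular_chain_0)
  qed simp
  then show ?thesis using G.one_closed by blast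
qed

lemma point_simplex:
  assumes "a \<in> topspace X"
  shows "singular_simplex 0 X (\<lambda>x\<in>standard_simplex 0. a)"
  using assms by (simp add: singular_simplex_def)

lemma trivial_cohomology0_iff: "trivial_group (cohomology0 X) \<longleftrightarrow> topspace X = {}"
proof
  assume t: "trivial_group (cohomology0 X)"
  show "topspace X = {}"
  proof (rule ccontr)
    assume "topspace X \<noteq> {}"
    then obtain a where "a \<in> topspace X" by blast
    then have s: "singular_chain 0 X (frag_of (\<lambda>x\<in>standard_simplex 0. a))"
      by (simp add: singular_chain_of point_simplex)
    have one: "\<one>\<^bsub>cohomology0 X\<^esub> = (\<lambda>c\<in>singular_chain_set 0 X. 0)"
      by (simp add: cohomology0_def cochain_group_def)
    have "(\<lambda>c\<in>singular_chain_set 0 X. wsum (\<lambda>_. 1) c) \<in> carrier (cohomology0 X)"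
      by (rule wsum_cocycle) simp
    then have "(\<lambda>c\<in>singular_chain_set 0 X. wsum (\<lambda>_. 1) c) = (\<lambda>c\<in>singular_chain_set 0 X. 0)"
      using t one unfolding trivial_group_def by auto
    from fun_cong[OF this, of "frag_of (\<lambda>x\<in>standard_simplex 0. a)"] show False using s by simp
  qed
next
  assume "topspace X = {}"
  then show "trivial_group (cohomology0 X)"
    unfolding trivial_group_def using cohomology0_empty comm_group.axioms(2)[OF comm_group_cohomology0] by blast
qed

lemma trivial_reduced_empty:
  assumes "topspace X = {}" shows "trivial_group (reduced_cohomology0 X)"
  unfolding trivial_reduced_cohomology0_iff cohomology0_empty[OF assms]
  using subgroup.one_closed[OF augmentation_subgroup[of X]] by simp

text \<open>Any two 0-simplices are homologous, so a cocycle takes one value on all of them and is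
  that multiple of the augmentation.\<close>

lemma trivial_reduced_path_connected:
  assumes X: "path_connected_space X"
  shows "trivial_group (reduced_cohomology0 X)"
proof (cases "topspace X = {}")
  case False
  then obtain a where "a \<in> topspace X" by blast
  define \<sigma> where "\<sigma> = (\<lambda>x::nat \<Rightarrow> real\<in>standard_simplex 0. a)"
  have \<sigma>: "singular_simplex 0 X \<sigma>" unfolding \<sigma>_def by (rule point_simplex) fact
  show ?thesis
    unfolding trivial_reduced_cohomology0_iff
  proof
    fix \<phi> assume \<phi>: "\<phi> \<in> carrier (cohomology0 X)"
    then have h: "\<phi> \<in> hom (chain_group 0 X) integer_group" and e: "\<phi> \<in> extensional (singular_chain_set 0 X)"
      and c: "\<And>c. singular_chain 1 X c \<Longrightarrow> \<phi> (chain_boundary 1 c) = 0"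
      unfolding mem_cohomology0 by blast+
    have d: "\<phi> (a - b) = \<phi> a - \<phi> b" if "singular_chain 0 X a" "singular_chain 0 X b" for a b
      using hom_chain_add[OF h singular_chain_diff[OF that] that(2)] by simp
    have eq: "\<phi> (frag_of f) = \<phi> (frag_of \<sigma>)" if f: "singular_simplex 0 X f" for f
    proof -
      have "singular_relboundary 0 X {} (frag_of f - frag_of \<sigma>)"
        using iso_integer_zeroth_homology_group_aux[OF X f \<sigma>] unfolding homologous_rel_def .
      then obtain k where "singular_chain 1 X k" "chain_boundary 1 k = frag_of f - frag_of \<sigma>"
        unfolding singular_relboundary_def mod_subset_empty by auto
      then have "\<phi> (frag_of f - frag_of \<sigma>) = 0" using c by metis
      then show ?thesis using d[of "frag_of f" "frag_of \<sigma>"] f \<sigma> by (simp add: singular_chain_of)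
    qed
    have z: "\<phi> 0 = 0" using d[of 0 0] by (simp add: singular_chain_0)
    have "\<phi> k = wsum (\<lambda>_. \<phi> (frag_of \<sigma>)) k" if "singular_chain 0 X k" for k
    proof -
      have "Poly_Mapping.keys k \<subseteq> singular_simplex_set 0 X" using that unfolding singular_chain_def .
      then have "singular_chain 0 X k \<and> \<phi> k = wsum (\<lambda>_. \<phi> (frag_of \<sigma>)) k"
      proof (induction k rule: frag_induction)
        case zero
        then show ?case using z by (simp add: singular_chain_0)
      next
        case (one f)
        then show ?case using eq by (simp add: singular_chain_of)
      next
        case (diff a b)
        then show ?case using d[of a b] singular_chain_diff[of 0 X a b] by (simp add: wsum_diff)
      qed
      then show ?thesis by blast
    qed
    then have "\<phi> = (\<lambda>k\<in>singular_chain_set 0 X. wsum (\<lambda>_. \<phi> (frag_of \<sigma>)) k)"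
      by (intro extensionalityI[OF e restrict_extensional]) simp
    then show "\<phi> \<in> augmentation_cocycles X" unfolding augmentation_cocycles_eq by blast
  qed
qed (rule trivial_reduced_empty)

text \<open>The indicator of the point a is a cocycle, since a path is connected and cannot leave a
  clopen set; but it takes different values at a and b.\<close>

lemma nontrivial_reduced_isolated:
  assumes a: "openin X {a}" "closedin X {a}" and b: "b \<in> topspace X" "b \<noteq> a"
  shows "\<not> trivial_group (reduced_cohomology0 X)"
proof
  assume t: "trivial_group (reduced_cohomology0 X)"
  \<comment> \<open>The only point of the standard 0-simplex; evaluating there reads a 0-simplex as
    a point of X.\<close>
  define v :: "nat \<Rightarrow> real" where "v = (\<lambda>j. if j = 0 then 1 else 0)"
  have v: "v \<in> standard_simplex 0" by (simp add: v_def standard_simplex_0)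
  define w :: "((nat \<Rightarrow> real) \<Rightarrow> 'a) \<Rightarrow> int" where "w = (\<lambda>\<sigma>. if \<sigma> v = a then 1 else 0)"
  have aX: "a \<in> topspace X" using openin_subset[OF a(1)] by simp
  have "(\<lambda>c\<in>singular_chain_set 0 X. wsum w c) \<in> carrier (cohomology0 X)"
  proof (rule wsum_cocycle)
    fix f assume "singular_simplex 1 X f"
    then have f: "continuous_map (subtopology (powertop_real UNIV) (standard_simplex 1)) X f"
      unfolding singular_simplex_def by blast
    have "connectedin (subtopology (powertop_real UNIV) (standard_simplex 1)) (standard_simplex 1)"
      using connectedin_standard_simplex by (simp add: connectedin_subtopology)
    from connectedin_continuous_map_image[OF f this]
    have con: "connectedin X (f ` standard_simplex 1)" .
    have dich: "f ` standard_simplex 1 \<subseteq> {a} \<or> disjnt (f ` standard_simplex 1) {a}"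
      using connectedin_clopen_cases[OF con a(2,1)] .
    have "simplical_face k v \<in> standard_simplex 1" if "k \<le> 1" for k
      using simplical_face_in_standard_simplex[of 1 k v] that v by simp
    then have "f (simplical_face k v) \<in> f ` standard_simplex 1" if "k \<le> 1" for k using that by blast
    from this[of 0] this[of 1] have "f (simplical_face 0 v) = a \<longleftrightarrow> f (simplical_face 1 v) = a"
      using dich by (auto simp: disjnt_def)
    then show "w (singular_face 1 0 f) = w (singular_face 1 1 f)"
      using v by (simp add: w_def singular_face_def)
  qed
  then have "(\<lambda>c\<in>singular_chain_set 0 X. wsum w c) \<in> augmentation_cocycles X"
    using t unfolding trivial_reduced_cohomology0_iff by blast
  then obtain m where m: "(\<lambda>c\<in>singular_chain_set 0 X. wsum w c) = (\<lambda>c\<in>singular_chain_set 0 X. wsum (\<lambda>_. m) c)"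
    unfolding augmentation_cocycles_eq by (rule rangeE)
  have "w (\<lambda>x\<in>standard_simplex 0. y) = m" if "y \<in> topspace X" for y
  proof -
    have "singular_chain 0 X (frag_of (\<lambda>x\<in>standard_simplex 0. y))"
      using point_simplex[OF that] by (simp add: singular_chain_of)
    then show ?thesis using fun_cong[OF m, of "frag_of (\<lambda>x\<in>standard_simplex 0. y)"] by simp
  qed
  from this[OF aX] this[OF b(1)] show False using v b(2) by (simp add: w_def)
qed

lemma trivial_sum_group_iff:
  assumes "\<And>i. group (G i)"
  shows "trivial_group (sum_group UNIV G) \<longleftrightarrow> (\<forall>i. trivial_group (G i))"
proof
  assume t: "trivial_group (sum_group UNIV G)"
  show "\<forall>i. trivial_group (G i)"
  proof
    fix i
    interpret group "G i" by fact
    have "x = \<one>\<^bsub>G i\<^esub>" if x: "x \<in> carrier (G i)" for x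
    proof -
      define y where "y = (\<lambda>j. if j = i then x else \<one>\<^bsub>G j\<^esub>)"
      have "{j. y j \<noteq> \<one>\<^bsub>G j\<^esub>} \<subseteq> {i}" unfolding y_def by auto
      then have "finite {j. y j \<noteq> \<one>\<^bsub>G j\<^esub>}" using finite_subset by blast
      moreover have "y j \<in> carrier (G j)" for j
        using x group.is_monoid[OF assms[of j]] monoid.one_closed unfolding y_def by auto
      ultimately have "y \<in> carrier (sum_group UNIV G)"
        by (auto simp: carrier_sum_group[OF assms])
      then have "y = (\<lambda>j\<in>UNIV. \<one>\<^bsub>G j\<^esub>)" using t unfolding trivial_group_def by simp
      then have "y i = \<one>\<^bsub>G i\<^esub>" by simp
      then show ?thesis by (simp add: y_def)
    qed
    then show "trivial_group (G i)" unfolding trivial_group_def using assms one_closed by blast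
  qed
next
  assume t: "\<forall>i. trivial_group (G i)"
  have "group (sum_group UNIV G)" by (rule sum_group) (use assms in auto)
  moreover have "carrier (sum_group UNIV G) = {\<one>\<^bsub>sum_group UNIV G\<^esub>}"
  proof -
    have c: "carrier (G i) = {\<one>\<^bsub>G i\<^esub>}" for i using t unfolding trivial_group_def by blast
    then show ?thesis by (auto simp: carrier_sum_group[OF assms] c PiE_def Pi_def fun_eq_iff)
  qed
  ultimately show "trivial_group (sum_group UNIV G)" unfolding trivial_group_def by blast
qed

subsection \<open>Sublevel sets of the weight function\<close>

context curve
begin

abbreviation S :: "int \<Rightarrow> (real^'r) set" where "S n \<equiv> sublevel p C \<nu> n"

abbreviation w0 :: "nat^'r \<Rightarrow> int" where "w0 l \<equiv> weight0 p C \<nu> l"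

lemma finite_cube_vertices: "finite (cube_vertices l J)"
proof -
  have "cube_vertices l J = (\<lambda>K. \<chi> i. l $ i + (if i \<in> K then 1 else 0)) ` Pow J"
    unfolding cube_vertices_def by auto
  then show ?thesis by simp
qed

lemma base_vertex: "l \<in> cube_vertices l J"
  unfolding cube_vertices_def by (auto intro!: exI[of _ "{}"] simp: vec_eq_iff)

lemma cube_weight_le_iff: "cube_weight p C \<nu> l J \<le> n \<longleftrightarrow> (\<forall>v\<in>cube_vertices l J. w0 v \<le> n)"
proof -
  have "w0 ` cube_vertices l J \<noteq> {}" using base_vertex by blast
  then show ?thesis unfolding cube_weight_def by (subst Max_le_iff) (auto simp: finite_cube_vertices)
qed

lemma mem_sublevel_iff: "x \<in> S n \<longleftrightarrow> (\<exists>l J. x \<in> closed_cube l J \<and> (\<forall>v\<in>cube_vertices l J. w0 v \<le> n))"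
  unfolding sublevel_def using cube_weight_le_iff by blast

lemma vertex_cube: "cube_vertices l {} = {l}"
  unfolding cube_vertices_def by (auto simp: vec_eq_iff)

lemma vertex_in_sublevel: "w0 l \<le> n \<Longrightarrow> (\<chi> i. real (l $ i)) \<in> S n"
  unfolding mem_sublevel_iff
  by (intro exI[of _ l] exI[of _ "{}"]) (simp add: vertex_cube closed_cube_def)

lemma sublevel_empty_iff: "S n = {} \<longleftrightarrow> (\<forall>l. w0 l > n)"
proof
  assume e: "S n = {}"
  show "\<forall>l. w0 l > n"
  proof
    fix l show "w0 l > n" using vertex_in_sublevel[of l n] e by (cases "w0 l \<le> n") auto
  qed
next
  assume g: "\<forall>l. w0 l > n"
  have False if x: "x \<in> S n" for x
  proof -
    obtain l J where "\<forall>v\<in>cube_vertices l J. w0 v \<le> n" using x mem_sublevel_iff by blast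
    then have "w0 l \<le> n" using base_vertex by blast
    then show False using g[rule_format, of l] by simp
  qed
  then show "S n = {}" by blast
qed

lemma w0_zero: "w0 0 = 0"
  by (simp add: weight0_def hilbert_zero)

lemma w0_unit: "w0 (axis i 1) = 1"
proof -
  have "hilbert_fun p C \<nu> (axis i 1) = 1"
  proof (rule hilbert_one)
    show "axis i 1 $ j \<le> branch_mult j" for j :: 'r using branch_mult_ge_1[of j] by (auto simp: axis_def)
    show "axis i (1::nat) \<noteq> 0" by (auto simp: axis_def vec_eq_iff)
  qed
  moreover have "(\<Sum>j\<in>UNIV. axis i (1::nat) $ j) = 1"
    by (simp add: axis_def if_distrib cong: if_cong)
  ultimately show ?thesis by (simp add: weight0_def)
qed

definition mvec :: "nat^'r" where "mvec = (\<chi> i. branch_mult i)"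

lemma mvec_nonzero: "mvec \<noteq> 0"
proof
  assume "mvec = 0"
  then have "branch_mult i = 0" for i unfolding mvec_def by (simp add: vec_eq_iff)
  then show False using branch_mult_ge_1 by (metis not_one_le_zero)
qed

lemma w0_mvec: "w0 mvec = 2 - int M"
proof -
  have "hilbert_fun p C \<nu> mvec = 1" by (rule hilbert_one[OF _ mvec_nonzero]) (simp add: mvec_def)
  then show ?thesis by (simp add: weight0_def mvec_def M_def)
qed

lemma M_pos: "M \<ge> 1"
proof -
  \<comment> \<open>Picks some branch; the index type is nonempty.\<close>
  obtain i :: 'r where True by simp
  have "branch_mult i \<le> M" unfolding M_def by (rule member_le_sum) auto
  then show ?thesis using branch_mult_ge_1[of i] by linarith
qed

lemma w0_ge:
  assumes "M \<le> 2" shows "w0 l \<ge> 0"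
proof -
  have "(\<Sum>i\<in>UNIV. l $ i) \<le> hilbert_fun p C \<nu> l * M" by (rule hilbert_M_ge)
  also have "\<dots> \<le> hilbert_fun p C \<nu> l * 2" using assms by (rule mult_le_mono2)
  finally show ?thesis unfolding weight0_def by linarith
qed

text \<open>The bound is 2 h(l) - |l| \<ge> |l| - 2 \<delta> \<ge> -2 \<delta>.\<close>

lemma w0_bounded: obtains b where "\<forall>l. b \<le> w0 l"
proof -
  obtain \<delta> where \<delta>: "\<forall>l. (\<Sum>i\<in>UNIV. l $ i) \<le> hilbert_fun p C \<nu> l + \<delta>" by (rule hilbert_ge)
  have "- 2 * int \<delta> \<le> w0 l" for l
  proof -
    have "(\<Sum>i\<in>UNIV. l $ i) \<le> hilbert_fun p C \<nu> l + \<delta>" using \<delta> by blast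
    then show ?thesis unfolding weight0_def by linarith
  qed
  then show thesis using that by blast
qed

text \<open>A least integer exists only for sets bounded below; shifting by the lower bound b of the
  weights reduces the minimum to one over the naturals.\<close>

lemma min_weight_properties: "S (min_weight p C \<nu>) \<noteq> {}" "S n \<noteq> {} \<Longrightarrow> min_weight p C \<nu> \<le> n"
proof -
  obtain b where b: "\<forall>l. b \<le> w0 l" by (rule w0_bounded)
  let ?P = "\<lambda>k. S (b + int k) \<noteq> {}"
  have lb: "b \<le> n" if ne: "S n \<noteq> {}" for n
  proof -
    obtain l where "w0 l \<le> n" using ne sublevel_empty_iff[of n] by (meson not_less)
    then show ?thesis using b order_trans by blast
  qed
  have "S 0 \<noteq> {}" using vertex_in_sublevel[of 0 0] w0_zero by auto
  then have "?P (nat (0 - b))" using lb[of 0] by simp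
  then have P: "?P (LEAST k. ?P k)" by (rule LeastI[where P = ?P])
  have least: "b + int (LEAST k. ?P k) \<le> n" if n: "S n \<noteq> {}" for n
  proof -
    have "?P (nat (n - b))" using n lb[OF n] by simp
    then have "(LEAST k. ?P k) \<le> nat (n - b)" by (rule Least_le)
    then show ?thesis using lb[OF n] by linarith
  qed
  have eq: "min_weight p C \<nu> = b + int (LEAST k. ?P k)"
    unfolding min_weight_def by (rule Least_equality) (rule P, rule least)
  show "S (min_weight p C \<nu>) \<noteq> {}" unfolding eq by (rule P)
  show "S n \<noteq> {} \<Longrightarrow> min_weight p C \<nu> \<le> n" unfolding eq by (rule least)
qed

lemma lattice_cohomology0_trivial_iff: "trivial_group (lattice_cohomology0 p C \<nu> n) \<longleftrightarrow> S n = {}"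
  unfolding lattice_cohomology0_def trivial_cohomology0_iff by simp

lemma negative_part_trivial_iff:
  "(\<forall>n<0. trivial_group (lattice_cohomology0 p C \<nu> n)) \<longleftrightarrow> min_weight p C \<nu> \<ge> 0"
  unfolding lattice_cohomology0_trivial_iff
  using min_weight_properties by (meson not_less order_le_less_trans)

text \<open>One direction tests the vertex \<open>mvec\<close> of weight 2 - M; the other is
  nonnegativity of all weights when M \<le> 2.\<close>

lemma negative_part_trivial_iff_M:
  "(\<forall>n<0. trivial_group (lattice_cohomology0 p C \<nu> n)) \<longleftrightarrow> M \<le> 2"
  unfolding lattice_cohomology0_trivial_iff sublevel_empty_iff
proof
  assume *: "\<forall>n<0. \<forall>l. n < w0 l"
  have "w0 mvec \<ge> 0" using *[rule_format, of "w0 mvec" mvec] by (cases "w0 mvec < 0") auto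
  then show "M \<le> 2" unfolding w0_mvec by simp
next
  assume "M \<le> 2"
  then show "\<forall>n<0. \<forall>l. n < w0 l" using w0_ge by (meson order_less_le_trans)
qed

lemma reduced_trivial_iff:
  "trivial_group (reduced_lattice_cohomology0 p C \<nu>) \<longleftrightarrow>
    (\<forall>n. trivial_group (reduced_cohomology0 (top_of_set (S n))))"
  unfolding reduced_lattice_cohomology0_def
  by (rule trivial_sum_group_iff) (rule group_reduced_cohomology0)

text \<open>For multiplicity at least two the origin is an isolated point of \<open>S\<^sub>0\<close>, since its neighbours
  \<open>e\<^sub>i\<close> have weight 1, while the vertex \<open>(m\<^sub>1, \<dots>, m\<^sub>r)\<close> also belongs to \<open>S\<^sub>0\<close>.\<close>

lemma reduced_nontrivial:
  assumes "M \<ge> 2"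
  shows "\<not> trivial_group (reduced_lattice_cohomology0 p C \<nu>)"
proof -
  have 0: "0 \<in> S 0"
  proof -
    have "(\<chi> i. real ((0::nat^'r) $ i)) = 0" by (simp add: vec_eq_iff)
    then show ?thesis using vertex_in_sublevel[of 0 0] w0_zero by simp
  qed
  \<comment> \<open>A cube in S 0 that meets this open box has base vertex 0, and an edge direction
    i would add the vertex \<open>axis i 1\<close> of weight 1. So only the origin is left.\<close>
  define U :: "(real^'r) set" where "U = {x. \<forall>i. x $ i < 1}"
  have "open U"
  proof -
    have "U = (\<Inter>i. {x. x $ i < 1})" unfolding U_def by blast
    moreover have "open {x::real^'r. x $ i < 1}" for i
      by (intro open_Collect_less continuous_intros)
    ultimately show ?thesis by (auto intro!: open_INT)
  qed
  moreover have "S 0 \<inter> U = {0}"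
  proof (intro subset_antisym subsetI)
    fix x assume x: "x \<in> S 0 \<inter> U"
    then obtain l J where lJ: "x \<in> closed_cube l J" "\<forall>v\<in>cube_vertices l J. w0 v \<le> 0"
      using mem_sublevel_iff by blast
    have l: "l = 0"
    proof -
      have "l $ i = 0" for i
      proof -
        have "real (l $ i) \<le> x $ i" "x $ i < 1" using lJ(1) x unfolding closed_cube_def U_def by auto
        then show ?thesis by linarith
      qed
      then show ?thesis by (simp add: vec_eq_iff)
    qed
    have "i \<notin> J" for i
    proof
      assume "i \<in> J"
      then have "axis i 1 \<in> cube_vertices l J"
        unfolding cube_vertices_def l by (auto intro!: exI[of _ "{i}"] simp: vec_eq_iff axis_def)
      then have "w0 (axis i 1) \<le> 0" using lJ(2) by blast
      then show False unfolding w0_unit by simp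
    qed
    then have "x $ i = 0" for i using lJ(1) unfolding closed_cube_def l by (simp add: order_antisym)
    then show "x \<in> {0}" by (simp add: vec_eq_iff)
  qed (use 0 in \<open>auto simp: U_def\<close>)
  ultimately have o: "openin (top_of_set (S 0)) {0}" by (metis openin_open)
  have c: "closedin (top_of_set (S 0)) {0}" using 0 by (auto simp: closedin_closed intro!: exI[of _ "{0}"])
  define x where "x = (\<chi> i. real (mvec $ i))"
  have "x \<in> S 0" unfolding x_def by (rule vertex_in_sublevel) (use assms w0_mvec in simp)
  moreover have "x \<noteq> 0"
  proof
    assume "x = 0"
    then have "mvec = 0" unfolding x_def by (simp add: vec_eq_iff)
    then show False using mvec_nonzero by simp
  qed
  ultimately have "\<not> trivial_group (reduced_cohomology0 (top_of_set (S 0)))"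
    using nontrivial_reduced_isolated[OF o c, of x] by simp
  then show ?thesis using reduced_trivial_iff by blast
qed

lemma M_eq_1_single_branch:
  fixes i j :: 'r
  assumes "M = 1" shows "i = j"
proof (rule ccontr)
  assume "i \<noteq> j"
  have "(\<Sum>k\<in>{i, j}. branch_mult k) \<le> M" unfolding M_def by (rule sum_mono2) auto
  then show False using \<open>i \<noteq> j\<close> branch_mult_ge_1[of i] branch_mult_ge_1[of j] assms by simp
qed

text \<open>For M = 1 the bounds h(l) \<le> |l| and |l| \<le> h(l) M coincide. Hence the weight of l
  is l itself on the single branch, and S n is the segment from 0 to n, convex and possibly
  empty.\<close>

lemma reduced_trivial:
  assumes "M = 1"
  shows "trivial_group (reduced_lattice_cohomology0 p C \<nu>)"
  unfolding reduced_trivial_iff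
proof
  fix n
  obtain i :: 'r where True by simp
  have U: "UNIV = {i}" using M_eq_1_single_branch[OF assms] by blast
  have h: "w0 l = int (l $ i)" for l
  proof -
    have s: "(\<Sum>i\<in>UNIV. l $ i) = l $ i" unfolding U by simp
    have "hilbert_fun p C \<nu> l = l $ i" using hilbert_le[of l] hilbert_M_ge[of l] s assms by simp
    then show ?thesis unfolding weight0_def s by simp
  qed
  have Sn: "S n = {x. 0 \<le> x $ i \<and> x $ i \<le> of_int n}"
  proof (intro subset_antisym subsetI)
    fix x assume "x \<in> S n"
    then obtain l J where lJ: "x \<in> closed_cube l J" "\<forall>v\<in>cube_vertices l J. w0 v \<le> n"
      using mem_sublevel_iff by blast
    let ?v = "\<chi> k. l $ k + (if k \<in> J then 1 else 0)"
    have "?v \<in> cube_vertices l J" unfolding cube_vertices_def by blast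
    then have "w0 ?v \<le> n" using lJ(2) by blast
    then have "int (l $ i + (if i \<in> J then 1 else 0)) \<le> n" unfolding h by simp
    then have b: "real (l $ i) + (if i \<in> J then 1 else 0) \<le> of_int n" by (simp split: if_splits)
    have "real (l $ i) \<le> x $ i" "x $ i \<le> real (l $ i) + (if i \<in> J then 1 else 0)"
      using lJ(1) unfolding closed_cube_def by blast+
    then have "0 \<le> x $ i" "x $ i \<le> of_int n" using b by linarith+
    then show "x \<in> {x. 0 \<le> x $ i \<and> x $ i \<le> of_int n}" by simp
  next
    fix x :: "real^'r" assume "x \<in> {x. 0 \<le> x $ i \<and> x $ i \<le> of_int n}"
    then have x: "0 \<le> x $ i" "x $ i \<le> of_int n" by auto
    define l :: "nat^'r" where "l = (\<chi> k. nat \<lfloor>x $ i\<rfloor>)"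
    \<comment> \<open>At an integral point the cube is the vertex alone: the unit segment starting
      at n would have weight n + 1.\<close>
    define J :: "'r set" where "J = (if x $ i = of_int \<lfloor>x $ i\<rfloor> then {} else {i})"
    have li: "real (l $ i) = of_int \<lfloor>x $ i\<rfloor>" unfolding l_def using x by simp
    have b1: "real (l $ i) \<le> x $ i" unfolding li by simp
    have b2: "x $ i \<le> real (l $ i) + (if i \<in> J then 1 else 0)"
    proof (cases "x $ i = of_int \<lfloor>x $ i\<rfloor>")
      case True
      then show ?thesis unfolding li by (simp add: J_def)
    next
      case False
      then have "i \<in> J" unfolding J_def by simp
      then show ?thesis unfolding li using real_of_int_floor_add_one_ge[of "x $ i"] by simp
    qed
    have "x \<in> closed_cube l J"
      unfolding closed_cube_def mem_Collect_eq
    proof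
      fix k
      have "k = i" by (rule M_eq_1_single_branch[OF assms])
      then show "real (l $ k) \<le> x $ k \<and> x $ k \<le> real (l $ k) + (if k \<in> J then 1 else 0)"
        using b1 b2 by simp
    qed
    moreover have "w0 v \<le> n" if v: "v \<in> cube_vertices l J" for v
    proof -
      obtain K where K: "K \<subseteq> J" "v = (\<chi> k. l $ k + (if k \<in> K then 1 else 0))"
        using v unfolding cube_vertices_def by blast
      show ?thesis
      proof (cases "x $ i = of_int \<lfloor>x $ i\<rfloor>")
        case True
        then have "v $ i = l $ i" using K unfolding J_def by auto
        then have "real (v $ i) \<le> of_int n" using x li True by simp
        then show ?thesis unfolding h by linarith
      next
        case False
        then have "x $ i > of_int \<lfloor>x $ i\<rfloor>" by (metis of_int_floor_le order_le_less)
        then have "of_int \<lfloor>x $ i\<rfloor> < (of_int n :: real)" using x by linarith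
        then have "\<lfloor>x $ i\<rfloor> + 1 \<le> n" by simp
        then have "real (l $ i) + 1 \<le> of_int n" unfolding li by linarith
        moreover have "v $ i \<le> l $ i + 1" using K by auto
        ultimately have "real (v $ i) \<le> of_int n" by linarith
        then show ?thesis unfolding h by linarith
      qed
    qed
    ultimately show "x \<in> S n" unfolding mem_sublevel_iff by blast
  qed
  have "convex (S n)" unfolding Sn
  proof (rule convexI)
    fix x y :: "real^'r" and u v :: real
    assume *: "x \<in> {x. 0 \<le> x $ i \<and> x $ i \<le> of_int n}" "y \<in> {x. 0 \<le> x $ i \<and> x $ i \<le> of_int n}" "0 \<le> u" "0 \<le> v" "u + v = 1"
    then have "u * x $ i + v * y $ i \<le> u * of_int n + v * of_int n"
      by (intro add_mono mult_left_mono) auto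
    also have "\<dots> = of_int n" using * by (simp flip: distrib_right)
    finally show "u *\<^sub>R x + v *\<^sub>R y \<in> {x. 0 \<le> x $ i \<and> x $ i \<le> of_int n}" using * by simp
  qed
  then have "path_connected (S n)" by (rule convex_imp_path_connected)
  then have "path_connected_space (top_of_set (S n))" by simp
  then show "trivial_group (reduced_cohomology0 (top_of_set (S n)))" by (rule trivial_reduced_path_connected)
qed

lemma reduced_trivial_iff_M: "trivial_group (reduced_lattice_cohomology0 p C \<nu>) \<longleftrightarrow> M = 1"
  using reduced_trivial reduced_nontrivial M_pos by (metis One_nat_def Suc_1 le_antisym not_less_eq_eq)

end

subsection \<open>Smooth germs and double points\<close>

lemma expansion_eval:
  assumes "fps_conv_radius (F :: complex fps) > 0"
  obtains f where "f analytic_on {0}" "f has_fps_expansion F" "f 0 = fps_nth F 0"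
  using has_fps_expansion_imp_analytic_0 eval_fps_has_fps_expansion[OF assms]
    has_fps_expansion_imp_0_eq_fps_nth_0 by metis

lemma eventually_eq_expansion:
  assumes "f has_fps_expansion F" "g has_fps_expansion F"
  shows "\<forall>\<^sub>F t in nhds (0::complex). f t = (g t :: complex)"
  using has_fps_expansion_diff[OF assms] by (simp add: has_fps_expansion_0_iff)

context curve
begin

lemma coordinate_germ: "holomorphic_germ p (\<lambda>z. z $ j - p $ j)"
  by (intro holomorphic_germ_diff) auto

lemma single_branch:
  fixes i :: 'r
  assumes "\<And>i j :: 'r. i = j"
  shows "M = branch_mult i"
proof -
  have "UNIV = {i}" using assms by blast
  then show ?thesis unfolding M_def by (metis sum.empty sum.insert finite.emptyI empty_iff add.right_neutral)
qed

text \<open>Substituting h undoes the change of parameter \<psi>.\<close>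

lemma germ_pulls_back_via_reparametrization:
  assumes "\<forall>\<^sub>F s in nhds 0. f (\<nu> i (\<psi> s)) = 0" "h analytic_on {0}" "h 0 = 0"
    "\<forall>\<^sub>F t in nhds 0. \<psi> (h t) = t" "holomorphic_germ p f"
  shows "T f i = 0"
proof -
  have "\<forall>\<^sub>F t in nhds 0. f (\<nu> i (\<psi> (h t))) = 0"
    by (rule eventually_compose_filterlim[OF assms(1) filterlim_analytic_0[OF assms(2,3)]])
  then have "\<forall>\<^sub>F t in nhds 0. f (\<nu> i t) = 0" using assms(4) by eventually_elim simp
  then show ?thesis using T_zero_iff[OF assms(5)] by blast
qed

text \<open>Let f be the coordinate of an isomorphism with the line. Its inverse recovers \<nu> i
  from f \<circ> \<nu> i, which is therefore injective, hence regular at 0, so each branch has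
  multiplicity 1. With f as common parameter all branches coincide.\<close>

lemma smooth_imp_M:
  assumes "smooth_curve_germ p C" shows "M = 1"
proof -
  obtain F G where F: "holomorphic_map_germ p F" "F p = (0::complex^1)"
    and GF: "\<forall>\<^sub>F z in nhds p. z \<in> C \<longrightarrow> F z \<in> UNIV \<and> G (F z) = z"
    using assms unfolding smooth_curve_germ_def germ_isomorphic_def by blast
  define f where "f = (\<lambda>z. F z $ 1)"
  have f: "holomorphic_germ p f" "f p = 0" using F unfolding f_def holomorphic_map_germ_def by auto
  define g where "g = (\<lambda>y::complex. G (\<chi> k. y))"
  have Ff: "F z = (\<chi> k. f z)" for z unfolding f_def by (simp add: vec_eq_iff)
  have gf: "\<forall>\<^sub>F t in nhds 0. g (f (\<nu> i t)) = \<nu> i t" for i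
    using GF vanish_iff[of "\<lambda>z. F z \<in> UNIV \<and> G (F z) = z"] unfolding g_def Ff by simp
  have an: "(\<lambda>t. f (\<nu> i t)) analytic_on {0}" for i
    using has_fps_expansion_imp_analytic_0[OF T_expansion[OF f(1)]] .
  have d: "deriv (\<lambda>t. f (\<nu> i t)) 0 \<noteq> 0" for i
  proof -
    obtain \<epsilon> where \<epsilon>: "\<epsilon> > 0" "inj_on (\<nu> i) (ball 0 \<epsilon>)" by (rule nu_inj)
    obtain \<delta> where \<delta>: "\<delta> > 0" "\<And>t. dist t 0 < \<delta> \<Longrightarrow> g (f (\<nu> i t)) = \<nu> i t"
      using gf[of i] unfolding eventually_nhds_metric by blast
    obtain S where S: "open S" "0 \<in> S" "(\<lambda>t. f (\<nu> i t)) holomorphic_on S" using an[of i] unfolding analytic_at by blast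
    obtain \<eta> where \<eta>: "\<eta> > 0" "ball 0 \<eta> \<subseteq> S" using S(1,2) open_contains_ball by blast
    define e where "e = min (min \<delta> \<epsilon>) \<eta>"
    have e: "e > 0" "ball 0 e \<subseteq> ball (0::complex) \<epsilon>" "ball 0 e \<subseteq> S" "e \<le> \<delta>"
      using \<epsilon> \<delta> \<eta> unfolding e_def by auto
    have "inj_on (\<lambda>t. f (\<nu> i t)) (ball 0 e)"
    proof (rule inj_onI)
      fix a b assume *: "a \<in> ball 0 e" "b \<in> ball 0 e" "f (\<nu> i a) = f (\<nu> i b)"
      have "\<nu> i a = g (f (\<nu> i a))" using \<delta>(2)[of a] * e(4) by (simp add: dist_commute)
      also have "\<dots> = \<nu> i b" unfolding *(3) using \<delta>(2)[of b] * e(4) by (simp add: dist_commute)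
      finally show "a = b" using inj_onD[OF \<epsilon>(2)] * e(2) by blast
    qed
    moreover have "(\<lambda>t. f (\<nu> i t)) holomorphic_on ball 0 e" using S(3) e(3) holomorphic_on_subset by blast
    ultimately show ?thesis using holomorphic_injective_imp_regular[of _ "ball 0 e" 0] e(1) by auto
  qed
  have mm1: "branch_mult i = 1" for i
  proof -
    have "fps_nth (T f i) 1 = deriv (\<lambda>t. f (\<nu> i t)) 0" unfolding T_def fps_expansion_def by (simp add: comp_def)
    then have "\<not> ordge 2 (T f i)" using d[of i] unfolding ordge_def by (metis one_less_numeral_iff semiring_norm(76))
    then have "branch_mult i < 2" using ordge_branch_mult[OF f, of i] ordge_mono by (meson not_less)
    then show ?thesis using branch_mult_ge_1[of i] by linarith
  qed
  have "i = j" for i j :: 'r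
  proof (rule ccontr)
    assume ij: "i \<noteq> j"
    obtain f' where f': "holomorphic_germ p f'" "T f' j = 0" "T f' i \<noteq> 0" using separate_branches[OF ij] by blast
    have z: "f (\<nu> k 0) = 0" for k using f by simp
    \<comment> \<open>Parametrized by the value s of f, both branches are s \<mapsto> g s, so an
      equation of branch j vanishes on branch i as well.\<close>
    obtain \<psi> where \<psi>: "\<psi> analytic_on {0}" "\<psi> 0 = 0" "\<forall>\<^sub>F s in nhds 0. f (\<nu> i (\<psi> s)) = s" "\<forall>\<^sub>F t in nhds 0. \<psi> (f (\<nu> i t)) = t"
      by (rule analytic_local_inverse[OF an[of i] z d])
    obtain \<phi> where \<phi>: "\<phi> analytic_on {0}" "\<phi> 0 = 0" "\<forall>\<^sub>F s in nhds 0. f (\<nu> j (\<phi> s)) = s" "\<forall>\<^sub>F t in nhds 0. \<phi> (f (\<nu> j t)) = t"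
      by (rule analytic_local_inverse[OF an[of j] z d])
    have 1: "\<forall>\<^sub>F s in nhds 0. g (f (\<nu> i (\<psi> s))) = \<nu> i (\<psi> s)"
      by (rule eventually_compose_filterlim[OF gf filterlim_analytic_0[OF \<psi>(1,2)]])
    have 2: "\<forall>\<^sub>F s in nhds 0. g (f (\<nu> j (\<phi> s))) = \<nu> j (\<phi> s)"
      by (rule eventually_compose_filterlim[OF gf filterlim_analytic_0[OF \<phi>(1,2)]])
    have "\<forall>\<^sub>F t in nhds 0. f' (\<nu> j t) = 0" using f' T_zero_iff by blast
    from eventually_compose_filterlim[OF this filterlim_analytic_0[OF \<phi>(1,2)]] 1 2 \<psi>(3) \<phi>(3)
    have "\<forall>\<^sub>F s in nhds 0. f' (\<nu> i (\<psi> s)) = 0" by eventually_elim simp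
    then have "T f' i = 0"
      by (rule germ_pulls_back_via_reparametrization[OF _ an[of i] z \<psi>(4) f'(1)])
    then show False using f' by blast
  qed
  then show ?thesis using single_branch mm1 by metis
qed

lemma reparametrize_branch:
  assumes x: "holomorphic_germ p x" and T: "T x i \<noteq> 0" "subdegree (T x i) = branch_mult i"
  obtains h \<psi> where "h analytic_on {0}" "h 0 = 0" "\<psi> analytic_on {0}" "\<psi> 0 = 0"
    "\<forall>\<^sub>F t in nhds 0. \<psi> (h t) = t" "\<forall>\<^sub>F s in nhds 0. x (\<nu> i (\<psi> s)) = s ^ branch_mult i"
    "\<forall>\<^sub>F s in nhds 0. h (\<psi> s) = s"
proof -
  obtain h \<psi> where *: "h analytic_on {0}" "h 0 = 0" "\<psi> analytic_on {0}" "\<psi> 0 = 0"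
    "\<forall>\<^sub>F s in nhds 0. h (\<psi> s) = s" "\<forall>\<^sub>F t in nhds 0. \<psi> (h t) = t"
    "\<forall>\<^sub>F s in nhds 0. x (\<nu> i (\<psi> s)) = s ^ branch_mult i"
    by (rule reparametrize[where x = x and \<gamma> = "\<nu> i", OF T_expansion[OF x] T branch_mult_ge_1])
  show thesis by (rule that[OF *(1-4,6,7,5)])
qed

text \<open>On the only branch x has order 1 and serves as the coordinate; the inverse isomorphism
  is the branch parametrized by x.\<close>

lemma M_imp_smooth:
  assumes "M = 1" shows "smooth_curve_germ p C"
proof -
  have ij: "i = j" for i j :: 'r by (rule M_eq_1_single_branch[OF assms])
  obtain i :: 'r where True by simp
  have mm1: "branch_mult i = 1" using single_branch[OF ij, of i] assms by simp
  obtain x where x: "holomorphic_germ p x" "x p = 0" and Tm: "\<forall>i. T x i \<noteq> 0 \<and> subdegree (T x i) = branch_mult i"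
    by (rule generic_coordinate)
  have Tx: "T x i \<noteq> 0" "subdegree (T x i) = branch_mult i" using Tm by blast+
  obtain h \<psi> where h: "h analytic_on {0}" "h 0 = 0" and \<psi>: "\<psi> analytic_on {0}" "\<psi> 0 = 0"
    and \<psi>h: "\<forall>\<^sub>F t in nhds 0. \<psi> (h t) = t" and xs: "\<forall>\<^sub>F s in nhds 0. x (\<nu> i (\<psi> s)) = s ^ branch_mult i"
    and "\<forall>\<^sub>F s in nhds 0. h (\<psi> s) = s"
    by (rule reparametrize_branch[OF x(1) Tx])
  have "\<forall>\<^sub>F t in nhds 0. x (\<nu> i (\<psi> (h t))) = h t ^ branch_mult i"
    by (rule eventually_compose_filterlim[OF xs filterlim_analytic_0[OF h]])
  with \<psi>h have \<psi>x: "\<forall>\<^sub>F t in nhds 0. \<psi> (x (\<nu> i t)) = t" by eventually_elim (simp add: mm1)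
  define F :: "complex^'n \<Rightarrow> complex^1" where "F = (\<lambda>z. \<chi> k. x z)"
  define G :: "complex^1 \<Rightarrow> complex^'n" where "G = (\<lambda>y. \<nu> i (\<psi> (y $ 1)))"
  show ?thesis
    unfolding smooth_curve_germ_def germ_isomorphic_def
  proof (intro exI[of _ F] exI[of _ G] conjI)
    show "holomorphic_map_germ p F" unfolding holomorphic_map_germ_def F_def using x by simp
    show "holomorphic_map_germ 0 G"
      unfolding holomorphic_map_germ_def
    proof
      fix j
      have "(\<lambda>s. \<nu> i (\<psi> s) $ j) analytic_on {0}"
        using analytic_curve_compose[OF nu_analytic \<psi>] unfolding analytic_curve_def by blast
      then show "holomorphic_germ 0 (\<lambda>y. G y $ j)"
        unfolding G_def by (intro holomorphic_germ_compose[where \<phi> = "\<lambda>s. \<nu> i (\<psi> s) $ j"]) auto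
    qed
    show "F p = 0" using x by (simp add: F_def vec_eq_iff)
    show "G 0 = p" using \<psi> by (simp add: G_def)
    have "\<forall>\<^sub>F t in nhds 0. G (F (\<nu> k t)) = \<nu> k t" for k
      using \<psi>x unfolding ij[of k i] by eventually_elim (simp add: F_def G_def)
    then show "\<forall>\<^sub>F z in nhds p. z \<in> C \<longrightarrow> F z \<in> UNIV \<and> G (F z) = z"
      using vanish_iff[of "\<lambda>z. G (F z) = z"] by simp
    have "\<forall>\<^sub>F s in nhds 0. \<nu> i (\<psi> s) \<in> C"
      by (rule eventually_compose_filterlim[OF nu_in_C filterlim_analytic_0[OF \<psi>]])
    with xs have ev: "\<forall>\<^sub>F s in nhds 0. \<nu> i (\<psi> s) \<in> C \<and> x (\<nu> i (\<psi> s)) = s"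
      by eventually_elim (simp add: mm1)
    have "filterlim (\<lambda>y::complex^1. y $ 1) (nhds 0) (nhds 0)"
      using tendsto_nhds_isCont[OF holomorphic_germ_continuous[OF holomorphic_germ_nth[of 0 1]]] by simp
    from eventually_compose_filterlim[OF ev this]
    show "\<forall>\<^sub>F y in nhds 0. y \<in> UNIV \<longrightarrow> G y \<in> C \<and> F (G y) = y"
      by eventually_elim (simp add: F_def G_def vec_eq_iff forall_1)
  qed
qed

text \<open>If every coordinate has the form \<open>a\<^sub>j(y) - \<i> w b\<^sub>j(y)\<close> in terms of functions \<open>w, y\<close> on the curve
  and \<open>b\<^sub>j\<close> is a unit for one \<open>j\<close>, then this coordinate can be solved for \<open>w\<close>.\<close>

lemma plane_embedding:
  fixes \<delta> :: "'r \<Rightarrow> complex \<Rightarrow> complex^2" and D :: "(complex^2) set"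
  assumes x: "holomorphic_germ p x" "x p = 0"
    and \<psi>: "\<And>i. \<psi> i analytic_on {0}" "\<And>i. \<psi> i 0 = 0"
    and h: "\<And>i. h i analytic_on {0}" "\<And>i. h i 0 = 0" "\<And>i. \<forall>\<^sub>F t in nhds 0. \<psi> i (h i t) = t"
    and \<delta>: "\<And>i. analytic_curve (\<delta> i)" "\<And>i. \<delta> i 0 = 0" "\<And>i s. \<delta> i s \<in> D"
    and cover: "\<And>P. (\<And>i. \<forall>\<^sub>F s in nhds 0. P i s) \<Longrightarrow> \<forall>\<^sub>F v in nhds 0. v \<in> D \<longrightarrow> (\<exists>i s. P i s \<and> \<delta> i s = v)"
    and ab: "\<And>j. a j analytic_on {0}" "\<And>j. b j analytic_on {0}" "b j0 0 \<noteq> 0"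
    and coord: "\<And>i j. \<forall>\<^sub>F s in nhds 0. \<nu> i (\<psi> i s) $ j = a j (\<delta> i s $ 2) - \<i> * \<delta> i s $ 1 * b j (\<delta> i s $ 2)"
    and xd: "\<And>i. \<forall>\<^sub>F s in nhds 0. x (\<nu> i (\<psi> i s)) = \<delta> i s $ 2"
  shows "germ_isomorphic p C 0 D"
proof -
  \<comment> \<open>The plane coordinates are w and y. G evaluates the coordinate formulas, and F
    recovers w from coordinate j0: z = a - \<i> w b gives w = \<i> (z - a) / b.\<close>
  define G :: "complex^2 \<Rightarrow> complex^'n" where "G = (\<lambda>v. \<chi> j. a j (v $ 2) - \<i> * v $ 1 * b j (v $ 2))"
  define F :: "complex^'n \<Rightarrow> complex^2"
    where "F = (\<lambda>z. vector [\<i> * (z $ j0 - a j0 (x z)) * inverse (b j0 (x z)), x z])"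
  have F12: "F z $ 1 = \<i> * (z $ j0 - a j0 (x z)) * inverse (b j0 (x z))" "F z $ 2 = x z" for z
    unfolding F_def by simp_all
  obtain i :: 'r where True by simp
  have G0: "G 0 = p"
  proof -
    have "p $ j = a j 0" for j
      using eventually_nhds_x_imp_x[OF coord[of i j]] \<psi>(2)[of i] \<delta>(2)[of i] by simp
    then show ?thesis unfolding G_def by (simp add: vec_eq_iff)
  qed
  have a0: "a j0 0 = p $ j0" using arg_cong[OF G0, of "\<lambda>v. v $ j0"] unfolding G_def by simp
  have G\<delta>: "\<forall>\<^sub>F s in nhds 0. G (\<delta> i s) = \<nu> i (\<psi> i s)" for i
  proof -
    have "\<forall>\<^sub>F s in nhds 0. \<forall>j. \<nu> i (\<psi> i s) $ j = a j (\<delta> i s $ 2) - \<i> * \<delta> i s $ 1 * b j (\<delta> i s $ 2)"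
      by (intro eventually_all_finite coord)
    then show ?thesis by eventually_elim (simp add: G_def vec_eq_iff)
  qed
  have C\<psi>: "\<forall>\<^sub>F s in nhds 0. \<nu> i (\<psi> i s) \<in> C" for i
    by (rule eventually_compose_filterlim[OF nu_in_C filterlim_analytic_0[OF \<psi>]])
  have "(b j0 \<longlongrightarrow> b j0 0) (nhds 0)"
    by (rule tendsto_nhds_isCont[OF analytic_at_imp_isCont[OF ab(2)]])
  then have "\<forall>\<^sub>F y in nhds 0. b j0 y \<noteq> 0" by (rule tendsto_imp_eventually_ne) (rule ab(3))
  moreover have "filterlim (\<lambda>v::complex^2. v $ 2) (nhds 0) (nhds 0)"
    using tendsto_nhds_isCont[OF holomorphic_germ_continuous[OF holomorphic_germ_nth[of 0 2]]] by simp
  ultimately have bne: "\<forall>\<^sub>F v in nhds (0::complex^2). b j0 (v $ 2) \<noteq> 0"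
    by (rule eventually_compose_filterlim)
  have "\<forall>\<^sub>F s in nhds 0. G (\<delta> i s) \<in> C \<and> x (G (\<delta> i s)) = \<delta> i s $ 2" for i
    using G\<delta>[of i] C\<psi>[of i] xd[of i] by eventually_elim simp
  \<comment> \<open>\<open>cover\<close> turns a statement along the parametrizations \<delta> i
    into one about all points of D near 0.\<close>
  from cover[where P = "\<lambda>i s. G (\<delta> i s) \<in> C \<and> x (G (\<delta> i s)) = \<delta> i s $ 2", OF this] bne
  have D1: "\<forall>\<^sub>F v in nhds 0. v \<in> D \<longrightarrow> G v \<in> C \<and> F (G v) = v"
  proof eventually_elim
    case (elim v)
    show ?case
    proof
      assume "v \<in> D"
      then have v: "G v \<in> C" "x (G v) = v $ 2" using elim by blast+
      have "F (G v) $ 1 = - (\<i> * \<i>) * v $ 1 * (b j0 (v $ 2) * inverse (b j0 (v $ 2)))"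
        unfolding F12 v(2) by (simp add: G_def mult.assoc)
      also have "\<dots> = v $ 1" using elim(2) by simp
      finally have "F (G v) $ 1 = v $ 1" .
      then show "G v \<in> C \<and> F (G v) = v" using v F12(2) by (simp add: vec_eq_iff forall_2)
    qed
  qed
  have D2: "\<forall>\<^sub>F z in nhds p. z \<in> C \<longrightarrow> F z \<in> D \<and> G (F z) = z"
  proof -
    have "\<forall>\<^sub>F t in nhds 0. F (\<nu> i t) \<in> D \<and> G (F (\<nu> i t)) = \<nu> i t" for i
    proof -
      have "\<forall>\<^sub>F s in nhds 0. \<delta> i s \<in> D \<longrightarrow> G (\<delta> i s) \<in> C \<and> F (G (\<delta> i s)) = \<delta> i s"
        using eventually_curve[OF \<delta>(1), where P = "\<lambda>v. v \<in> D \<longrightarrow> G v \<in> C \<and> F (G v) = v"] D1 \<delta>(2) by simp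
      with G\<delta>[of i] have "\<forall>\<^sub>F s in nhds 0. F (\<nu> i (\<psi> i s)) \<in> D \<and> G (F (\<nu> i (\<psi> i s))) = \<nu> i (\<psi> i s)"
        by eventually_elim (use \<delta>(3) in metis)
      from eventually_compose_filterlim[OF this filterlim_analytic_0[OF h(1)[of i] h(2)]] h(3)[of i]
      show ?thesis by eventually_elim simp
    qed
    then show ?thesis using vanish_iff[of "\<lambda>z. F z \<in> D \<and> G (F z) = z"] by blast
  qed
  have hF: "holomorphic_map_germ p F"
    unfolding holomorphic_map_germ_def forall_2 F12
  proof
    have "(\<lambda>s. inverse (b j0 s)) analytic_on {0}" using ab by (intro analytic_intros) auto
    then show "holomorphic_germ p (\<lambda>z. \<i> * (z $ j0 - a j0 (x z)) * inverse (b j0 (x z)))"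
      using x ab(1) holomorphic_germ_compose[OF x(1), of "\<lambda>s. inverse (b j0 s)"]
      by (intro holomorphic_germ_mult holomorphic_germ_diff holomorphic_germ_const holomorphic_germ_nth
            holomorphic_germ_compose[OF x(1), of "a j0"]) auto
    show "holomorphic_germ p x" using x by simp
  qed
  have hG: "holomorphic_map_germ 0 G"
    unfolding holomorphic_map_germ_def
  proof
    fix j
    have "holomorphic_germ (0::complex^2) (\<lambda>v. a j (v $ 2))"
      by (rule holomorphic_germ_compose[where \<phi> = "a j", OF holomorphic_germ_nth]) (simp add: ab)
    moreover have "holomorphic_germ (0::complex^2) (\<lambda>v. b j (v $ 2))"
      by (rule holomorphic_germ_compose[where \<phi> = "b j", OF holomorphic_germ_nth]) (simp add: ab)
    ultimately show "holomorphic_germ 0 (\<lambda>v. G v $ j)"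
      unfolding G_def vec_lambda_beta
      by (intro holomorphic_germ_diff holomorphic_germ_mult[OF holomorphic_germ_mult]
            holomorphic_germ_const holomorphic_germ_nth)
  qed
  have "F p = 0" using x a0 by (simp add: vec_eq_iff forall_2 F12)
  then show ?thesis unfolding germ_isomorphic_def using hF hG G0 D1 D2 by blast
qed

text \<open>In the parameter with y = s^2 the involution s \<mapsto> -s splits every coordinate into
  an even part a(y) and an odd part s^k b(y), with k the least order of the odd parts. The curve s
  \<mapsto> (\<i> s^k, s^2) satisfies w^2 + y^k = 0.\<close>

lemma double_point_unibranch:
  assumes one: "\<And>i j :: 'r. i = j" and M2: "M = 2"
  shows "\<exists>k\<ge>2. germ_isomorphic p C (0 :: complex^2) {v. (v $ 1)\<^sup>2 + (v $ 2) ^ k = 0}"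
proof -
  obtain i :: 'r where True by simp
  have mm2: "branch_mult i = 2" using single_branch[OF one, of i] M2 by simp
  obtain x where x: "holomorphic_germ p x" "x p = 0" and Tm: "\<forall>i. T x i \<noteq> 0 \<and> subdegree (T x i) = branch_mult i"
    by (rule generic_coordinate)
  have Tx: "T x i \<noteq> 0" "subdegree (T x i) = branch_mult i" using Tm by blast+
  obtain h \<psi> where h: "h analytic_on {0}" "h 0 = 0" and \<psi>: "\<psi> analytic_on {0}" "\<psi> 0 = 0"
    and \<psi>h: "\<forall>\<^sub>F t in nhds 0. \<psi> (h t) = t" and xs: "\<forall>\<^sub>F s in nhds 0. x (\<nu> i (\<psi> s)) = s ^ branch_mult i"
    and h\<psi>: "\<forall>\<^sub>F s in nhds 0. h (\<psi> s) = s"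
    by (rule reparametrize_branch[OF x(1) Tx])
  define \<Gamma> where "\<Gamma> = (\<lambda>j. fps_expansion (\<lambda>s. \<nu> i (\<psi> s) $ j) 0)"
  have \<Gamma>: "(\<lambda>s. \<nu> i (\<psi> s) $ j) has_fps_expansion \<Gamma> j" for j
    using analytic_curve_compose[OF nu_analytic \<psi>] unfolding \<Gamma>_def analytic_curve_def
    by (intro analytic_at_imp_has_fps_expansion_0) auto
  define E where "E = (\<lambda>j. fps_const (1/2) * (\<Gamma> j + rot (-1) (\<Gamma> j)))"
  define O' where "O' = (\<lambda>j. fps_const (1/2) * (\<Gamma> j - rot (-1) (\<Gamma> j)))"
  have E_nth: "fps_nth (E j) n = (if even n then fps_nth (\<Gamma> j) n else 0)" for j n
    by (simp add: E_def rot_def)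
  have O_nth: "fps_nth (O' j) n = (if odd n then fps_nth (\<Gamma> j) n else 0)" for j n
    by (simp add: O'_def rot_def)
  have \<Gamma>EO: "\<Gamma> j = E j + O' j" for j by (rule fps_ext) (simp add: E_nth O_nth)
  have Ee: "(\<lambda>s. 1/2 * (\<nu> i (\<psi> s) $ j + \<nu> i (\<psi> (-1 * s)) $ j)) has_fps_expansion E j" for j
    unfolding E_def by (intro has_fps_expansion_cmult_left has_fps_expansion_add \<Gamma> rot_expansion[OF \<Gamma>])
  have Oe: "(\<lambda>s. 1/2 * (\<nu> i (\<psi> s) $ j - \<nu> i (\<psi> (-1 * s)) $ j)) has_fps_expansion O' j" for j
    unfolding O'_def by (intro has_fps_expansion_cmult_left has_fps_expansion_diff \<Gamma> rot_expansion[OF \<Gamma>])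
  \<comment> \<open>If all odd parts were zero, \<nu> i \<circ> \<psi> would be even, against its
    injectivity near 0.\<close>
  have ex: "\<exists>n j. fps_nth (O' j) n \<noteq> 0"
  proof (rule ccontr)
    assume "\<not> (\<exists>n j. fps_nth (O' j) n \<noteq> 0)"
    then have "O' j = 0" for j by (simp add: fps_eq_iff)
    then have "\<forall>\<^sub>F s in nhds 0. 1/2 * (\<nu> i (\<psi> s) $ j - \<nu> i (\<psi> (-1 * s)) $ j) = 0" for j
      using Oe[of j] by (simp add: has_fps_expansion_0_iff)
    then have "\<forall>\<^sub>F s in nhds 0. \<forall>j. 1/2 * (\<nu> i (\<psi> s) $ j - \<nu> i (\<psi> (-1 * s)) $ j) = 0"
      by (intro eventually_all_finite)
    then have e1: "\<forall>\<^sub>F s in nhds 0. \<nu> i (\<psi> s) = \<nu> i (\<psi> (- s))" by eventually_elim (simp add: vec_eq_iff)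
    obtain \<epsilon> where \<epsilon>: "\<epsilon> > 0" "inj_on (\<nu> i) (ball 0 \<epsilon>)" by (rule nu_inj)
    have "\<forall>\<^sub>F t in nhds (0::complex). t \<in> ball 0 \<epsilon>" by (rule eventually_nhds_in_open) (use \<epsilon> in auto)
    from eventually_compose_filterlim[OF this filterlim_analytic_0[OF \<psi>]] h\<psi>
    have e2: "\<forall>\<^sub>F s in nhds 0. \<psi> s \<in> ball 0 \<epsilon> \<and> h (\<psi> s) = s" by eventually_elim simp
    have "filterlim uminus (nhds (0::complex)) (nhds 0)"
      using tendsto_nhds_isCont[of 0 "uminus :: complex \<Rightarrow> complex"] by simp
    from eventually_compose_filterlim[OF e2 this] e1 e2
    have "\<forall>\<^sub>F s in nhds 0. s = (0::complex)"
    proof eventually_elim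
      case (elim s)
      have "\<psi> s = \<psi> (- s)" by (rule inj_onD[OF \<epsilon>(2)]) (use elim in auto)
      then have "h (\<psi> s) = h (\<psi> (- s))" by (rule arg_cong)
      then show ?case using elim by simp
    qed
    then obtain e where e: "e > 0" "\<And>s::complex. dist s 0 < e \<Longrightarrow> s = 0" unfolding eventually_nhds_metric by blast
    have "of_real (e / 2) = (0::complex)" by (rule e(2)) (use e(1) in simp)
    then show False using e(1) by simp
  qed
  define k where "k = (LEAST n. \<exists>j. fps_nth (O' j) n \<noteq> 0)"
  have "\<exists>j. fps_nth (O' j) k \<noteq> 0" unfolding k_def by (rule LeastI_ex[OF ex])
  then obtain j0 where j0: "fps_nth (O' j0) k \<noteq> 0" by blast
  have lt: "fps_nth (O' j) n = 0" if "n < k" for n j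
    using not_less_Least[of n "\<lambda>n. \<exists>j. fps_nth (O' j) n \<noteq> 0"] that unfolding k_def by blast
  have k_odd: "odd k" using j0 unfolding O_nth by (auto split: if_splits)
  \<comment> \<open>Coordinates centred at p have order at least 2 on this branch, and composition
    with \<psi> keeps that, so their linear coefficients vanish.\<close>
  have "k \<noteq> 1"
  proof
    assume k1: "k = 1"
    let ?z = "\<lambda>z::complex^'n. z $ j0 - p $ j0"
    have o: "ordge 2 (T ?z i)" using ordge_branch_mult[OF coordinate_germ[of j0], of i] mm2 by simp
    have \<Psi>: "\<psi> has_fps_expansion fps_expansion \<psi> 0" by (rule analytic_at_imp_has_fps_expansion_0[OF \<psi>(1)])
    have "fps_nth (fps_expansion \<psi> 0) 0 = 0" using has_fps_expansion_imp_0_eq_fps_nth_0[OF \<Psi>] \<psi>(2) by simp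
    from has_fps_expansion_compose[OF T_expansion[OF coordinate_germ[of j0], of i] \<Psi> this]
    have "(\<lambda>s. \<nu> i (\<psi> s) $ j0 - p $ j0) has_fps_expansion fps_compose (T ?z i) (fps_expansion \<psi> 0)"
      by (simp add: comp_def)
    moreover have "(\<lambda>s. \<nu> i (\<psi> s) $ j0 - p $ j0) has_fps_expansion \<Gamma> j0 - fps_const (p $ j0)"
      by (intro has_fps_expansion_diff \<Gamma> has_fps_expansion_const)
    ultimately have "\<Gamma> j0 - fps_const (p $ j0) = fps_compose (T ?z i) (fps_expansion \<psi> 0)"
      using fps_expansion_unique_complex by blast
    then have "fps_nth (\<Gamma> j0 - fps_const (p $ j0)) 1 = fps_nth (fps_compose (T ?z i) (fps_expansion \<psi> 0)) 1"
      by (rule arg_cong)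
    also have "\<dots> = 0" using o unfolding fps_compose_nth ordge_def by (intro sum.neutral) auto
    finally show False using j0 k1 unfolding O_nth by simp
  qed
  then have k2: "k \<ge> 2" using k_odd by (cases k) auto
  define R where "R = (\<lambda>j. fps_shift k (O' j))"
  have OR: "O' j = fps_X ^ k * R j" for j
    unfolding R_def by (rule ordge_imp_factor) (simp add: ordge_def lt)
  have "fps_nth (E j) n = 0" if "\<not> 2 dvd n" for j n using that by (simp add: E_nth)
  then have "\<exists>a. a analytic_on {0} \<and> (\<lambda>s. a (s ^ 2)) has_fps_expansion E j" for j
    using expansion_in_power[of "E j" 2] Ee[of j] unfolding has_fps_expansion_def by (metis one_le_numeral)
  then obtain a where a: "\<And>j. a j analytic_on {0}" "\<And>j. (\<lambda>s. a j (s ^ 2)) has_fps_expansion E j" by metis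
  \<comment> \<open>Dividing an odd series by s^k with k odd leaves an even one.\<close>
  have "fps_nth (R j) n = 0" if "\<not> 2 dvd n" for j n using that k_odd by (simp add: R_def O_nth)
  moreover have "fps_conv_radius (R j) > 0" for j
    using Oe[of j] unfolding R_def has_fps_expansion_def by simp
  ultimately have "\<exists>b. b analytic_on {0} \<and> (\<lambda>s. b (s ^ 2)) has_fps_expansion R j" for j
    using expansion_in_power[of "R j" 2] by (metis one_le_numeral)
  then obtain b where b: "\<And>j. b j analytic_on {0}" "\<And>j. (\<lambda>s. b j (s ^ 2)) has_fps_expansion R j" by metis
  have b0: "b j0 0 \<noteq> 0"
    using has_fps_expansion_imp_0_eq_fps_nth_0[OF b(2)[of j0]] j0 by (simp add: R_def)
  have coord: "\<forall>\<^sub>F s in nhds 0. \<nu> i (\<psi> s) $ j = a j (s ^ 2) + s ^ k * b j (s ^ 2)" for j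
  proof (rule eventually_eq_expansion[OF \<Gamma>])
    show "(\<lambda>s. a j (s ^ 2) + s ^ k * b j (s ^ 2)) has_fps_expansion \<Gamma> j"
      unfolding \<Gamma>EO OR by (intro has_fps_expansion_add has_fps_expansion_mult has_fps_expansion_fps_X_power a b)
  qed
  define \<delta> :: "'r \<Rightarrow> complex \<Rightarrow> complex^2" where "\<delta> = (\<lambda>_ s. vector [\<i> * s ^ k, s ^ 2])"
  have \<delta>12: "\<delta> c s $ 1 = \<i> * s ^ k" "\<delta> c s $ 2 = s ^ 2" for c s unfolding \<delta>_def by simp_all
  have "germ_isomorphic p C (0 :: complex^2) {v. (v $ 1)\<^sup>2 + (v $ 2) ^ k = 0}"
  proof (rule plane_embedding[OF x, where \<psi> = "\<lambda>_. \<psi>" and h = "\<lambda>_. h" and \<delta> = \<delta> and a = a and b = b and ?j0.0 = j0])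
    show "analytic_curve (\<delta> c)" for c
      unfolding analytic_curve_def forall_2 \<delta>12 by (auto intro!: analytic_intros)
    show "\<delta> c 0 = 0" for c using k2 by (simp add: vec_eq_iff forall_2 \<delta>12)
    show "\<delta> c s \<in> {v. (v $ 1)\<^sup>2 + (v $ 2) ^ k = 0}" for c s
      by (simp add: \<delta>12 power_mult_distrib mult.commute flip: power_mult)
    show "\<forall>\<^sub>F s in nhds 0. \<nu> c (\<psi> s) $ j = a j (\<delta> c s $ 2) - \<i> * \<delta> c s $ 1 * b j (\<delta> c s $ 2)" for c j
      using coord[of j] unfolding one[of c i] \<delta>12 by eventually_elim (simp flip: mult.assoc)
    show "\<forall>\<^sub>F s in nhds 0. x (\<nu> c (\<psi> s)) = \<delta> c s $ 2" for c
      using xs unfolding one[of c i] \<delta>12 mm2 .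
    fix P :: "'r \<Rightarrow> complex \<Rightarrow> bool"
    assume P: "\<And>c. \<forall>\<^sub>F s in nhds 0. P c s"
    obtain e where e: "e > 0" "\<And>s. dist s 0 < e \<Longrightarrow> P i s" using P[of i] unfolding eventually_nhds_metric by blast
    have "filterlim (\<lambda>v::complex^2. v $ 2) (nhds 0) (nhds 0)"
      using tendsto_nhds_isCont[OF holomorphic_germ_continuous[OF holomorphic_germ_nth[of 0 2]]] by simp
    moreover have "\<forall>\<^sub>F y in nhds (0::complex). y \<in> ball 0 (e ^ 2)" by (rule eventually_nhds_in_open) (use e in auto)
    ultimately have "\<forall>\<^sub>F v in nhds (0::complex^2). v $ 2 \<in> ball 0 (e ^ 2)" by (rule eventually_compose_filterlim[rotated])
    then show "\<forall>\<^sub>F v in nhds 0. v \<in> {v. (v $ 1)\<^sup>2 + (v $ 2) ^ k = 0} \<longrightarrow> (\<exists>c s. P c s \<and> \<delta> c s = v)"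
    proof eventually_elim
      case (elim v)
      show ?case
      proof
        assume v: "v \<in> {v. (v $ 1)\<^sup>2 + (v $ 2) ^ k = 0}"
        \<comment> \<open>A root t of y determines w up to sign. As k is odd, replacing t by -t
          changes that sign and stays in the same small disc.\<close>
        define t where "t = csqrt (v $ 2)"
        have t2: "t ^ 2 = v $ 2" unfolding t_def by simp
        have "norm t ^ 2 < e ^ 2" using elim t2 by (simp flip: norm_power)
        then have nt: "norm t < e" using e(1) by (simp add: power_less_imp_less_base)
        have "(v $ 1)\<^sup>2 = - ((v $ 2) ^ k)" using v by (simp add: eq_neg_iff_add_eq_0)
        also have "\<dots> = - ((t ^ 2) ^ k)" unfolding t2 ..
        also have "\<dots> = (\<i> * t ^ k)\<^sup>2" by (simp add: power_mult_distrib mult.commute flip: power_mult)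
        finally consider "v $ 1 = \<i> * t ^ k" | "v $ 1 = - (\<i> * t ^ k)" unfolding power2_eq_iff by blast
        then show "\<exists>c s. P c s \<and> \<delta> c s = v"
        proof cases
          case 1
          then have "\<delta> i t = v" using t2 by (simp add: vec_eq_iff forall_2 \<delta>12)
          then show ?thesis using e(2)[of t] nt by auto
        next
          case 2
          then have "\<delta> i (- t) = v" using t2 k_odd by (simp add: vec_eq_iff forall_2 \<delta>12)
          then show ?thesis using e(2)[of "- t"] nt by auto
        qed
      qed
    qed
  qed (use \<psi> h \<psi>h a(1) b(1) b0 in auto)
  then show ?thesis using k2 by blast
qed

text \<open>Both branches are smooth and parametrized by y = s, so the antisymmetric part is half
  the difference of the two parametrizations. Its order q gives w = \<i> s^q on one branch and w =
  -\<i> s^q on the other, that is, k = 2 q.\<close>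

lemma double_point_two_branches:
  fixes i j :: 'r
  assumes ij: "i \<noteq> j" and M2: "M = 2"
  shows "\<exists>k\<ge>2. germ_isomorphic p C (0 :: complex^2) {v. (v $ 1)\<^sup>2 + (v $ 2) ^ k = 0}"
proof -
  \<comment> \<open>A third branch would make M at least 3.\<close>
  have U: "c = i \<or> c = j" for c
  proof (rule ccontr)
    assume "\<not> (c = i \<or> c = j)"
    then have "i \<noteq> c" "j \<noteq> c" by auto
    then have "(\<Sum>k\<in>{i, j, c}. branch_mult k) = branch_mult i + branch_mult j + branch_mult c" using ij by simp
    moreover have "(\<Sum>k\<in>{i, j, c}. branch_mult k) \<le> M" unfolding M_def by (rule sum_mono2) auto
    ultimately show False using branch_mult_ge_1[of i] branch_mult_ge_1[of j] branch_mult_ge_1[of c] M2 by linarith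
  qed
  have "(\<Sum>k\<in>{i, j}. branch_mult k) \<le> M" unfolding M_def by (rule sum_mono2) auto
  then have mmij: "branch_mult i = 1" "branch_mult j = 1" using ij M2 branch_mult_ge_1[of i] branch_mult_ge_1[of j] by simp_all
  then have mm1: "branch_mult c = 1" for c using U[of c] by auto
  obtain x where x: "holomorphic_germ p x" "x p = 0" and Tm: "\<forall>i. T x i \<noteq> 0 \<and> subdegree (T x i) = branch_mult i"
    by (rule generic_coordinate)
  have "\<forall>c. \<exists>h\<psi>. fst h\<psi> analytic_on {0} \<and> fst h\<psi> 0 = 0 \<and> snd h\<psi> analytic_on {0} \<and> snd h\<psi> 0 = 0 \<and>
      (\<forall>\<^sub>F t in nhds 0. snd h\<psi> (fst h\<psi> t) = t) \<and> (\<forall>\<^sub>F s in nhds 0. x (\<nu> c (snd h\<psi> s)) = s)"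
  proof
    fix c
    have "T x c \<noteq> 0" "subdegree (T x c) = branch_mult c" using Tm by blast+
    then obtain h \<psi> where "h analytic_on {0}" "h 0 = 0" "\<psi> analytic_on {0}" "\<psi> 0 = 0"
      "\<forall>\<^sub>F t in nhds 0. \<psi> (h t) = t" "\<forall>\<^sub>F s in nhds 0. x (\<nu> c (\<psi> s)) = s ^ branch_mult c"
      by (rule reparametrize_branch[OF x(1)])
    then show "\<exists>h\<psi>. fst h\<psi> analytic_on {0} \<and> fst h\<psi> 0 = 0 \<and> snd h\<psi> analytic_on {0} \<and> snd h\<psi> 0 = 0 \<and>
      (\<forall>\<^sub>F t in nhds 0. snd h\<psi> (fst h\<psi> t) = t) \<and> (\<forall>\<^sub>F s in nhds 0. x (\<nu> c (snd h\<psi> s)) = s)"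
      by (intro exI[of _ "(h, \<psi>)"]) (simp add: mm1)
  qed
  from choice[OF this] obtain h\<psi> where h\<psi>: "\<forall>c. fst (h\<psi> c) analytic_on {0} \<and> fst (h\<psi> c) 0 = 0 \<and>
      snd (h\<psi> c) analytic_on {0} \<and> snd (h\<psi> c) 0 = 0 \<and> (\<forall>\<^sub>F t in nhds 0. snd (h\<psi> c) (fst (h\<psi> c) t) = t) \<and>
      (\<forall>\<^sub>F s in nhds 0. x (\<nu> c (snd (h\<psi> c) s)) = s)" ..
  define h where "h = (\<lambda>c. fst (h\<psi> c))"
  define \<psi> where "\<psi> = (\<lambda>c. snd (h\<psi> c))"
  have h: "h c analytic_on {0}" "h c 0 = 0" and \<psi>: "\<psi> c analytic_on {0}" "\<psi> c 0 = 0"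
    and \<psi>h: "\<forall>\<^sub>F t in nhds 0. \<psi> c (h c t) = t" and xs: "\<forall>\<^sub>F s in nhds 0. x (\<nu> c (\<psi> c s)) = s" for c
    using h\<psi> unfolding h_def \<psi>_def by blast+
  define \<Gamma> where "\<Gamma> = (\<lambda>c l. fps_expansion (\<lambda>s. \<nu> c (\<psi> c s) $ l) 0)"
  have \<Gamma>: "(\<lambda>s. \<nu> c (\<psi> c s) $ l) has_fps_expansion \<Gamma> c l" for c l
    using analytic_curve_compose[OF nu_analytic \<psi>] unfolding \<Gamma>_def analytic_curve_def
    by (intro analytic_at_imp_has_fps_expansion_0) auto
  define E where "E = (\<lambda>l. fps_const (1/2) * (\<Gamma> i l + \<Gamma> j l))"
  define O' where "O' = (\<lambda>l. fps_const (1/2) * (\<Gamma> i l - \<Gamma> j l))"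
  have Ee: "(\<lambda>s. 1/2 * (\<nu> i (\<psi> i s) $ l + \<nu> j (\<psi> j s) $ l)) has_fps_expansion E l" for l
    unfolding E_def by (intro has_fps_expansion_cmult_left has_fps_expansion_add \<Gamma>)
  have Oe: "(\<lambda>s. 1/2 * (\<nu> i (\<psi> i s) $ l - \<nu> j (\<psi> j s) $ l)) has_fps_expansion O' l" for l
    unfolding O'_def by (intro has_fps_expansion_cmult_left has_fps_expansion_diff \<Gamma>)
  have \<Gamma>i: "\<Gamma> i l = E l + O' l" and \<Gamma>j: "\<Gamma> j l = E l - O' l" for l
    by (auto simp: E_def O'_def fps_eq_iff field_simps)
  \<comment> \<open>If the parametrizations agreed, an equation of branch j would vanish on branch
    i.\<close>
  have ex: "\<exists>n l. fps_nth (O' l) n \<noteq> 0"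
  proof (rule ccontr)
    assume "\<not> (\<exists>n l. fps_nth (O' l) n \<noteq> 0)"
    then have "O' l = 0" for l by (simp add: fps_eq_iff)
    then have "\<forall>\<^sub>F s in nhds 0. 1/2 * (\<nu> i (\<psi> i s) $ l - \<nu> j (\<psi> j s) $ l) = 0" for l
      using Oe[of l] by (simp add: has_fps_expansion_0_iff)
    then have "\<forall>\<^sub>F s in nhds 0. \<forall>l. 1/2 * (\<nu> i (\<psi> i s) $ l - \<nu> j (\<psi> j s) $ l) = 0"
      by (intro eventually_all_finite)
    then have e1: "\<forall>\<^sub>F s in nhds 0. \<nu> i (\<psi> i s) = \<nu> j (\<psi> j s)" by eventually_elim (simp add: vec_eq_iff)
    obtain f where f: "holomorphic_germ p f" "T f j = 0" "T f i \<noteq> 0" using separate_branches[OF ij] by blast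
    have "\<forall>\<^sub>F t in nhds 0. f (\<nu> j t) = 0" using f T_zero_iff by blast
    from eventually_compose_filterlim[OF this filterlim_analytic_0[OF \<psi>]] e1
    have "\<forall>\<^sub>F s in nhds 0. f (\<nu> i (\<psi> i s)) = 0" by eventually_elim simp
    then have "T f i = 0"
      by (rule germ_pulls_back_via_reparametrization[OF _ h \<psi>h f(1)])
    then show False using f by blast
  qed
  define q where "q = (LEAST n. \<exists>l. fps_nth (O' l) n \<noteq> 0)"
  have "\<exists>l. fps_nth (O' l) q \<noteq> 0" unfolding q_def by (rule LeastI_ex[OF ex])
  then obtain l0 where l0: "fps_nth (O' l0) q \<noteq> 0" by blast
  have lt: "fps_nth (O' l) n = 0" if "n < q" for n l
    using not_less_Least[of n "\<lambda>n. \<exists>l. fps_nth (O' l) n \<noteq> 0"] that unfolding q_def by blast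
  \<comment> \<open>Both branches pass through p at s = 0, so the difference has no constant
    term.\<close>
  have "q \<noteq> 0"
  proof
    assume "q = 0"
    then show False using l0 has_fps_expansion_imp_0_eq_fps_nth_0[OF Oe[of l0]] \<psi>(2) by simp
  qed
  then have q: "2 * q \<ge> 2" by simp
  define R where "R = (\<lambda>l. fps_shift q (O' l))"
  have OR: "O' l = fps_X ^ q * R l" for l
    unfolding R_def by (rule ordge_imp_factor) (simp add: ordge_def lt)
  have "\<exists>a. a analytic_on {0} \<and> a has_fps_expansion E l" for l
    using Ee[of l] has_fps_expansion_imp_analytic_0 by blast
  then obtain a where a: "\<And>l. a l analytic_on {0}" "\<And>l. a l has_fps_expansion E l" by metis
  have "fps_conv_radius (R l) > 0" for l
    using Oe[of l] unfolding R_def has_fps_expansion_def by simp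
  then have "\<exists>b. b analytic_on {0} \<and> b has_fps_expansion R l" for l
    using expansion_eval by metis
  then obtain b where b: "\<And>l. b l analytic_on {0}" "\<And>l. b l has_fps_expansion R l" by metis
  have b0: "b l0 0 \<noteq> 0"
    using has_fps_expansion_imp_0_eq_fps_nth_0[OF b(2)[of l0]] l0 by (simp add: R_def)
  have ci: "\<forall>\<^sub>F s in nhds 0. \<nu> i (\<psi> i s) $ l = a l s + s ^ q * b l s" for l
  proof (rule eventually_eq_expansion[OF \<Gamma>])
    show "(\<lambda>s. a l s + s ^ q * b l s) has_fps_expansion \<Gamma> i l"
      unfolding \<Gamma>i OR by (intro has_fps_expansion_add has_fps_expansion_mult has_fps_expansion_fps_X_power a b)
  qed
  have cj: "\<forall>\<^sub>F s in nhds 0. \<nu> j (\<psi> j s) $ l = a l s - s ^ q * b l s" for l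
  proof (rule eventually_eq_expansion[OF \<Gamma>])
    show "(\<lambda>s. a l s - s ^ q * b l s) has_fps_expansion \<Gamma> j l"
      unfolding \<Gamma>j OR by (intro has_fps_expansion_diff has_fps_expansion_mult has_fps_expansion_fps_X_power a b)
  qed
  \<comment> \<open>The unit \<i> is built into the sign so that -\<i> w b becomes s^q b on branch i
    and -s^q b on branch j.\<close>
  define sg :: "'r \<Rightarrow> complex" where "sg = (\<lambda>c. if c = i then \<i> else - \<i>)"
  have sg2: "sg c * sg c = -1" for c unfolding sg_def by simp
  define \<delta> :: "'r \<Rightarrow> complex \<Rightarrow> complex^2" where "\<delta> = (\<lambda>c s. vector [sg c * s ^ q, s])"
  have \<delta>12: "\<delta> c s $ 1 = sg c * s ^ q" "\<delta> c s $ 2 = s" for c s unfolding \<delta>_def by simp_all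
  have "germ_isomorphic p C (0 :: complex^2) {v. (v $ 1)\<^sup>2 + (v $ 2) ^ (2 * q) = 0}"
  proof (rule plane_embedding[OF x \<psi> h \<psi>h, where \<delta> = \<delta> and a = a and b = b and ?j0.0 = l0])
    show "analytic_curve (\<delta> c)" for c
      unfolding analytic_curve_def forall_2 \<delta>12 by (auto intro!: analytic_intros)
    show "\<delta> c 0 = 0" for c using q by (simp add: vec_eq_iff forall_2 \<delta>12)
    show "\<delta> c s \<in> {v. (v $ 1)\<^sup>2 + (v $ 2) ^ (2 * q) = 0}" for c s
    proof -
      have "(sg c * s ^ q)\<^sup>2 = (sg c * sg c) * s ^ (2 * q)"
        by (simp only: power_mult_distrib power_even_eq) (simp only: power2_eq_square)
      then show ?thesis unfolding sg2 by (simp add: \<delta>12)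
    qed
    show "\<forall>\<^sub>F s in nhds 0. \<nu> c (\<psi> c s) $ l = a l (\<delta> c s $ 2) - \<i> * \<delta> c s $ 1 * b l (\<delta> c s $ 2)" for c l
    proof (cases "c = i")
      case True
      show ?thesis using ci[of l] unfolding True \<delta>12 sg_def by eventually_elim (simp flip: mult.assoc)
    next
      case False
      then have c: "c = j" using U by blast
      show ?thesis using cj[of l] unfolding c \<delta>12 sg_def by eventually_elim (use ij in \<open>simp flip: mult.assoc\<close>)
    qed
    show "\<forall>\<^sub>F s in nhds 0. x (\<nu> c (\<psi> c s)) = \<delta> c s $ 2" for c unfolding \<delta>12 by (rule xs)
    fix P :: "'r \<Rightarrow> complex \<Rightarrow> bool"
    assume P: "\<And>c. \<forall>\<^sub>F s in nhds 0. P c s"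
    have "filterlim (\<lambda>v::complex^2. v $ 2) (nhds 0) (nhds 0)"
      using tendsto_nhds_isCont[OF holomorphic_germ_continuous[OF holomorphic_germ_nth[of 0 2]]] by simp
    then have "\<forall>\<^sub>F v in nhds (0::complex^2). P i (v $ 2)" "\<forall>\<^sub>F v in nhds (0::complex^2). P j (v $ 2)"
      by (rule eventually_compose_filterlim[OF P])+
    then show "\<forall>\<^sub>F v in nhds 0. v \<in> {v. (v $ 1)\<^sup>2 + (v $ 2) ^ (2 * q) = 0} \<longrightarrow> (\<exists>c s. P c s \<and> \<delta> c s = v)"
    proof eventually_elim
      case (elim v)
      show ?case
      proof
        assume v: "v \<in> {v. (v $ 1)\<^sup>2 + (v $ 2) ^ (2 * q) = 0}"
        have "(v $ 1)\<^sup>2 = - ((v $ 2) ^ (2 * q))" using v by (simp add: eq_neg_iff_add_eq_0)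
        also have "\<dots> = (\<i> * (v $ 2) ^ q)\<^sup>2" by (simp add: power_mult_distrib mult.commute flip: power_mult)
        finally consider "v $ 1 = \<i> * (v $ 2) ^ q" | "v $ 1 = - (\<i> * (v $ 2) ^ q)" unfolding power2_eq_iff by blast
        then show "\<exists>c s. P c s \<and> \<delta> c s = v"
        proof cases
          case 1
          then have "\<delta> i (v $ 2) = v" by (simp add: vec_eq_iff forall_2 \<delta>12 sg_def)
          then show ?thesis using elim by blast
        next
          case 2
          then have "\<delta> j (v $ 2) = v" using ij by (simp add: vec_eq_iff forall_2 \<delta>12 sg_def)
          then show ?thesis using elim by blast
        qed
      qed
    qed
  qed (use a(1) b(1) b0 in auto)
  then show ?thesis using q by blast
qed

end

theorem proposition1p3p2:
  fixes p :: "complex^'n" and C :: "(complex^'n) set"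
    and B :: "'r::finite \<Rightarrow> (complex^'n) set" and \<nu> :: "'r \<Rightarrow> complex \<Rightarrow> complex^'n"
  assumes "curve_singularity p C B \<nu>"
  shows
    "((trivial_group (reduced_lattice_cohomology0 p C \<nu>) \<longleftrightarrow> smooth_curve_germ p C) \<and>
      (smooth_curve_germ p C \<longleftrightarrow> multiplicity_curve p C = 1)) \<and>
     (((\<not> trivial_group (reduced_lattice_cohomology0 p C \<nu>) \<and>
        (\<forall>n<0. trivial_group (lattice_cohomology0 p C \<nu> n))) \<longleftrightarrow> multiplicity_curve p C = 2) \<and>
      ((\<forall>n<0. trivial_group (lattice_cohomology0 p C \<nu> n)) \<longleftrightarrow> min_weight p C \<nu> \<ge> 0) \<and>
      (multiplicity_curve p C = 2 \<longrightarrow>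
        (\<exists>k\<ge>2. germ_isomorphic p C (0 :: complex^2) {v. (v $ 1)\<^sup>2 + (v $ 2) ^ k = 0}))) \<and>
     (((\<exists>n<0. \<not> trivial_group (lattice_cohomology0 p C \<nu> n)) \<longleftrightarrow> multiplicity_curve p C > 2) \<and>
      ((\<exists>n<0. \<not> trivial_group (lattice_cohomology0 p C \<nu> n)) \<longleftrightarrow> min_weight p C \<nu> < 0))"
proof -
  interpret curve p C B \<nu> by unfold_locales (rule assms)
  have red: "trivial_group (reduced_lattice_cohomology0 p C \<nu>) \<longleftrightarrow> M = 1" by (rule reduced_trivial_iff_M)
  have neg: "(\<forall>n<0. trivial_group (lattice_cohomology0 p C \<nu> n)) \<longleftrightarrow> M \<le> 2" by (rule negative_part_trivial_iff_M)
  have neg': "(\<exists>n<0. \<not> trivial_group (lattice_cohomology0 p C \<nu> n)) \<longleftrightarrow> \<not> M \<le> 2" using neg by blast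
  have min: "min_weight p C \<nu> \<ge> 0 \<longleftrightarrow> M \<le> 2" using neg negative_part_trivial_iff by blast
  have smooth: "smooth_curve_germ p C \<longleftrightarrow> M = 1" using smooth_imp_M M_imp_smooth by blast
  \<comment> \<open>M = 2 leaves two cases: a single branch of multiplicity 2, or two smooth
    branches.\<close>
  have double: "\<exists>k\<ge>2. germ_isomorphic p C (0 :: complex^2) {v. (v $ 1)\<^sup>2 + (v $ 2) ^ k = 0}" if "M = 2"
  proof (cases "\<forall>i j :: 'r. i = j")
    case True
    then show ?thesis using double_point_unibranch that by blast
  next
    case False
    then show ?thesis using double_point_two_branches that by blast
  qed
  have "M = 1 \<or> M = 2 \<or> M > 2" using M_pos by linarith
  then show ?thesis
    unfolding red neg neg' smooth multiplicity_eq min using min double M_pos by (auto simp: not_less not_le)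
qed

end
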